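(* Let $\{X_t\}_{t\in\mathbb Z}$ be the CEStGM process (see context) with interaction kernel $R$, and suppose $R$ is Hilbert–Schmidt, i.e. $\int_{\mathcal X\times\mathcal X}R(x,y)^2\,\mu(dx)\mu(dy)<\infty$. Then for each $a\in[p]$, $$\mathcal F^{(a)}\perp\!\!\!\perp\mathcal F^{\mathcal N_a'}\mid\mathcal F^{\mathcal N_a}.$$ In particular the pairwise Markov property holds: if $b\in[p]\setminus\{a\}$ and $b\notin\mathcal N_a$, then $\mathcal F^{(a)}\perp\!\!\!\perp\mathcal F^{(b)}\mid\mathcal F^{V\setminus\{a,b\}}$, where $V=[p]$.
   Context: Setting. Let $p\ge1$, $[p]=\{1,\ldots,p\}$. For $a\in[p]$ let $\mathcal X^{(a)}\subseteq\mathbb R$ be measurable with a sigma-finite measure $\mu_a$; $\mathcal X=\prod_a\mathcal X^{(a)}$, $\mu=\otimes_a\mu_a$. For each $a$ let $K_a\ge1$, $\mathbf s^{(a)}:\mathcal X^{(a)}\to\mathbb R^{K_a}$ and $c^{(a)}:\mathcal X^{(a)}\to\mathbb R$ be measurable, $\boldsymbol\theta^{(a)}\in\mathbb R^{K_a}$, and let $\Phi_\ell^{(a,b)}$ ($\ell\in\{-1,0,1\}$) be real $K_a\times K_b$ matrices with $\Phi_0^{(a,a)}=0$, $(\Phi_0^{(a,b)})^\top=\Phi_0^{(b,a)}$, $(\Phi_{-1}^{(a,b)})^\top=\Phi_1^{(b,a)}$. Let $\Psi_\ell=(\Phi_\ell^{(a,b)})_{a,b\in[p]}$ be the block matrices,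 $\mathbf s(x)$ the concatenation of $\mathbf s^{(1)}(x^{(1)}),\ldots,\mathbf s^{(p)}(x^{(p)})$, and $\boldsymbol\theta$ the concatenation of $\boldsymbol\theta^{(1)},\ldots,\boldsymbol\theta^{(p)}$. Interaction kernel: $R(x,y)=G(x)^{1/2}H(x,y)G(y)^{1/2}$ with $G(x)=\exp\big(\boldsymbol\theta^\top\mathbf s(x)+\tfrac12\mathbf s(x)^\top\Psi_0\mathbf s(x)+\sum_{a}c^{(a)}(x^{(a)})\big)$, $H(x,y)=\exp(\mathbf s(x)^\top\Psi_1\mathbf s(y))$. Let $T(f)[y]=\int R(x,y)f(x)\mu(dx)$ on $L^2(\mathcal X,\mu)$. (The Hilbert–Schmidt condition implies $T$ is compact.) CEStGM process: when $T$ is compact, the unique (in law) strictly stationary process $X_t=(X_t^{(1)},\ldots,X_t^{(p)})$, $t\in\mathbb Z$, whose joint density for $(X_m,\ldots,X_{m+n-1})$ (any $m\in\mathbb Z$, $n\ge1$) with respect to the $n$-fold product of $\mu$ is $r^{-(n-1)}v(x_1)\prod_{t=2}^nR(x_{t-1},x_t)\,w(x_n)$, where $r>0$ is the spectral radius of $T$ and $v,w$ are the a.e. positive eigenfunctions of $T$ and $T^*$ for the eigenvalue $r$ (unique up to scaling, by Krein–Rutman), scaled so that $\langle v,w\rangle=1$. It satisfies: the conditional density of $X_t^{(a)}$ given all other $X_\tau^{(b)}$, $(b,\tau)\ne(a,t)$, is proportional to $\exp\big(\mathbf s^{(a)}(x_t^{(a)})^\top\boldsymbol\Theta_a+c^{(a)}(x_t^{(a)})\big)$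 with $\boldsymbol\Theta_a=\boldsymbol\theta^{(a)}+\sum_{b\ne a}\Phi_0^{(a,b)}\mathbf s^{(b)}(x_t^{(b)})+\sum_{b\in[p]}[\Phi_{-1}^{(a,b)}\mathbf s^{(b)}(x_{t-1}^{(b)})+\Phi_1^{(a,b)}\mathbf s^{(b)}(x_{t+1}^{(b)})]$. The basic natural exponential model with conditional densities proportional to $\exp(\theta^{(a)}s_a(x_t^{(a)})+x_t^{(a)}\Theta_a+c_a(x_t^{(a)}))$, where $\Theta_a$ is linear in the neighbours $x_\tau^{(b)}$ with scalar coefficients $\Phi_\ell^{(a,b)}$, is the special case in which only the statistic $x$ interacts. Neighbourhoods: $\mathcal N_a=\{b\in[p]\setminus\{a\}:\Phi_0^{(a,b)}\ne0\text{ or }\Phi_1^{(a,b)}\ne0\text{ or }\Phi_{-1}^{(a,b)}\ne0\}$ and $\mathcal N_a'=[p]\setminus(\mathcal N_a\cup\{a\})$. Sigma-algebras: for $K\subseteq[p]$, $\mathcal F^K=\sigma(X_t^{(b)}:t\in\mathbb Z,b\in K)$, and $\mathcal F^{(a)}=\mathcal F^{\{a\}}$. Conditional independence $\mathcal G_1\perp\!\!\!\perp\mathcal G_2\mid\mathcal G_3$ means $\mathrm E[m_1m_2\mid\mathcal G_3]=\mathrm E[m_1\mid\mathcal G_3]\,\mathrm E[m_2\mid\mathcal G_3]$ a.s. for all bounded positive $\mathcal G_i$-measurable $m_i$, $i=1,2$. *)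

theory Defs
  imports "HOL-Probability.Probability"
begin

section \<open>Parameters of the model\<close>

text \<open>
  Components are numbered by \<open>a \<in> {1..ncomp P}\<close>.  The set $X^{(a)}$ is \<open>space (ref_measure P a)\<close>.
  As the dimensions $K_a$ vary with \<open>a\<close>, vectors and matrices are functions of their
  indices, and only the entries with indices in \<open>{1..stat_dim P a}\<close> are ever used:
  \<open>suff_stat P a x j\<close> is $s^{(a)}_j(x)$ and \<open>interact P l a b j k\<close> is
  the entry $(j,k)$ of $\Phi_l^{(a,b)}$, for \<open>l \<in> {-1, 0, 1}\<close>.
\<close>

record stgm =
  ncomp :: nat
  ref_measure :: "nat \<Rightarrow> real measure"
  stat_dim :: "nat \<Rightarrow> nat"
  suff_stat :: "nat \<Rightarrow> real \<Rightarrow> nat \<Rightarrow> real"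
  base_fun :: "nat \<Rightarrow> real \<Rightarrow> real"
  nat_param :: "nat \<Rightarrow> nat \<Rightarrow> real"
  interact :: "int \<Rightarrow> nat \<Rightarrow> nat \<Rightarrow> nat \<Rightarrow> nat \<Rightarrow> real"

definition comps :: "stgm \<Rightarrow> nat set" where
  "comps P = {1..ncomp P}"

definition valid_stgm :: "stgm \<Rightarrow> bool" where
  "valid_stgm P \<longleftrightarrow>
     ncomp P \<ge> 1 \<and>
     (\<forall>a\<in>comps P.
        space (ref_measure P a) \<in> sets borel \<and>
        sets (ref_measure P a) = sets (restrict_space borel (space (ref_measure P a))) \<and>
        sigma_finite_measure (ref_measure P a) \<and>
        stat_dim P a \<ge> 1 \<and>
        (\<forall>j\<in>{1..stat_dim P a}. (\<lambda>x. suff_stat P a x j) \<in> borel_measurable (ref_measure P a)) \<and>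
        base_fun P a \<in> borel_measurable (ref_measure P a)) \<and>
     (\<forall>a\<in>comps P. \<forall>j\<in>{1..stat_dim P a}. \<forall>k\<in>{1..stat_dim P a}. interact P 0 a a j k = 0) \<and>
     (\<forall>a\<in>comps P. \<forall>b\<in>comps P. \<forall>j\<in>{1..stat_dim P a}. \<forall>k\<in>{1..stat_dim P b}.
        interact P 0 a b j k = interact P 0 b a k j \<and>
        interact P (-1) a b j k = interact P 1 b a k j)"

definition state_measure :: "stgm \<Rightarrow> (nat \<Rightarrow> real) measure" where
  "state_measure P = PiM (comps P) (ref_measure P)"


section \<open>Interaction kernel\<close>

text \<open>
  Concatenated vectors and block matrices are indexed by pairs \<open>(a, j)\<close>,
  where \<open>a\<close> is the block and \<open>j\<close> the position inside the block.
\<close>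

definition block_index :: "stgm \<Rightarrow> (nat \<times> nat) set" where
  "block_index P = (SIGMA a:comps P. {1..stat_dim P a})"

definition concat_stat :: "stgm \<Rightarrow> (nat \<Rightarrow> real) \<Rightarrow> nat \<times> nat \<Rightarrow> real" where
  "concat_stat P x = (\<lambda>(a, j). suff_stat P a (x a) j)"

definition concat_param :: "stgm \<Rightarrow> nat \<times> nat \<Rightarrow> real" where
  "concat_param P = (\<lambda>(a, j). nat_param P a j)"

definition block_matrix :: "stgm \<Rightarrow> int \<Rightarrow> nat \<times> nat \<Rightarrow> nat \<times> nat \<Rightarrow> real" where
  "block_matrix P l = (\<lambda>(a, j) (b, k). interact P l a b j k)"

definition quad :: "stgm \<Rightarrow> int \<Rightarrow> (nat \<Rightarrow> real) \<Rightarrow> (nat \<Rightarrow> real) \<Rightarrow> real" where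
  "quad P l x y = (\<Sum>i\<in>block_index P. \<Sum>j\<in>block_index P.
      concat_stat P x i * block_matrix P l i j * concat_stat P y j)"

definition G_fun :: "stgm \<Rightarrow> (nat \<Rightarrow> real) \<Rightarrow> real" where
  "G_fun P x = exp ((\<Sum>i\<in>block_index P. concat_param P i * concat_stat P x i)
      + quad P 0 x x / 2 + (\<Sum>a\<in>comps P. base_fun P a (x a)))"

definition H_fun :: "stgm \<Rightarrow> (nat \<Rightarrow> real) \<Rightarrow> (nat \<Rightarrow> real) \<Rightarrow> real" where
  "H_fun P x y = exp (quad P 1 x y)"

definition interaction_kernel :: "stgm \<Rightarrow> (nat \<Rightarrow> real) \<Rightarrow> (nat \<Rightarrow> real) \<Rightarrow> real" where
  "interaction_kernel P x y = sqrt (G_fun P x) * H_fun P x y * sqrt (G_fun P y)"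

definition hilbert_schmidt :: "'a measure \<Rightarrow> ('a \<Rightarrow> 'a \<Rightarrow> real) \<Rightarrow> bool" where
  "hilbert_schmidt M k \<longleftrightarrow> (\<integral>\<^sup>+ (x, y). ennreal ((k x y)\<^sup>2) \<partial>(M \<Otimes>\<^sub>M M)) < \<infinity>"


section \<open>Operators on square integrable functions\<close>

text \<open>
  Elements of $L^2$ are represented by functions, and equality in $L^2$ is almost everywhere
  equality.  The scalars are either real or complex: eigenfunctions are real, and the spectrum
  of an integral operator with real kernel is that of its extension to complex functions.
\<close>

definition L2_space :: "'a measure \<Rightarrow> ('a \<Rightarrow> 'b::{banach, second_countable_topology}) set" where
  "L2_space M = {f \<in> borel_measurable M. integrable M (\<lambda>x. (norm (f x))\<^sup>2)}"

definition L2_norm :: "'a measure \<Rightarrow> ('a \<Rightarrow> 'b::{banach, second_countable_topology}) \<Rightarrow> real" where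
  "L2_norm M f = sqrt (\<integral>x. (norm (f x))\<^sup>2 \<partial>M)"

definition L2_inner :: "'a measure \<Rightarrow> ('a \<Rightarrow> real) \<Rightarrow> ('a \<Rightarrow> real) \<Rightarrow> real" where
  "L2_inner M f g = (\<integral>x. f x * g x \<partial>M)"

text \<open>The integration is over the first argument of the kernel.\<close>

definition kernel_op ::
    "'a measure \<Rightarrow> ('a \<Rightarrow> 'a \<Rightarrow> real) \<Rightarrow> ('a \<Rightarrow> 'b::{banach, second_countable_topology}) \<Rightarrow> 'a \<Rightarrow> 'b" where
  "kernel_op M k f y = (\<integral>x. k x y *\<^sub>R f x \<partial>M)"

text \<open>The scalars \<open>z\<close> for which \<open>z - T\<close> is a bijection of $L^2$ with bounded inverse.\<close>

definition L2_resolvent_set :: "'a measure \<Rightarrow> (('a \<Rightarrow> complex) \<Rightarrow> 'a \<Rightarrow> complex) \<Rightarrow> complex set" where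
  "L2_resolvent_set M T = {z. \<exists>C. \<forall>g\<in>L2_space M. \<exists>f\<in>L2_space M.
      (AE x in M. z * f x - T f x = g x) \<and>
      L2_norm M f \<le> C * L2_norm M g \<and>
      (\<forall>h\<in>L2_space M. (AE x in M. z * h x - T h x = g x) \<longrightarrow> (AE x in M. h x = f x))}"

definition L2_spectrum :: "'a measure \<Rightarrow> (('a \<Rightarrow> complex) \<Rightarrow> 'a \<Rightarrow> complex) \<Rightarrow> complex set" where
  "L2_spectrum M T = - L2_resolvent_set M T"

definition L2_spectral_radius :: "'a measure \<Rightarrow> (('a \<Rightarrow> complex) \<Rightarrow> 'a \<Rightarrow> complex) \<Rightarrow> real" where
  "L2_spectral_radius M T = Sup (cmod ` L2_spectrum M T)"

definition eigenfunction :: "'a measure \<Rightarrow> (('a \<Rightarrow> real) \<Rightarrow> 'a \<Rightarrow> real) \<Rightarrow> real \<Rightarrow> ('a \<Rightarrow> real) \<Rightarrow> bool" where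
  "eigenfunction M T r f \<longleftrightarrow>
     f \<in> L2_space M \<and> \<not> (AE x in M. f x = 0) \<and> (AE x in M. T f x = r * f x)"

text \<open>
  An eigenfunction of the Hilbert space adjoint $T^*$: the equation $T^* g = r g$ is stated
  through the defining property of the adjoint, \<open>\<langle>T f, g\<rangle> = \<langle>f, T\<^sup>* g\<rangle>\<close> for all \<open>f\<close>.
\<close>

definition adjoint_eigenfunction ::
    "'a measure \<Rightarrow> (('a \<Rightarrow> real) \<Rightarrow> 'a \<Rightarrow> real) \<Rightarrow> real \<Rightarrow> ('a \<Rightarrow> real) \<Rightarrow> bool" where
  "adjoint_eigenfunction M T r g \<longleftrightarrow>
     g \<in> L2_space M \<and> \<not> (AE x in M. g x = 0) \<and>
     (\<forall>f\<in>L2_space M. L2_inner M (T f) g = L2_inner M f (\<lambda>x. r * g x))"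


section \<open>The stationary process\<close>

definition strictly_stationary :: "'w measure \<Rightarrow> 's measure \<Rightarrow> (int \<Rightarrow> 'w \<Rightarrow> 's) \<Rightarrow> bool" where
  "strictly_stationary M S X \<longleftrightarrow>
     (\<forall>t. X t \<in> measurable M S) \<and>
     (\<forall>h. distr M (PiM UNIV (\<lambda>_. S)) (\<lambda>\<omega> t. X (t + h) \<omega>)
        = distr M (PiM UNIV (\<lambda>_. S)) (\<lambda>\<omega> t. X t \<omega>))"

text \<open>
  The eigenfunctions \<open>v\<close> and \<open>w\<close> are unique up to scaling, so the density below does not
  depend on their choice once \<open>L2_inner \<mu> v w = 1\<close>.  The window $(x_1,\dots,x_n)$ is a
  function on \<open>{1..n}\<close>.
\<close>

definition cestgm_process :: "stgm \<Rightarrow> 'w measure \<Rightarrow> (int \<Rightarrow> 'w \<Rightarrow> nat \<Rightarrow> real) \<Rightarrow> bool" where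
  "cestgm_process P M X \<longleftrightarrow>
     (let \<mu> = state_measure P; R = interaction_kernel P;
          r = L2_spectral_radius \<mu> (kernel_op \<mu> R)
      in prob_space M \<and> strictly_stationary M \<mu> X \<and> r > 0 \<and>
         (\<exists>v w. eigenfunction \<mu> (kernel_op \<mu> R) r v \<and>
            adjoint_eigenfunction \<mu> (kernel_op \<mu> R) r w \<and>
            (AE x in \<mu>. v x > 0) \<and> (AE x in \<mu>. w x > 0) \<and>
            L2_inner \<mu> v w = 1 \<and>
            (\<forall>m. \<forall>n\<ge>1. distributed M (PiM {1..n} (\<lambda>_. \<mu>))
               (\<lambda>\<omega>. \<lambda>i\<in>{1..n}. X (m + int i - 1) \<omega>)
               (\<lambda>x. ennreal (inverse (r ^ (n - 1)) * v (x 1)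
                       * (\<Prod>t=2..n. R (x (t - 1)) (x t)) * w (x n))))))"


section \<open>Neighbourhoods, sigma-algebras and conditional independence\<close>

definition nonzero_block :: "stgm \<Rightarrow> int \<Rightarrow> nat \<Rightarrow> nat \<Rightarrow> bool" where
  "nonzero_block P l a b \<longleftrightarrow>
     (\<exists>j\<in>{1..stat_dim P a}. \<exists>k\<in>{1..stat_dim P b}. interact P l a b j k \<noteq> 0)"

definition nbhd :: "stgm \<Rightarrow> nat \<Rightarrow> nat set" where
  "nbhd P a = {b \<in> comps P - {a}.
      nonzero_block P 0 a b \<or> nonzero_block P 1 a b \<or> nonzero_block P (-1) a b}"

definition non_nbhd :: "stgm \<Rightarrow> nat \<Rightarrow> nat set" where
  "non_nbhd P a = comps P - (nbhd P a \<union> {a})"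

definition comp_algebra :: "'w measure \<Rightarrow> (int \<Rightarrow> 'w \<Rightarrow> nat \<Rightarrow> real) \<Rightarrow> nat set \<Rightarrow> 'w measure" where
  "comp_algebra M X K = sigma (space M)
      {(\<lambda>\<omega>. X t \<omega> b) -` A \<inter> space M | t b A. b \<in> K \<and> A \<in> sets borel}"

definition cond_indep :: "'w measure \<Rightarrow> 'w measure \<Rightarrow> 'w measure \<Rightarrow> 'w measure \<Rightarrow> bool" where
  "cond_indep M G1 G2 G3 \<longleftrightarrow>
     subalgebra M G1 \<and> subalgebra M G2 \<and> subalgebra M G3 \<and>
     (\<forall>m1\<in>borel_measurable G1. \<forall>m2\<in>borel_measurable G2.
        (\<forall>\<omega>\<in>space M. 0 \<le> m1 \<omega>) \<longrightarrow> bounded (m1 ` space M) \<longrightarrow>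
        (\<forall>\<omega>\<in>space M. 0 \<le> m2 \<omega>) \<longrightarrow> bounded (m2 ` space M) \<longrightarrow>
        (AE \<omega> in M. real_cond_exp M G3 (\<lambda>\<omega>. m1 \<omega> * m2 \<omega>) \<omega>
            = real_cond_exp M G3 m1 \<omega> * real_cond_exp M G3 m2 \<omega>))"

end

theory Submission
  imports Defs
begin

text \<open>
  Fix \<open>a\<close>, a set \<open>B\<close> of components that do not interact with \<open>a\<close>, and let \<open>S\<close> be the remaining
  components. On a time window $[-L,L]$ the only factors of the density which mix \<open>a\<close> and \<open>B\<close>
  are the two eigenfunctions at the ends, so \<open>a\<close> and \<open>B\<close> are conditionally independent inside
  $(-n,n)$ given \<open>S\<close> and everything at the times $n \<le> |t| \<le> L$. Call $E_n$ the conditional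
  expectation given the latter. The $L^2$ norm of $E_n m$ decreases in $n$, so for large $L$ some
  $E_n m$ is close to $E_{n+1} m$. By the Markov property $E_n m$ is, given \<open>S\<close>, a function of
  the times $\<plusminus>n$, and $E_{n+1} m$ is one of the times $\<plusminus>(n+1)$. As the kernel is positive, these two
  become conditionally independent given \<open>S\<close> after an equivalent change of measure,
  which by stationarity is uniformly controlled in $n$; hence both are close to a function of \<open>S\<close>,
  and $E_n$ can be replaced by the conditional expectation given \<open>S\<close> on the window. Martingale
  convergence as $L \<rightarrow> \<infinity>$ concludes.
\<close>

section \<open>Conditional expectations\<close>

text \<open>Letting n grow under the conditioning would require that, up to null sets, the
  intersection over n of the sigma-algebras generated by S and the far times is the one generated by
  S. Intersections and joins of sigma-algebras do not commute in general, so the limit is replaced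
  by an estimate at one finite level. The squared L^2 distances between $E_n m$ and $E_{n+1} m$
  telescope to at most 1, for two functions together to at most 2; so among the L - k - 1 levels
  between k and L there is one where both distances are at most 2 / (L - k - 1). Both functions must
  share this level because the exact factorisation is used there. The kernel need be neither bounded
  nor bounded away from 0, so the change of measure is made only where the states at the times -n-1,
  -n, n, n+1 have size at most b. Passing to the new measure and back costs one factor \<kappa>
  each, depending on b but not on n or L; the excluded event costs four tails of the one-time
  marginal. Hence b is chosen first, for the tails, and L afterwards, to beat the square of
  \<kappa>.\<close>

context finite_measure
begin

lemma finite_measure_subalgebraI:
  "subalgebra M G \<Longrightarrow> finite_measure_subalgebra M G"
  by unfold_locales

lemma real_cond_exp_unit_interval:
  assumes "subalgebra M G" "f \<in> borel_measurable M" "\<And>x. 0 \<le> f x" "\<And>x. f x \<le> (1::real)"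
  shows "AE x in M. 0 \<le> real_cond_exp M G f x \<and> real_cond_exp M G f x \<le> 1"
proof -
  interpret finite_measure_subalgebra M G by (rule finite_measure_subalgebraI) fact
  have "integrable M f" using assms by (auto intro!: integrable_const_bound[where B=1])
  then show ?thesis
    using real_cond_exp_ge_c[of f 0] real_cond_exp_le_c[of f 1] assms by auto
qed

text \<open>\<open>real_cond_exp M G f - c\<close> is \<open>G\<close>-measurable and hence
  orthogonal to \<open>f - real_cond_exp M G f\<close>. With \<open>c = 0\<close> this gives the
  drop of the norm under further conditioning, in general the optimality of the conditional
  expectation among \<open>G\<close>-measurable approximations. A finite measure is allowed because
  the weighted measure in \<open>decoupling\<close> is not normalised.\<close>

lemma real_cond_exp_pythagoras:
  fixes f c :: "'a \<Rightarrow> real"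
  assumes G: "subalgebra M G"
    and [measurable]: "f \<in> borel_measurable M" "c \<in> borel_measurable G"
    and f: "AE x in M. 0 \<le> f x \<and> f x \<le> 1" and c: "AE x in M. 0 \<le> c x \<and> c x \<le> 1"
  shows "(\<integral>x. (f x - c x)\<^sup>2 \<partial>M)
    = (\<integral>x. (f x - real_cond_exp M G f x)\<^sup>2 \<partial>M) + (\<integral>x. (real_cond_exp M G f x - c x)\<^sup>2 \<partial>M)"
proof -
  interpret finite_measure_subalgebra M G by (rule finite_measure_subalgebraI) fact
  define e where "e = real_cond_exp M G f"
  have [measurable]: "c \<in> borel_measurable M" "e \<in> borel_measurable M" "e \<in> borel_measurable G"
    using measurable_from_subalg[OF G assms(3)] by (auto simp: e_def)
  have fi: "integrable M f"
    using f by (auto intro!: integrable_const_bound[where B=1])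
  have e: "AE x in M. 0 \<le> e x \<and> e x \<le> 1"
    unfolding e_def using real_cond_exp_ge_c[OF fi, of 0] real_cond_exp_le_c[OF fi, of 1] f by auto
  have prod_integrable: "integrable M (\<lambda>x. p x * q x)"
    if [measurable]: "p \<in> borel_measurable M" "q \<in> borel_measurable M"
      and "AE x in M. norm (p x) \<le> 1" "AE x in M. norm (q x) \<le> 1" for p q :: "'a \<Rightarrow> real"
  proof (rule integrable_const_bound)
    show "AE x in M. norm (p x * q x) \<le> 1"
      using that(3,4) by eventually_elim (simp add: abs_mult mult_le_one)
  qed measurable
  have diff_bound: "AE x in M. norm (p x - q x) \<le> 1"
    if "AE x in M. 0 \<le> p x \<and> p x \<le> 1" "AE x in M. 0 \<le> q x \<and> q x \<le> 1" for p q :: "'a \<Rightarrow> real"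
    using that by eventually_elim auto
  note d = diff_bound[OF f e] diff_bound[OF e c] diff_bound[OF f c]
  have n: "AE x in M. norm (f x) \<le> 1" "AE x in M. norm (e x) \<le> 1"
    using f e by auto
  have [measurable, simp]: "integrable M (\<lambda>x. (f x - e x)\<^sup>2)" "integrable M (\<lambda>x. (e x - c x)\<^sup>2)"
      "integrable M (\<lambda>x. (e x - c x) * (f x - e x))"
      "integrable M (\<lambda>x. (e x - c x) * f x)" "integrable M (\<lambda>x. (e x - c x) * e x)"
    unfolding power2_eq_square by (intro prod_integrable d n; measurable)+
  have "(\<integral>x. (e x - c x) * (f x - e x) \<partial>M) = (\<integral>x. (e x - c x) * f x \<partial>M) - (\<integral>x. (e x - c x) * e x \<partial>M)"
    by (simp add: right_diff_distrib flip: Bochner_Integration.integral_diff)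
  also have "\<dots> = 0"
    using real_cond_exp_intg(2)[of "\<lambda>x. e x - c x" f] by (simp add: e_def[symmetric])
  finally have cross: "(\<integral>x. (e x - c x) * (f x - e x) \<partial>M) = 0" .
  have "(\<integral>x. (f x - c x)\<^sup>2 \<partial>M)
      = (\<integral>x. ((f x - e x)\<^sup>2 + (e x - c x)\<^sup>2) + 2 * ((e x - c x) * (f x - e x)) \<partial>M)"
    by (intro Bochner_Integration.integral_cong refl) (simp add: power2_eq_square algebra_simps)
  also have "\<dots> = (\<integral>x. (f x - e x)\<^sup>2 \<partial>M) + (\<integral>x. (e x - c x)\<^sup>2 \<partial>M)"
    using cross by simp
  finally show ?thesis by (simp add: e_def)
qed

text \<open>Conditioning preserves order, and \<open>f\<close> lies between plus and minus its
  absolute value.\<close>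

lemma integral_abs_real_cond_exp_le:
  assumes G: "subalgebra M G" and f: "integrable M (f :: 'a \<Rightarrow> real)"
  shows "(\<integral>x. \<bar>real_cond_exp M G f x\<bar> \<partial>M) \<le> (\<integral>x. \<bar>f x\<bar> \<partial>M)"
proof -
  interpret finite_measure_subalgebra M G by (rule finite_measure_subalgebraI) fact
  have af: "integrable M (\<lambda>x. \<bar>f x\<bar>)" "integrable M (\<lambda>x. - \<bar>f x\<bar>)" using f by auto
  have "AE x in M. real_cond_exp M G (\<lambda>x. - \<bar>f x\<bar>) x \<le> real_cond_exp M G f x"
    "AE x in M. real_cond_exp M G f x \<le> real_cond_exp M G (\<lambda>x. \<bar>f x\<bar>) x"
    using f af by (auto intro!: real_cond_exp_mono)
  moreover have "AE x in M. real_cond_exp M G (\<lambda>x. - \<bar>f x\<bar>) x = - real_cond_exp M G (\<lambda>x. \<bar>f x\<bar>) x"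
    using real_cond_exp_cmult[OF af(1), of "-1"] by simp
  ultimately have "AE x in M. \<bar>real_cond_exp M G f x\<bar> \<le> real_cond_exp M G (\<lambda>x. \<bar>f x\<bar>) x"
    by eventually_elim auto
  then have "(\<integral>x. \<bar>real_cond_exp M G f x\<bar> \<partial>M) \<le> (\<integral>x. real_cond_exp M G (\<lambda>x. \<bar>f x\<bar>) x \<partial>M)"
    using f af by (intro integral_mono_AE) (auto simp: real_cond_exp_int(1))
  also have "\<dots> = (\<integral>x. \<bar>f x\<bar> \<partial>M)"
    by (rule real_cond_exp_int(2)[OF af(1)])
  finally show ?thesis .
qed

section \<open>From generating families to sigma-algebras\<close>

lemma set_integral_eq_on_generated_algebra:
  fixes f g :: "'a \<Rightarrow> real"
  assumes G: "subalgebra M G" and E: "Int_stable E" "space M \<in> E" "sets G = sigma_sets (space M) E"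
    and f: "integrable M f" and g: "integrable M g"
    and eq: "\<And>A. A \<in> E \<Longrightarrow> (\<integral>x\<in>A. f x \<partial>M) = (\<integral>x\<in>A. g x \<partial>M)"
    and A: "A \<in> sets G"
  shows "(\<integral>x\<in>A. f x \<partial>M) = (\<integral>x\<in>A. g x \<partial>M)"
proof -
  have sub: "sigma_sets (space M) E \<subseteq> sets M"
    using G E by (auto simp: subalgebra_def)
  have EP: "E \<subseteq> Pow (space M)"
    using sub sets.sets_into_space by (blast intro: sigma_sets.Basic)
  from E(1) EP A[unfolded E(3)] show ?thesis
  proof (induction rule: sigma_sets_induct_disjoint)
    case (basic A) then show ?case by (rule eq)
  next
    case empty then show ?case by (simp add: set_lebesgue_integral_def)
  next
    \<comment> \<open>The complement is taken inside \<open>space M\<close>, over which the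
      integrals agree because it belongs to \<open>E\<close>.\<close>
    case (compl A)
    then have A[measurable]: "A \<in> sets M" using sub by auto
    have "(\<integral>x\<in>space M - A. h x \<partial>M) = (\<integral>x\<in>space M. h x \<partial>M) - (\<integral>x\<in>A. h x \<partial>M)"
      if "integrable M h" for h :: "'a \<Rightarrow> real"
    proof -
      have "(\<integral>x\<in>(space M - A) \<union> A. h x \<partial>M) = (\<integral>x\<in>space M - A. h x \<partial>M) + (\<integral>x\<in>A. h x \<partial>M)"
        using that by (intro set_integral_Un) (auto simp: set_integrable_def intro!: integrable_mult_indicator[where 'b=real, unfolded real_scaleR_def])
      moreover have "(space M - A) \<union> A = space M" using sets.sets_into_space[OF A] by auto
      ultimately show ?thesis by simp
    qed
    then show ?case using f g compl eq[OF E(2)] by simp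
  next
    case (union A)
    then have A[measurable]: "\<And>i. A i \<in> sets M" using sub by auto
    have "(\<integral>x\<in>\<Union>(range A). h x \<partial>M) = (\<Sum>i. (\<integral>x\<in>A i. h x \<partial>M))"
      if "integrable M h" for h :: "'a \<Rightarrow> real"
      using that union(1)
      by (intro lebesgue_integral_countable_add)
        (auto simp: set_integrable_def disjoint_family_on_def intro!: integrable_mult_indicator[where 'b=real, unfolded real_scaleR_def] sets.countable_UN)
    then show ?case using f g union by simp
  qed
qed

text \<open>Agreement on the generators extends to all of \<open>G\<close>, so \<open>f\<close> and
  \<open>g\<close> have the same conditional expectation given \<open>G\<close>, and a bounded
  \<open>G\<close>-measurable factor sees nothing else. This avoids approximating \<open>h\<close>
  by simple functions.\<close>

lemma integral_mult_eq_on_generated_algebra: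
  fixes f g h :: "'a \<Rightarrow> real"
  assumes G: "subalgebra M G" and E: "Int_stable E" "space M \<in> E" "sets G = sigma_sets (space M) E"
    and f: "integrable M f" and g: "integrable M g"
    and eq: "\<And>A. A \<in> E \<Longrightarrow> (\<integral>x\<in>A. f x \<partial>M) = (\<integral>x\<in>A. g x \<partial>M)"
    and h[measurable]: "h \<in> borel_measurable G" and hb: "\<And>x. x \<in> space M \<Longrightarrow> \<bar>h x\<bar> \<le> b"
  shows "(\<integral>x. h x * f x \<partial>M) = (\<integral>x. h x * g x \<partial>M)"
proof -
  interpret finite_measure_subalgebra M G by (rule finite_measure_subalgebraI) fact
  have hM[measurable]: "h \<in> borel_measurable M" using measurable_from_subalg[OF G h] .
  have int: "integrable M (\<lambda>x. h x * u x)" if "integrable M u" for u :: "'a \<Rightarrow> real"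
  proof (rule Bochner_Integration.integrable_bound)
    show "integrable M (\<lambda>x. b * u x)" using that by simp
    have "\<bar>h x\<bar> * \<bar>u x\<bar> \<le> \<bar>b\<bar> * \<bar>u x\<bar>" if "x \<in> space M" for x
      using hb[OF that] by (intro mult_right_mono) auto
    then show "AE x in M. norm (h x * u x) \<le> norm (b * u x)"
      by (auto simp: abs_mult)
  qed (use that in simp)
  have "AE x in M. real_cond_exp M G f x = real_cond_exp M G g x"
  proof (rule real_cond_exp_charact)
    fix A assume A: "A \<in> sets G"
    show "(\<integral>x\<in>A. f x \<partial>M) = (\<integral>x\<in>A. real_cond_exp M G g x \<partial>M)"
      using set_integral_eq_on_generated_algebra[OF G E f g eq A] real_cond_exp_intA[OF g A] by simp
  qed (use f g in auto)
  then have "(\<integral>x. h x * real_cond_exp M G f x \<partial>M) = (\<integral>x. h x * real_cond_exp M G g x \<partial>M)"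
    by (intro integral_cong_AE) auto
  then show ?thesis
    using f g int by (simp add: real_cond_exp_intg)
qed

section \<open>Upward martingale convergence in L^1\<close>

lemma upward_cond_exp_approx:
  fixes F :: "nat \<Rightarrow> 'a measure" and f :: "'a \<Rightarrow> real"
  assumes F: "\<And>n. subalgebra M (F n)" and G: "subalgebra M G"
    and mono: "\<And>m n. m \<le> n \<Longrightarrow> sets (F m) \<subseteq> sets (F n)"
    and gen: "sets G = sigma_sets (space M) (\<Union>n. sets (F n))"
    and f: "integrable M f" "f \<in> borel_measurable G" and e: "0 < e"
  obtains n g where "g \<in> borel_measurable (F n)" "integrable M g" "(\<integral>x. \<bar>f x - g x\<bar> \<partial>M) < e"
proof -
  \<comment> \<open>The functions with this property form a linear space closed under L^1 limits;
    indicators of sets in \<open>G\<close> enter by a pi-lambda argument, integrable functions by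
    approximation.\<close>
  define approx where "approx = (\<lambda>u::'a \<Rightarrow> real. integrable M u \<and>
    (\<forall>e>0. \<exists>n g. g \<in> borel_measurable (F n) \<and> integrable M g \<and> (\<integral>x. \<bar>u x - g x\<bar> \<partial>M) < e))"
  have F_mono: "g \<in> borel_measurable (F n)" if "g \<in> borel_measurable (F m)" "m \<le> n" for m n and g :: "'a \<Rightarrow> real"
  proof (rule measurable_from_subalg[OF _ that(1)])
    show "subalgebra (F n) (F m)"
      using mono[OF that(2)] F[of m] F[of n] by (simp add: subalgebra_def)
  qed
  have approxE: thesis
    if "approx u" "0 < e" "\<And>n g. g \<in> borel_measurable (F n) \<Longrightarrow> integrable M g \<Longrightarrow> (\<integral>x. \<bar>u x - g x\<bar> \<partial>M) < e \<Longrightarrow> thesis"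
    for u e thesis
    using that unfolding approx_def by blast
  have approx_integrable: "integrable M u" if "approx u" for u
    using that by (simp add: approx_def)
  have approx_add: "approx (\<lambda>x. u x + v x)" if u: "approx u" and v: "approx v" for u v
    unfolding approx_def
  proof (intro conjI allI impI)
    note int = approx_integrable[OF u] approx_integrable[OF v]
    show "integrable M (\<lambda>x. u x + v x)" using int by simp
    fix e :: real assume "0 < e"
    then have e2: "0 < e/2" by simp
    obtain m g where g: "g \<in> borel_measurable (F m)" "integrable M g" "(\<integral>x. \<bar>u x - g x\<bar> \<partial>M) < e/2"
      by (rule approxE[OF u e2])
    obtain n h where h: "h \<in> borel_measurable (F n)" "integrable M h" "(\<integral>x. \<bar>v x - h x\<bar> \<partial>M) < e/2"
      by (rule approxE[OF v e2])
    have "(\<integral>x. \<bar>u x + v x - (g x + h x)\<bar> \<partial>M) \<le> (\<integral>x. \<bar>u x - g x\<bar> + \<bar>v x - h x\<bar> \<partial>M)"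
      using int g(2) h(2) by (intro integral_mono) auto
    also have "\<dots> = (\<integral>x. \<bar>u x - g x\<bar> \<partial>M) + (\<integral>x. \<bar>v x - h x\<bar> \<partial>M)"
      using int g(2) h(2) by (intro Bochner_Integration.integral_add) auto
    also have "\<dots> < e" using g h by simp
    finally show "\<exists>n k. k \<in> borel_measurable (F n) \<and> integrable M k \<and> (\<integral>x. \<bar>u x + v x - k x\<bar> \<partial>M) < e"
      using g(2) h(2) F_mono[OF g(1), of "max m n"] F_mono[OF h(1), of "max m n"]
      by (intro exI[of _ "max m n"] exI[of _ "\<lambda>x. g x + h x"]) simp
  qed
  have approx_cmult: "approx (\<lambda>x. c * u x)" if u: "approx u" for u and c :: real
    unfolding approx_def
  proof (intro conjI allI impI)
    show "integrable M (\<lambda>x. c * u x)" using approx_integrable[OF u] by simp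
    fix e :: real assume e: "0 < e"
    \<comment> \<open>The added 1 covers the case \<open>c = 0\<close>.\<close>
    then have e': "0 < e / (\<bar>c\<bar> + 1)" by (simp add: add_nonneg_pos)
    obtain m g where g: "g \<in> borel_measurable (F m)" "integrable M g" "(\<integral>x. \<bar>u x - g x\<bar> \<partial>M) < e / (\<bar>c\<bar> + 1)"
      by (rule approxE[OF u e'])
    have "\<bar>c * u x - c * g x\<bar> = \<bar>c\<bar> * \<bar>u x - g x\<bar>" for x
      by (metis abs_mult right_diff_distrib)
    then have "(\<integral>x. \<bar>c * u x - c * g x\<bar> \<partial>M) = \<bar>c\<bar> * (\<integral>x. \<bar>u x - g x\<bar> \<partial>M)"
      by simp
    also have "\<dots> \<le> (\<bar>c\<bar> + 1) * (\<integral>x. \<bar>u x - g x\<bar> \<partial>M)"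
      by (intro mult_right_mono) auto
    also have "\<dots> < e"
      using g(3) pos_less_divide_eq[of "\<bar>c\<bar> + 1"] by (simp add: mult.commute)
    finally show "\<exists>n k. k \<in> borel_measurable (F n) \<and> integrable M k \<and> (\<integral>x. \<bar>c * u x - k x\<bar> \<partial>M) < e"
      using g by (intro exI[of _ m] exI[of _ "\<lambda>x. c * g x"]) auto
  qed
  have approx_lim: "approx u"
    if u: "integrable M u" and s: "\<And>i::nat. approx (s i)" and lim: "(\<lambda>i. \<integral>x. \<bar>u x - s i x\<bar> \<partial>M) \<longlonglongrightarrow> 0" for u s
    unfolding approx_def
  proof (intro conjI allI impI)
    fix e :: real assume e: "0 < e"
    then have "\<forall>\<^sub>F i in sequentially. (\<integral>x. \<bar>u x - s i x\<bar> \<partial>M) < e/2"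
      using order_tendstoD(2)[OF lim, of "e/2"] by simp
    then obtain i where i: "(\<integral>x. \<bar>u x - s i x\<bar> \<partial>M) < e/2"
      by (auto simp: eventually_sequentially)
    obtain n g where g: "g \<in> borel_measurable (F n)" "integrable M g" "(\<integral>x. \<bar>s i x - g x\<bar> \<partial>M) < e/2"
      by (rule approxE[OF s[of i] half_gt_zero[OF e]])
    have si: "integrable M (s i)" by (rule approx_integrable[OF s])
    have "(\<integral>x. \<bar>u x - g x\<bar> \<partial>M) \<le> (\<integral>x. \<bar>u x - s i x\<bar> + \<bar>s i x - g x\<bar> \<partial>M)"
      using u si g by (intro integral_mono) auto
    also have "\<dots> = (\<integral>x. \<bar>u x - s i x\<bar> \<partial>M) + (\<integral>x. \<bar>s i x - g x\<bar> \<partial>M)"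
      using u si g by (auto intro!: Bochner_Integration.integral_add)
    also have "\<dots> < e" using g i by simp
    finally show "\<exists>n g. g \<in> borel_measurable (F n) \<and> integrable M g \<and> (\<integral>x. \<bar>u x - g x\<bar> \<partial>M) < e"
      using g by blast
  qed (fact u)
  have approx_F: "approx u" if "u \<in> borel_measurable (F n)" "integrable M u" for u n
    unfolding approx_def
  proof (intro conjI allI impI)
    fix e :: real assume "0 < e"
    with that show "\<exists>n g. g \<in> borel_measurable (F n) \<and> integrable M g \<and> (\<integral>x. \<bar>u x - g x\<bar> \<partial>M) < e"
      by (intro exI[of _ n] exI[of _ u]) simp
  qed (fact that)
  have sub: "sigma_sets (space M) (\<Union>n. sets (F n)) \<subseteq> sets M"
    using G gen by (auto simp: subalgebra_def)
  have approx_ind: "approx (indicator A)" if "A \<in> sets G" for A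
  proof -
    have "Int_stable (\<Union>n. sets (F n))"
    proof (rule Int_stableI)
      fix A B assume "A \<in> (\<Union>n. sets (F n))" "B \<in> (\<Union>n. sets (F n))"
      then obtain m n where "A \<in> sets (F m)" "B \<in> sets (F n)" by auto
      then have "A \<in> sets (F (max m n))" "B \<in> sets (F (max m n))"
        using mono[of m "max m n"] mono[of n "max m n"] by auto
      then show "A \<inter> B \<in> (\<Union>n. sets (F n))" by blast
    qed
    moreover have "(\<Union>n. sets (F n)) \<subseteq> Pow (space M)"
      using F sets.sets_into_space by (fastforce simp: subalgebra_def)
    ultimately show ?thesis
      using that[unfolded gen]
    proof (induction rule: sigma_sets_induct_disjoint)
      case (basic A)
      then obtain n where n: "A \<in> sets (F n)" by auto
      then have "A \<in> sets M" using F by (auto simp: subalgebra_def)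
      with n show ?case
        by (intro approx_F[of _ n]) (auto intro!: integrable_const_bound[where B=1])
    next
      case empty
      show ?case by (intro approx_F[of _ 0]) auto
    next
      case (compl A)
      then have "A \<in> sets M" using sub by auto
      have one: "approx (indicator (space M))"
        using F[of 0] sets.top[of "F 0"] by (intro approx_F[of _ 0]) (auto simp: subalgebra_def intro!: integrable_const_bound[where B=1])
      have eq: "indicator (space M - A) = (\<lambda>x. indicator (space M) x + (-1) * indicator A x :: real)"
        using sets.sets_into_space[OF \<open>A \<in> sets M\<close>] by (auto simp: indicator_def fun_eq_iff)
      show ?case
        unfolding eq by (rule approx_add[OF one approx_cmult[OF compl(2)]])
    next
      case (union A)
      then have A[measurable]: "\<And>i. A i \<in> sets M" using sub by auto
      have partial: "approx (\<lambda>x. \<Sum>i<k. indicator (A i) x)" for k :: nat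
      proof (induction k)
        case 0
        show ?case by (intro approx_F[of _ 0]) auto
      next
        case (Suc k)
        show ?case using approx_add[OF Suc union(3)[of k]] by simp
      qed
      show ?case
      proof (rule approx_lim[OF _ partial])
        show "integrable M (indicator (\<Union>(range A)) :: 'a \<Rightarrow> real)"
          by (auto intro!: integrable_const_bound[where B=1] sets.countable_UN)
        have "(\<lambda>k. \<integral>x. \<bar>indicator (\<Union>(range A)) x - (\<Sum>i<k. indicator (A i) x)\<bar> \<partial>M) \<longlonglongrightarrow> (\<integral>x. (0::real) \<partial>M)"
        proof (rule integral_dominated_convergence[where w="\<lambda>_. 1"])
          have sums: "(\<lambda>i. indicator (A i) x) sums (indicator (\<Union>(range A)) x :: real)" for x
            using indicator_sums[of A x] union(1) by (simp add: disjoint_family_on_def)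
          show "AE x in M. (\<lambda>k. \<bar>indicator (\<Union>(range A)) x - (\<Sum>i<k. indicator (A i) x)\<bar>) \<longlonglongrightarrow> (0::real)"
            using sums by (intro AE_I2 tendsto_rabs_zero) (auto simp: sums_def intro!: tendsto_eq_intros)
          fix k
          have *: "(\<Sum>i<k. indicator (A i) x) \<le> (indicator (\<Union>(range A)) x :: real)" for x
            using sum_le_suminf[OF sums_summable[OF sums], of "{..<k}" x] sums_unique[OF sums, of x] by simp
          have "\<bar>indicator (\<Union>(range A)) x - (\<Sum>i<k. indicator (A i) x)\<bar> \<le> (1::real)" for x
          proof -
            have "0 \<le> (\<Sum>i<k. indicator (A i) x :: real)" by (intro sum_nonneg) simp
            moreover have "indicator (\<Union>(range A)) x \<le> (1::real)" by (rule indicator_le_1)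
            ultimately show ?thesis using *[of x] by linarith
          qed
          then show "AE x in M. norm \<bar>(indicator (\<Union>(range A)) x :: real) - (\<Sum>i<k. indicator (A i) x)\<bar> \<le> 1"
            by auto
        qed auto
        then show "(\<lambda>k. \<integral>x. \<bar>indicator (\<Union>(range A)) x - (\<Sum>i<k. indicator (A i) x)\<bar> \<partial>M) \<longlonglongrightarrow> (0::real)"
          by simp
      qed
    qed
  qed
  \<comment> \<open>The induction runs over the measure restricted to \<open>G\<close>, so that its
    base case meets only sets in \<open>G\<close>.\<close>
  have fG: "integrable (restr_to_subalg M G) f"
    using f G by (intro integrable_in_subalg)
  then have "approx f"
  proof (induction rule: integrable_induct)
    case (base A c)
    then have "A \<in> sets G" using sets_restr_to_subalg[OF G] by auto
    from approx_cmult[OF approx_ind[OF this], of c] show ?case by (simp add: mult.commute)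
  next
    case (add f g)
    then show ?case by (intro approx_add)
  next
    case (lim f s)
    have fM: "integrable M f" "\<And>i. integrable M (s i)"
      using lim.hyps(1,4) by (auto intro: integrable_from_subalg[OF G])
    have sp: "space (restr_to_subalg M G) = space M" by (rule space_restr_to_subalg)
    show ?case
    proof (rule approx_lim[OF fM(1) lim.IH])
      have "(\<lambda>i. \<integral>x. \<bar>f x - s i x\<bar> \<partial>M) \<longlonglongrightarrow> (\<integral>x. (0::real) \<partial>M)"
      \<comment> \<open>The approximants supplied by the induction satisfy
        \<open>norm (s i x) \<le> 2 * norm (f x)\<close>, hence the factor 3.\<close>
      proof (rule integral_dominated_convergence[where w="\<lambda>x. 3 * \<bar>f x\<bar>"])
        show "AE x in M. (\<lambda>i. \<bar>f x - s i x\<bar>) \<longlonglongrightarrow> 0"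
          using lim.hyps(2) sp by (intro AE_I2 tendsto_rabs_zero) (auto intro!: tendsto_eq_intros)
        fix i
        have "norm \<bar>f x - s i x\<bar> \<le> 3 * \<bar>f x\<bar>" if "x \<in> space M" for x
          using lim.hyps(3)[of x i] that sp by auto
        then show "AE x in M. norm \<bar>f x - s i x\<bar> \<le> 3 * \<bar>f x\<bar>"
          by auto
      qed (use fM in auto)
      then show "(\<lambda>i. \<integral>x. \<bar>f x - s i x\<bar> \<partial>M) \<longlonglongrightarrow> 0" by simp
    qed
  qed
  then show thesis
    by (rule approxE[OF _ e that])
qed

text \<open>Let u = E[f | G] and let g be close to u and measurable at level N. Conditioning at a
  level n beyond N fixes g, so E[f | F n] - u = E[u - g | F n] - (u - g), and both terms are bounded
  in L^1 by the distance of u and g.\<close>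

lemma upward_cond_exp_tendsto:
  fixes F :: "nat \<Rightarrow> 'a measure" and f :: "'a \<Rightarrow> real"
  assumes F: "\<And>n. subalgebra M (F n)" and G: "subalgebra M G"
    and mono: "\<And>m n. m \<le> n \<Longrightarrow> sets (F m) \<subseteq> sets (F n)"
    and gen: "sets G = sigma_sets (space M) (\<Union>n. sets (F n))"
    and f: "integrable M f"
  shows "(\<lambda>n. \<integral>x. \<bar>real_cond_exp M (F n) f x - real_cond_exp M G f x\<bar> \<partial>M) \<longlonglongrightarrow> 0"
proof (rule LIMSEQ_I)
  fix e :: real assume e: "0 < e"
  interpret G: finite_measure_subalgebra M G by (rule finite_measure_subalgebraI) fact
  define u where "u = real_cond_exp M G f"
  have u: "integrable M u" "u \<in> borel_measurable G"
    using f by (auto simp: u_def intro: G.real_cond_exp_int)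
  obtain N g where g: "g \<in> borel_measurable (F N)" "integrable M g" "(\<integral>x. \<bar>u x - g x\<bar> \<partial>M) < e/2"
    using upward_cond_exp_approx[OF F G mono gen u half_gt_zero[OF e]] by blast
  have "(\<integral>x. \<bar>real_cond_exp M (F n) f x - u x\<bar> \<partial>M) < e" if n: "N \<le> n" for n
  proof -
    interpret Fn: finite_measure_subalgebra M "F n" by (rule finite_measure_subalgebraI) fact
    have gn: "g \<in> borel_measurable (F n)"
      using g(1) n mono[of N n] F[of N] F[of n] by (auto simp: measurable_def subalgebra_def)
    have sub: "subalgebra G (F n)"
      using F[of n] G gen by (auto simp: subalgebra_def)
    have "AE x in M. real_cond_exp M (F n) u x = real_cond_exp M (F n) f x"
      unfolding u_def by (rule Fn.real_cond_exp_nested_subalg[OF G sub f])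
    moreover have "AE x in M. real_cond_exp M (F n) g x = g x"
      by (rule Fn.real_cond_exp_F_meas[OF g(2) gn])
    moreover have "AE x in M. real_cond_exp M (F n) (\<lambda>x. u x - g x) x = real_cond_exp M (F n) u x - real_cond_exp M (F n) g x"
      by (rule Fn.real_cond_exp_diff[OF u(1) g(2)])
    ultimately have ae: "AE x in M. \<bar>real_cond_exp M (F n) f x - u x\<bar>
        \<le> \<bar>real_cond_exp M (F n) (\<lambda>x. u x - g x) x\<bar> + \<bar>u x - g x\<bar>"
      by eventually_elim auto
    have int: "integrable M (real_cond_exp M (F n) f)" "integrable M (real_cond_exp M (F n) (\<lambda>x. u x - g x))"
      using f u g by (auto intro!: Fn.real_cond_exp_int(1))
    have "(\<integral>x. \<bar>real_cond_exp M (F n) f x - u x\<bar> \<partial>M)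
        \<le> (\<integral>x. \<bar>real_cond_exp M (F n) (\<lambda>x. u x - g x) x\<bar> + \<bar>u x - g x\<bar> \<partial>M)"
      using ae int u g by (intro integral_mono_AE) auto
    also have "\<dots> = (\<integral>x. \<bar>real_cond_exp M (F n) (\<lambda>x. u x - g x) x\<bar> \<partial>M) + (\<integral>x. \<bar>u x - g x\<bar> \<partial>M)"
      using int u g by (auto intro!: Bochner_Integration.integral_add)
    also have "\<dots> \<le> (\<integral>x. \<bar>u x - g x\<bar> \<partial>M) + (\<integral>x. \<bar>u x - g x\<bar> \<partial>M)"
      using integral_abs_real_cond_exp_le[OF F[of n], of "\<lambda>x. u x - g x"] u g by auto
    also have "\<dots> < e" using g by simp
    finally show ?thesis .
  qed
  then show "\<exists>N. \<forall>n\<ge>N. norm ((\<integral>x. \<bar>real_cond_exp M (F n) f x - real_cond_exp M G f x\<bar> \<partial>M) - 0) < e"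
    by (auto simp: u_def[symmetric])
qed

end

text \<open>Each argument is released from its generators in turn: first the event of
  \<open>G1\<close>, then that of \<open>G2\<close>, finally the test event of \<open>G3\<close>. At
  each stage the identity is an equality of integrals against one factor, so the pi-lambda argument
  concerns that factor alone.\<close>

lemma (in finite_measure) cond_indep_from_generators:
  assumes G: "subalgebra M G1" "subalgebra M G2" "subalgebra M G3"
    and E1: "Int_stable E1" "space M \<in> E1" "sets G1 = sigma_sets (space M) E1"
    and E2: "Int_stable E2" "space M \<in> E2" "sets G2 = sigma_sets (space M) E2"
    and E3: "Int_stable E3" "space M \<in> E3" "sets G3 = sigma_sets (space M) E3"
    and eq: "\<And>A B D. A \<in> E1 \<Longrightarrow> B \<in> E2 \<Longrightarrow> D \<in> E3 \<Longrightarrow>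
      (\<integral>x. indicator D x * (indicator A x * indicator B x) \<partial>M)
      = (\<integral>x. indicator D x * (real_cond_exp M G3 (indicator A) x * real_cond_exp M G3 (indicator B) x) \<partial>M)"
  shows "cond_indep M G1 G2 G3"
proof -
  interpret finite_measure_subalgebra M G3 by (rule finite_measure_subalgebraI) fact
  define bnd where "bnd = (\<lambda>f::'a \<Rightarrow> real. f \<in> borel_measurable M \<and> (\<exists>b. AE x in M. \<bar>f x\<bar> \<le> b))"
  have bnd_meas[measurable_dest]: "f \<in> borel_measurable M" if "bnd f" for f
    using that by (simp add: bnd_def)
  have bnd_int: "integrable M f" if "bnd f" for f
    using that by (auto simp: bnd_def intro!: integrable_const_bound)
  have bnd_mult: "bnd (\<lambda>x. f x * g x)" if fg: "bnd f" "bnd g" for f g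
  proof -
    obtain b c where "AE x in M. \<bar>f x\<bar> \<le> b" "AE x in M. \<bar>g x\<bar> \<le> c"
      using fg unfolding bnd_def by blast
    then have "AE x in M. \<bar>f x * g x\<bar> \<le> b * c"
      by eventually_elim (auto simp: abs_mult intro!: mult_mono)
    then show ?thesis using fg by (auto simp: bnd_def)
  qed
  have bnd_ind: "bnd (indicator A)" if "A \<in> sets M" for A
    using that by (auto simp: bnd_def intro!: exI[of _ 1])
  have bnd_cond: "bnd (real_cond_exp M G3 f)" if f: "bnd f" for f
  proof -
    obtain b where b: "AE x in M. \<bar>f x\<bar> \<le> b" using f by (auto simp: bnd_def)
    then have "AE x in M. - b \<le> f x" "AE x in M. f x \<le> b" by auto
    then have "AE x in M. \<bar>real_cond_exp M G3 f x\<bar> \<le> b"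
      using real_cond_exp_ge_c[OF bnd_int[OF f], of "- b"] real_cond_exp_le_c[OF bnd_int[OF f], of b] by auto
    then show ?thesis by (auto simp: bnd_def)
  qed
  have cond_int: "(\<integral>x. g x * f x \<partial>M) = (\<integral>x. g x * real_cond_exp M G3 f x \<partial>M)"
    if "bnd f" "bnd g" "g \<in> borel_measurable G3" for f g
    using real_cond_exp_intg(2)[of g f] that bnd_int[OF bnd_mult] by (simp add: bnd_meas)
  have E_sets: "A \<in> sets M" if "A \<in> E1 \<or> A \<in> E2 \<or> A \<in> E3" for A
    using that E1(3) E2(3) E3(3) G by (auto simp: subalgebra_def)
  have E3_G3: "A \<in> sets G3" if "A \<in> E3" for A
    using that E3(3) by auto
  \<comment> \<open>Against a \<open>G3\<close>-measurable weight only one of the two factors has to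
    be conditioned. The right-hand side then contains the raw \<open>f\<close> linearly, which is
    the form that extends from generators.\<close>
  have move: "(\<integral>x. indicator D x * (f x * real_cond_exp M G3 g x) \<partial>M)
      = (\<integral>x. indicator D x * (real_cond_exp M G3 f x * real_cond_exp M G3 g x) \<partial>M)"
    if D: "D \<in> sets G3" and fg: "bnd f" "bnd g" for D f g
  proof -
    have DM: "D \<in> sets M" using D G(3) by (auto simp: subalgebra_def)
    have [measurable]: "(\<lambda>x. indicator D x * real_cond_exp M G3 g x) \<in> borel_measurable G3"
      using D by measurable
    show ?thesis
      using cond_int[OF fg(1) bnd_mult[OF bnd_ind[OF DM] bnd_cond[OF fg(2)]]] by (simp add: ac_simps)
  qed
  show ?thesis
    unfolding cond_indep_def
  proof (intro conjI ballI impI G)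
    fix m1 m2 :: "'a \<Rightarrow> real"
    assume m1[measurable]: "m1 \<in> borel_measurable G1" and m2[measurable]: "m2 \<in> borel_measurable G2"
      and "bounded (m1 ` space M)" "bounded (m2 ` space M)"
    then obtain b1 b2 where b1: "\<And>x. x \<in> space M \<Longrightarrow> \<bar>m1 x\<bar> \<le> b1" and b2: "\<And>x. x \<in> space M \<Longrightarrow> \<bar>m2 x\<bar> \<le> b2"
      by (auto simp: bounded_iff)
    have bnd_m: "bnd m1" "bnd m2"
      using measurable_from_subalg[OF G(1) m1] measurable_from_subalg[OF G(2) m2] b1 b2
      by (auto simp: bnd_def)
    note bnds = bnd_m bnd_m[THEN bnd_cond] bnd_int bnd_mult bnd_ind bnd_cond E_sets
    have 1: "(\<integral>x. indicator D x * (m1 x * indicator B x) \<partial>M)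
        = (\<integral>x. indicator D x * (real_cond_exp M G3 m1 x * indicator B x) \<partial>M)"
      if B: "B \<in> E2" and D: "D \<in> E3" for B D
    proof -
      have "(\<integral>x. m1 x * (indicator D x * indicator B x) \<partial>M)
          = (\<integral>x. m1 x * (indicator D x * real_cond_exp M G3 (indicator B) x) \<partial>M)"
      proof (rule integral_mult_eq_on_generated_algebra[OF G(1) E1 _ _ _ m1 b1])
        fix A assume A: "A \<in> E1"
        show "(\<integral>x\<in>A. indicator D x * indicator B x \<partial>M)
          = (\<integral>x\<in>A. indicator D x * real_cond_exp M G3 (indicator B) x \<partial>M)"
          using eq[OF A B D] move[OF E3_G3[OF D] bnd_ind bnd_ind, of A B] A B E_sets
          by (simp add: set_lebesgue_integral_def ac_simps)
      qed (use B D in \<open>auto intro!: bnds\<close>)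
      also have "\<dots> = (\<integral>x. indicator D x * (real_cond_exp M G3 m1 x * real_cond_exp M G3 (indicator B) x) \<partial>M)"
        using move[OF E3_G3[OF D] bnd_m(1) bnd_ind, of B] B E_sets by (simp add: ac_simps)
      also have "\<dots> = (\<integral>x. indicator D x * (real_cond_exp M G3 m1 x * indicator B x) \<partial>M)"
        using move[OF E3_G3[OF D] bnd_ind bnd_m(1), of B] B E_sets by (simp add: ac_simps)
      finally show ?thesis by (simp add: ac_simps)
    qed
    have 2: "(\<integral>x. indicator D x * (m1 x * m2 x) \<partial>M)
        = (\<integral>x. indicator D x * (real_cond_exp M G3 m1 x * real_cond_exp M G3 m2 x) \<partial>M)"
      if D: "D \<in> E3" for D
    proof -
      have "(\<integral>x. m2 x * (indicator D x * m1 x) \<partial>M) = (\<integral>x. m2 x * (indicator D x * real_cond_exp M G3 m1 x) \<partial>M)"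
      proof (rule integral_mult_eq_on_generated_algebra[OF G(2) E2 _ _ _ m2 b2])
        fix B assume B: "B \<in> E2"
        show "(\<integral>x\<in>B. indicator D x * m1 x \<partial>M) = (\<integral>x\<in>B. indicator D x * real_cond_exp M G3 m1 x \<partial>M)"
          using 1[OF B D] by (simp add: set_lebesgue_integral_def ac_simps)
      qed (use D in \<open>auto intro!: bnds\<close>)
      also have "\<dots> = (\<integral>x. indicator D x * (real_cond_exp M G3 m1 x * real_cond_exp M G3 m2 x) \<partial>M)"
        using move[OF E3_G3[OF D] bnd_m(2,1)] by (simp add: ac_simps)
      finally show ?thesis by (simp add: ac_simps)
    qed
    show "AE x in M. real_cond_exp M G3 (\<lambda>x. m1 x * m2 x) x = real_cond_exp M G3 m1 x * real_cond_exp M G3 m2 x"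
    proof (rule real_cond_exp_charact)
      fix D assume D: "D \<in> sets G3"
      show "(\<integral>x\<in>D. m1 x * m2 x \<partial>M) = (\<integral>x\<in>D. real_cond_exp M G3 m1 x * real_cond_exp M G3 m2 x \<partial>M)"
      proof (rule set_integral_eq_on_generated_algebra[OF G(3) E3 _ _ _ D])
        fix D assume "D \<in> E3"
        from 2[OF this] show "(\<integral>x\<in>D. m1 x * m2 x \<partial>M) = (\<integral>x\<in>D. real_cond_exp M G3 m1 x * real_cond_exp M G3 m2 x \<partial>M)"
          by (simp add: set_lebesgue_integral_def)
      qed (auto intro!: bnds)
    qed (auto intro!: bnds)
  qed
qed

section \<open>Elementary L^1 and L^2 estimates\<close>

context prob_space
begin

text \<open>Telescoping of \<open>f1 * f2 - g1 * g2\<close>. It turns L^1 closeness of conditional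
  expectations into closeness of the factorised integrals.\<close>

lemma integral_prod_diff_le:
  fixes f1 f2 g1 g2 :: "'a \<Rightarrow> real"
  assumes [measurable]: "D \<in> sets M" "f1 \<in> borel_measurable M" "f2 \<in> borel_measurable M"
      "g1 \<in> borel_measurable M" "g2 \<in> borel_measurable M"
    and unit: "AE x in M. 0 \<le> f1 x \<and> f1 x \<le> 1" "AE x in M. 0 \<le> f2 x \<and> f2 x \<le> 1"
      "AE x in M. 0 \<le> g1 x \<and> g1 x \<le> 1" "AE x in M. 0 \<le> g2 x \<and> g2 x \<le> 1"
  shows "\<bar>(\<integral>x. indicator D x * (f1 x * f2 x) \<partial>M) - (\<integral>x. indicator D x * (g1 x * g2 x) \<partial>M)\<bar>
    \<le> (\<integral>x. \<bar>f1 x - g1 x\<bar> \<partial>M) + (\<integral>x. \<bar>f2 x - g2 x\<bar> \<partial>M)"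
proof -
  have prod_int: "integrable M (\<lambda>x. indicator D x * (u x * u' x))"
    if [measurable]: "u \<in> borel_measurable M" "u' \<in> borel_measurable M"
      and u: "AE x in M. 0 \<le> u x \<and> u x \<le> 1" "AE x in M. 0 \<le> u' x \<and> u' x \<le> 1" for u u' :: "'a \<Rightarrow> real"
  proof (rule integrable_const_bound[where B=1])
    show "AE x in M. norm (indicator D x * (u x * u' x)) \<le> 1"
      using u by eventually_elim (auto simp: indicator_def abs_mult mult_le_one)
  qed measurable
  have diff_int: "integrable M (\<lambda>x. \<bar>u x - u' x\<bar>)"
    if [measurable]: "u \<in> borel_measurable M" "u' \<in> borel_measurable M"
      and u: "AE x in M. 0 \<le> u x \<and> u x \<le> 1" "AE x in M. 0 \<le> u' x \<and> u' x \<le> 1" for u u' :: "'a \<Rightarrow> real"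
  proof (rule integrable_const_bound[where B=1])
    show "AE x in M. norm \<bar>u x - u' x\<bar> \<le> 1"
      using u by eventually_elim auto
  qed measurable
  note i1 = prod_int[OF assms(2,3) unit(1,2)] and i2 = prod_int[OF assms(4,5) unit(3,4)]
    and d1 = diff_int[OF assms(2,4) unit(1,3)] and d2 = diff_int[OF assms(3,5) unit(2,4)]
  have "\<bar>(\<integral>x. indicator D x * (f1 x * f2 x) \<partial>M) - (\<integral>x. indicator D x * (g1 x * g2 x) \<partial>M)\<bar>
      = \<bar>\<integral>x. indicator D x * (f1 x * f2 x) - indicator D x * (g1 x * g2 x) \<partial>M\<bar>"
    using i1 i2 by simp
  also have "\<dots> \<le> (\<integral>x. \<bar>indicator D x * (f1 x * f2 x) - indicator D x * (g1 x * g2 x)\<bar> \<partial>M)"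
    by (rule integral_abs_bound)
  also have "\<dots> \<le> (\<integral>x. \<bar>f1 x - g1 x\<bar> + \<bar>f2 x - g2 x\<bar> \<partial>M)"
  proof (rule integral_mono_AE)
    show "AE x in M. \<bar>indicator D x * (f1 x * f2 x) - indicator D x * (g1 x * g2 x)\<bar> \<le> \<bar>f1 x - g1 x\<bar> + \<bar>f2 x - g2 x\<bar>"
      using unit
    proof eventually_elim
      case (elim x)
      have "\<bar>f1 x * f2 x - g1 x * g2 x\<bar> = \<bar>(f1 x - g1 x) * f2 x + g1 x * (f2 x - g2 x)\<bar>"
        by (simp add: algebra_simps)
      also have "\<dots> \<le> \<bar>f1 x - g1 x\<bar> * \<bar>f2 x\<bar> + \<bar>g1 x\<bar> * \<bar>f2 x - g2 x\<bar>"
        by (metis abs_mult abs_triangle_ineq)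
      also have "\<dots> \<le> \<bar>f1 x - g1 x\<bar> * 1 + 1 * \<bar>f2 x - g2 x\<bar>"
        using elim by (intro add_mono mult_left_mono mult_right_mono) auto
      finally show ?case by (auto simp: indicator_def)
    qed
  qed (use i1 i2 d1 d2 in auto)
  also have "\<dots> = (\<integral>x. \<bar>f1 x - g1 x\<bar> \<partial>M) + (\<integral>x. \<bar>f2 x - g2 x\<bar> \<partial>M)"
    using d1 d2 by simp
  finally show ?thesis .
qed

text \<open>Cauchy-Schwarz on a probability space, obtained by integrating 2 \<delta> |u| \<le>
  \<delta>^2 + u^2. The estimates for conditional expectations are produced in L^2 but consumed in
  L^1.\<close>

lemma integral_abs_le_of_square:
  fixes u :: "'a \<Rightarrow> real"
  assumes [measurable]: "u \<in> borel_measurable M" and u: "AE x in M. \<bar>u x\<bar> \<le> 1"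
    and \<delta>: "0 < \<delta>" and sq: "(\<integral>x. (u x)\<^sup>2 \<partial>M) \<le> \<delta>\<^sup>2"
  shows "(\<integral>x. \<bar>u x\<bar> \<partial>M) \<le> \<delta>"
proof -
  have i: "integrable M u" "integrable M (\<lambda>x. (u x)\<^sup>2)"
    using u by (auto intro!: integrable_const_bound[where B=1] simp: abs_square_le_1)
  have "(\<integral>x. \<bar>u x\<bar> \<partial>M) \<le> (\<integral>x. \<delta> / 2 + (u x)\<^sup>2 / (2 * \<delta>) \<partial>M)"
  proof (rule integral_mono)
    fix x
    have "0 \<le> (\<bar>u x\<bar> - \<delta>)\<^sup>2" by simp
    then have "2 * \<delta> * \<bar>u x\<bar> \<le> \<delta>\<^sup>2 + (u x)\<^sup>2" by (simp add: power2_diff algebra_simps)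
    then show "\<bar>u x\<bar> \<le> \<delta> / 2 + (u x)\<^sup>2 / (2 * \<delta>)"
      using \<delta> by (simp add: field_simps power2_eq_square)
  qed (use i in auto)
  also have "\<dots> = \<delta> / 2 + (\<integral>x. (u x)\<^sup>2 \<partial>M) / (2 * \<delta>)"
    using i by (simp add: prob_space)
  also have "\<dots> \<le> \<delta> / 2 + \<delta>\<^sup>2 / (2 * \<delta>)"
    using sq \<delta> by (intro add_left_mono divide_right_mono) auto
  also have "\<dots> = \<delta>" using \<delta> by (simp add: power2_eq_square)
  finally show ?thesis .
qed

end

section \<open>Densities on product spaces\<close>

text \<open>Realises division by kernel factors as a reweighting of the underlying probability
  space.\<close>

lemma distributed_density:
  assumes Z: "distributed M S Z f" and h[measurable]: "h \<in> borel_measurable S"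
  shows "distributed (density M (\<lambda>\<omega>. h (Z \<omega>))) S Z (\<lambda>x. f x * h x)"
proof -
  have [measurable]: "f \<in> borel_measurable S" "Z \<in> measurable M S" and eq: "distr M S Z = density S f"
    using Z by (auto simp: distributed_def)
  have "distr (density M (\<lambda>\<omega>. h (Z \<omega>))) S Z = density (distr M S Z) h"
    by (rule density_distr[symmetric]) measurable
  also have "\<dots> = density S (\<lambda>x. f x * h x)"
    by (simp add: eq density_density_eq)
  finally show ?thesis by (simp add: distributed_def)
qed

text \<open>Bayes formula on a fibre: with the coordinates in \<open>U\<close> fixed, the others
  have density proportional to \<open>H\<close>, which sees the fixed ones only through
  \<open>K\<close>. The conditional expectation is therefore the quotient of the
  \<open>H\<close>-integrals with and without \<open>\<psi>\<close>. The bounds on \<open>c\<close>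
  hold everywhere and not only almost everywhere, so that \<open>c\<close> can serve as a bounded
  observable in its turn.\<close>

lemma (in product_sigma_finite) factorized_density_cond_exp:
  fixes Z :: "'w \<Rightarrow> 'i \<Rightarrow> 'a" and F H :: "('i \<Rightarrow> 'a) \<Rightarrow> ennreal" and \<psi> :: "('i \<Rightarrow> 'a) \<Rightarrow> real"
  assumes fin: "finite W" and UW: "U \<subseteq> W" and KU: "K \<subseteq> U"
    and Q: "finite_measure Q"
    and F[measurable]: "F \<in> borel_measurable (PiM U M)"
    and H[measurable]: "H \<in> borel_measurable (PiM (K \<union> (W - U)) M)"
    and Z: "distributed Q (PiM W M) Z (\<lambda>x. F (restrict x U) * H (restrict x (K \<union> (W - U))))"
    and \<psi>[measurable]: "\<psi> \<in> borel_measurable (PiM (K \<union> (W - U)) M)"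
    and \<psi>_bounds: "\<And>x. 0 \<le> \<psi> x" "\<And>x. \<psi> x \<le> 1"
  obtains c where "c \<in> borel_measurable (PiM K M)" "\<And>x. 0 \<le> c x" "\<And>x. c x \<le> (1::real)"
    "AE \<omega> in Q. real_cond_exp Q (vimage_algebra (space Q) (\<lambda>\<omega>. restrict (Z \<omega>) U) (PiM U M))
        (\<lambda>\<omega>. \<psi> (restrict (Z \<omega>) (K \<union> (W - U)))) \<omega> = c (restrict (Z \<omega>) K)"
proof -
  interpret Q: finite_measure Q by fact
  define V where "V = W - U"
  \<comment> \<open>The fibre point over \<open>u\<close>: its \<open>K\<close> coordinates come
    from \<open>u\<close>, those in \<open>V\<close> from \<open>y\<close>.\<close>
  define p where "p = (\<lambda>u y. merge K V (restrict u K, y :: 'i \<Rightarrow> 'a))"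
  have W: "W = U \<union> V" "U \<inter> V = {}" "K \<inter> V = {}" and finUV: "finite U" "finite V"
    using UW KU fin by (auto simp: V_def intro: finite_subset)
  have V_finite: "sigma_finite_measure (PiM V M)"
    using finUV by (intro sigma_finite) 
  interpret V: sigma_finite_measure "PiM V M" by fact
  note [measurable] = H[folded V_def] \<psi>[folded V_def]
  have Zm[measurable]: "Z \<in> measurable Q (PiM W M)"
    using Z by (rule distributed_measurable)
  have KVW: "K \<union> V \<subseteq> W" "K \<subseteq> W" using KU W by auto
  have ZU[measurable]: "(\<lambda>\<omega>. restrict (Z \<omega>) U) \<in> measurable Q (PiM U M)"
    and ZKV[measurable]: "(\<lambda>\<omega>. restrict (Z \<omega>) (K \<union> V)) \<in> measurable Q (PiM (K \<union> V) M)"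
    and ZK[measurable]: "(\<lambda>\<omega>. restrict (Z \<omega>) K) \<in> measurable Q (PiM K M)"
    using measurable_compose[OF Zm measurable_restrict_subset] UW KVW by auto
  define \<Psi> where "\<Psi> = (\<lambda>s. \<integral>\<^sup>+y. ennreal (\<psi> (merge K V (s, y))) * H (merge K V (s, y)) \<partial>PiM V M)"
  define \<Xi> where "\<Xi> = (\<lambda>s. \<integral>\<^sup>+y. H (merge K V (s, y)) \<partial>PiM V M)"
  \<comment> \<open>Division in \<open>ennreal\<close> yields 0 when the denominator is 0 or
    infinite (the numerator is at most the denominator), so the quotient needs no case
    distinction.\<close>
  define c where "c = (\<lambda>s. enn2real (\<Psi> s / \<Xi> s))"
  have [measurable]: "\<Psi> \<in> borel_measurable (PiM K M)" "\<Xi> \<in> borel_measurable (PiM K M)"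
    unfolding \<Psi>_def \<Xi>_def by measurable
  have c[measurable]: "c \<in> borel_measurable (PiM K M)"
    unfolding c_def by measurable
  have \<Psi>_le: "\<Psi> s \<le> \<Xi> s" for s
    unfolding \<Psi>_def \<Xi>_def
    using \<psi>_bounds by (intro nn_integral_mono) (metis ennreal_1 ennreal_leI mult_1 mult_right_mono zero_le)
  have quot_le: "\<Psi> s / \<Xi> s \<le> 1" for s
  proof (cases "\<Xi> s = 0 \<or> \<Xi> s = top")
    case True
    then show ?thesis using \<Psi>_le[of s] by (auto simp: ennreal_divide_top)
  next
    case False
    then show ?thesis using divide_right_mono_ennreal[OF \<Psi>_le[of s], of "\<Xi> s"]
      by (simp add: ennreal_divide_self zero_less_iff_neq_zero top.not_eq_extremum)
  qed
  have c_ennreal: "ennreal (c s) = \<Psi> s / \<Xi> s" for s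
    using quot_le[of s] unfolding c_def by (metis ennreal_enn2real ennreal_one_less_top le_less_trans)
  have c_bounds: "0 \<le> c s" "c s \<le> 1" for s
  proof -
    show "0 \<le> c s" by (simp add: c_def)
    have "ennreal (c s) \<le> ennreal 1" using quot_le[of s] by (simp add: c_ennreal)
    then show "c s \<le> 1" by (subst (asm) ennreal_le_iff) auto
  qed
  \<comment> \<open>For infinite \<open>\<Xi> s\<close> the hypothesis forces \<open>t = 0\<close>;
    thus almost sure finiteness of the product, proved below, is all that is needed.\<close>
  have c_eq: "t * \<Psi> s = t * (ennreal (c s) * \<Xi> s)" if "t * \<Xi> s < top" for t s
  proof (cases "\<Xi> s = 0 \<or> \<Xi> s = top")
    case True
    then show ?thesis using that \<Psi>_le[of s] by (auto simp: ennreal_mult_less_top ennreal_mult_eq_top_iff)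
  next
    case False
    then show ?thesis
      by (simp add: c_ennreal ennreal_divide_times ennreal_divide_self zero_less_iff_neq_zero top.not_eq_extremum
          ennreal_times_divide mult_divide_eq_ennreal)
  qed
  have integral_eq: "(\<integral>\<^sup>+\<omega>. \<phi> (restrict (Z \<omega>) U) * \<xi> (restrict (Z \<omega>) (K \<union> V)) \<partial>Q)
      = (\<integral>\<^sup>+u. F u * \<phi> u * (\<integral>\<^sup>+y. \<xi> (p u y) * H (p u y) \<partial>PiM V M) \<partial>PiM U M)"
    if [measurable]: "\<phi> \<in> borel_measurable (PiM U M)" "\<xi> \<in> borel_measurable (PiM (K \<union> V) M)"
    for \<phi> \<xi> :: "('i \<Rightarrow> 'a) \<Rightarrow> ennreal"
  proof -
    have [measurable]: "(\<lambda>x. restrict x U) \<in> measurable (PiM W M) (PiM U M)"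
      "(\<lambda>x. restrict x (K \<union> V)) \<in> measurable (PiM W M) (PiM (K \<union> V) M)"
      by (rule measurable_restrict_subset; fact)+
    have [measurable]: "(\<lambda>x. restrict x K) \<in> measurable (PiM U M) (PiM K M)"
      using measurable_restrict_subset KU by auto
    have p_meas: "(\<lambda>y. p u y) \<in> measurable (PiM V M) (PiM (K \<union> V) M)" if "u \<in> space (PiM U M)" for u
      using that unfolding p_def by measurable
    have "(\<integral>\<^sup>+\<omega>. \<phi> (restrict (Z \<omega>) U) * \<xi> (restrict (Z \<omega>) (K \<union> V)) \<partial>Q)
        = (\<integral>\<^sup>+x. F (restrict x U) * H (restrict x (K \<union> V)) * (\<phi> (restrict x U) * \<xi> (restrict x (K \<union> V))) \<partial>PiM W M)"
      using distributed_nn_integral[OF Z, of "\<lambda>x. \<phi> (restrict x U) * \<xi> (restrict x (K \<union> V))"]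
      by (simp add: V_def[symmetric])
    also have "\<dots> = (\<integral>\<^sup>+u. (\<integral>\<^sup>+y. F (restrict (merge U V (u, y)) U) * H (restrict (merge U V (u, y)) (K \<union> V))
        * (\<phi> (restrict (merge U V (u, y)) U) * \<xi> (restrict (merge U V (u, y)) (K \<union> V))) \<partial>PiM V M) \<partial>PiM U M)"
      unfolding W(1) using W finUV
      by (subst product_nn_integral_fold) (auto simp: W(1)[symmetric])
    also have "\<dots> = (\<integral>\<^sup>+u. (\<integral>\<^sup>+y. (F u * \<phi> u) * (\<xi> (p u y) * H (p u y)) \<partial>PiM V M) \<partial>PiM U M)"
    proof (intro nn_integral_cong)
      fix u y assume u: "u \<in> space (PiM U M)" and y: "y \<in> space (PiM V M)"
      have 1: "restrict (merge U V (u, y)) U = u"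
        using u W by (simp add: space_PiM)
      have 2: "restrict (merge U V (u, y)) (K \<union> V) = p u y"
        using KU W unfolding p_def by (auto simp: merge_def fun_eq_iff)
      show "F (restrict (merge U V (u, y)) U) * H (restrict (merge U V (u, y)) (K \<union> V))
        * (\<phi> (restrict (merge U V (u, y)) U) * \<xi> (restrict (merge U V (u, y)) (K \<union> V)))
        = F u * \<phi> u * (\<xi> (p u y) * H (p u y))"
        unfolding 1 2 by (simp add: ac_simps)
    qed
    also have "\<dots> = (\<integral>\<^sup>+u. F u * \<phi> u * (\<integral>\<^sup>+y. \<xi> (p u y) * H (p u y) \<partial>PiM V M) \<partial>PiM U M)"
      by (intro nn_integral_cong nn_integral_cmult) (use p_meas in measurable)
    finally show ?thesis .
  qed
  have \<Xi>_p: "\<Xi> (restrict u K) = (\<integral>\<^sup>+y. H (p u y) \<partial>PiM V M)" for u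
    by (simp only: \<Xi>_def p_def)
  have \<Psi>_p: "\<Psi> (restrict u K) = (\<integral>\<^sup>+y. ennreal (\<psi> (p u y)) * H (p u y) \<partial>PiM V M)" for u
    by (simp only: \<Psi>_def p_def)
  \<comment> \<open>The integral of this product is the total mass of \<open>Q\<close>.\<close>
  have finite_fiber: "AE u in PiM U M. F u * \<Xi> (restrict u K) < top"
  proof -
    have [measurable]: "(\<lambda>x. restrict x K) \<in> measurable (PiM U M) (PiM K M)"
      using measurable_restrict_subset KU by auto
    have "(\<integral>\<^sup>+u. F u * \<Xi> (restrict u K) \<partial>PiM U M) = emeasure Q (space Q)"
      using integral_eq[OF borel_measurable_const[of 1] borel_measurable_const[of 1]]
      by (simp only: \<Xi>_p mult_1_left mult_1_right nn_integral_const)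
    then have "(\<integral>\<^sup>+u. F u * \<Xi> (restrict u K) \<partial>PiM U M) \<noteq> \<infinity>"
      by simp
    then have "AE u in PiM U M. F u * \<Xi> (restrict u K) \<noteq> \<infinity>"
      by (rule nn_integral_noteq_infinite[rotated]) measurable
    then show ?thesis
      by eventually_elim (simp add: less_top)
  qed
  have c_integral: "(\<integral>\<^sup>+\<omega>. indicator A (restrict (Z \<omega>) U) * ennreal (\<psi> (restrict (Z \<omega>) (K \<union> V))) \<partial>Q)
      = (\<integral>\<^sup>+\<omega>. indicator A (restrict (Z \<omega>) U) * ennreal (c (restrict (Z \<omega>) K)) \<partial>Q)"
    if [measurable]: "A \<in> sets (PiM U M)" for A
  proof -
    have [measurable]: "(\<lambda>x. restrict x K) \<in> measurable (PiM U M) (PiM K M)"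
      "(\<lambda>x. restrict x K) \<in> measurable (PiM (K \<union> V) M) (PiM K M)"
      by (rule measurable_restrict_subset, use KU in blast)+
    have pK: "restrict (p u y) K = restrict u K" for u y
      using W(3) by (simp add: p_def)
    have "(\<integral>\<^sup>+\<omega>. indicator A (restrict (Z \<omega>) U) * ennreal (\<psi> (restrict (Z \<omega>) (K \<union> V))) \<partial>Q)
      = (\<integral>\<^sup>+u. F u * indicator A u * \<Psi> (restrict u K) \<partial>PiM U M)"
      using integral_eq[of "indicator A" "\<lambda>x. ennreal (\<psi> x)"] by (simp add: \<Psi>_p)
    also have "\<dots> = (\<integral>\<^sup>+u. F u * indicator A u * (ennreal (c (restrict u K)) * \<Xi> (restrict u K)) \<partial>PiM U M)"
      using finite_fiber
    proof (intro nn_integral_cong_AE, eventually_elim)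
      fix u assume "F u * \<Xi> (restrict u K) < top"
      from c_eq[OF this] show "F u * indicator A u * \<Psi> (restrict u K)
          = F u * indicator A u * (ennreal (c (restrict u K)) * \<Xi> (restrict u K))"
        by (simp split: split_indicator)
    qed
    also have "\<dots> = (\<integral>\<^sup>+u. F u * indicator A u * (\<integral>\<^sup>+y. ennreal (c (restrict (p u y) K)) * H (p u y) \<partial>PiM V M) \<partial>PiM U M)"
    proof (intro nn_integral_cong)
      fix u assume u: "u \<in> space (PiM U M)"
      have "(\<lambda>y. p u y) \<in> measurable (PiM V M) (PiM (K \<union> V) M)"
        using u unfolding p_def by measurable
      then have [measurable]: "(\<lambda>y. H (p u y)) \<in> borel_measurable (PiM V M)"
        by measurable
      have "(\<integral>\<^sup>+y. ennreal (c (restrict u K)) * H (p u y) \<partial>PiM V M) = ennreal (c (restrict u K)) * (\<integral>\<^sup>+y. H (p u y) \<partial>PiM V M)"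
        by (rule nn_integral_cmult) measurable
      also have "(\<integral>\<^sup>+y. H (p u y) \<partial>PiM V M) = \<Xi> (restrict u K)"
        by (rule \<Xi>_p[symmetric])
      finally have "(\<integral>\<^sup>+y. ennreal (c (restrict u K)) * H (p u y) \<partial>PiM V M) = ennreal (c (restrict u K)) * \<Xi> (restrict u K)" .
      then show "F u * indicator A u * (ennreal (c (restrict u K)) * \<Xi> (restrict u K))
        = F u * indicator A u * (\<integral>\<^sup>+y. ennreal (c (restrict (p u y) K)) * H (p u y) \<partial>PiM V M)"
        by (simp add: pK)
    qed
    also have "\<dots> = (\<integral>\<^sup>+\<omega>. indicator A (restrict (Z \<omega>) U) * ennreal (c (restrict (restrict (Z \<omega>) (K \<union> V)) K)) \<partial>Q)"
      using integral_eq[of "indicator A" "\<lambda>x. ennreal (c (restrict x K))"] by simp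
    also have "\<dots> = (\<integral>\<^sup>+\<omega>. indicator A (restrict (Z \<omega>) U) * ennreal (c (restrict (Z \<omega>) K)) \<partial>Q)"
      by (simp add: Int_absorb1 Int_commute inf_absorb2)
    finally show ?thesis .
  qed
  define G where "G = vimage_algebra (space Q) (\<lambda>\<omega>. restrict (Z \<omega>) U) (PiM U M)"
  have sub: "subalgebra Q G"
    using ZU unfolding subalgebra_def G_def by (simp add: measurable_iff_sets)
  interpret finite_measure_subalgebra Q G
    by standard (fact sub)
  have maps: "(\<lambda>\<omega>. restrict (Z \<omega>) U) \<in> space Q \<rightarrow> space (PiM U M)"
    by (auto intro: measurable_space[OF ZU])
  have "AE \<omega> in Q. real_cond_exp Q G (\<lambda>\<omega>. \<psi> (restrict (Z \<omega>) (K \<union> V))) \<omega> = c (restrict (Z \<omega>) K)"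
  proof (rule real_cond_exp_charact)
    fix B assume "B \<in> sets G"
    then obtain A where A[measurable]: "A \<in> sets (PiM U M)" and B: "B = (\<lambda>\<omega>. restrict (Z \<omega>) U) -` A \<inter> space Q"
      by (auto simp: G_def sets_vimage_algebra2[OF maps])
    have ind: "indicator B \<omega> = (indicator A (restrict (Z \<omega>) U) :: real)" if "\<omega> \<in> space Q" for \<omega>
      using that by (simp add: B indicator_def)
    have "(\<integral>\<omega>. indicator A (restrict (Z \<omega>) U) * \<psi> (restrict (Z \<omega>) (K \<union> V)) \<partial>Q)
       = (\<integral>\<omega>. indicator A (restrict (Z \<omega>) U) * c (restrict (Z \<omega>) K) \<partial>Q)"
      using c_integral[OF A] \<psi>_bounds c_bounds
      by (simp add: integral_eq_nn_integral ennreal_mult ennreal_indicator)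
    then show "(LINT \<omega>:B|Q. \<psi> (restrict (Z \<omega>) (K \<union> V))) = (LINT \<omega>:B|Q. c (restrict (Z \<omega>) K))"
      unfolding set_lebesgue_integral_def by (simp add: ind cong: Bochner_Integration.integral_cong)
  next
    show "integrable Q (\<lambda>\<omega>. \<psi> (restrict (Z \<omega>) (K \<union> V)))" "integrable Q (\<lambda>\<omega>. c (restrict (Z \<omega>) K))"
      using \<psi>_bounds c_bounds by (auto intro!: Q.integrable_const_bound[where B=1])
    have "(\<lambda>u. restrict u K) \<in> measurable (PiM U M) (PiM K M)"
      using measurable_restrict_subset KU by auto
    from measurable_compose[OF measurable_vimage_algebra1[OF maps, folded G_def] this]
    have "(\<lambda>\<omega>. restrict (Z \<omega>) K) \<in> measurable G (PiM K M)"
      using KU by (simp add: Int_absorb1)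
    then show "(\<lambda>\<omega>. c (restrict (Z \<omega>) K)) \<in> borel_measurable G"
      by measurable
  qed
  then show thesis
    using that[OF c c_bounds] by (simp add: G_def V_def)
qed

text \<open>Turns a product over times of products over components into one product over space-time
  sites, with the times relabelled by \<open>g\<close>. Both measures agree on boxes, which
  determine the product measure.\<close>

lemma distr_PiM_uncurry:
  fixes M :: "'j \<Rightarrow> 'a measure" and T :: "'s set" and T' :: "'t set"
  assumes M: "product_sigma_finite M" and fin: "finite C" "finite T" and g: "bij_betw g T' T"
  shows "distr (PiM T (\<lambda>_. PiM C M)) (PiM (T' \<times> C) (\<lambda>i. M (snd i))) (\<lambda>x. \<lambda>i\<in>T' \<times> C. x (g (fst i)) (snd i))
    = PiM (T' \<times> C) (\<lambda>i. M (snd i))"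
proof -
  interpret M: product_sigma_finite M by fact
  interpret MM: product_sigma_finite "\<lambda>i::'t \<times> 'j. M (snd i)"
    by standard
  interpret C: product_sigma_finite "\<lambda>_::'s. PiM C M"
    by (rule product_sigma_finite.intro) (rule M.sigma_finite[OF fin(1)])
  have fT: "finite T'" using bij_betw_finite[OF g] fin by simp
  have gT: "g t \<in> T" if "t \<in> T'" for t using g that by (auto simp: bij_betw_def)
  define f where "f = (\<lambda>x::'s \<Rightarrow> 'j \<Rightarrow> 'a. \<lambda>i\<in>T' \<times> C. x (g (fst i)) (snd i))"
  have f[measurable]: "f \<in> measurable (PiM T (\<lambda>_. PiM C M)) (PiM (T' \<times> C) (\<lambda>i. M (snd i)))"
    unfolding f_def
  proof (rule measurable_restrict)
    fix i assume "i \<in> T' \<times> C"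
    then have i: "g (fst i) \<in> T" "snd i \<in> C" using gT by auto
    show "(\<lambda>x. x (g (fst i)) (snd i)) \<in> measurable (PiM T (\<lambda>_. PiM C M)) (M (snd i))"
      using measurable_compose[OF measurable_component_singleton[OF i(1)] measurable_component_singleton[OF i(2)]] .
  qed
  have "distr (PiM T (\<lambda>_. PiM C M)) (PiM (T' \<times> C) (\<lambda>i. M (snd i))) f = PiM (T' \<times> C) (\<lambda>i. M (snd i))"
  proof (rule MM.PiM_eqI)
    fix A assume A: "\<And>i. i \<in> T' \<times> C \<Longrightarrow> A i \<in> sets (M (snd i))"
    \<comment> \<open>The preimage of a box of sites is a product of boxes, one for each time; the
      label of that time is read back through the inverse of \<open>g\<close>.\<close>
    define A' where "A' = (\<lambda>s. Pi\<^sub>E C (\<lambda>b. A (the_inv_into T' g s, b)))"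
    have inv: "the_inv_into T' g (g t) = t" if "t \<in> T'" for t
      using g that by (simp add: bij_betw_def the_inv_into_f_f)
    have inv_in: "the_inv_into T' g s \<in> T'" if "s \<in> T" for s
      using g that by (metis bij_betw_def the_inv_into_into order_refl)
    have pre: "f -` Pi\<^sub>E (T' \<times> C) A \<inter> space (PiM T (\<lambda>_. PiM C M)) = Pi\<^sub>E T A'"
    proof (intro set_eqI iffI)
      fix x assume x: "x \<in> f -` Pi\<^sub>E (T' \<times> C) A \<inter> space (PiM T (\<lambda>_. PiM C M))"
      show "x \<in> Pi\<^sub>E T A'"
      proof (rule PiE_I)
        fix s assume s: "s \<in> T"
        then obtain t where t: "t \<in> T'" "s = g t" using g by (auto simp: bij_betw_def)
        have "x s \<in> extensional C" using x s by (auto simp: space_PiM PiE_def)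
        moreover have "x s b \<in> A (t, b)" if "b \<in> C" for b
          using x that t by (auto simp: f_def PiE_iff)
        ultimately show "x s \<in> A' s" using t inv by (auto simp: A'_def PiE_iff)
      next
        fix s assume "s \<notin> T"
        then show "x s = undefined" using x by (auto simp: space_PiM)
      qed
    next
      fix x assume x: "x \<in> Pi\<^sub>E T A'"
      have "x (g t) b \<in> A (t, b)" if "t \<in> T'" "b \<in> C" for t b
        using PiE_mem[OF x gT[OF that(1)]] that inv by (auto simp: A'_def)
      then have "f x \<in> Pi\<^sub>E (T' \<times> C) A" by (auto simp: f_def)
      moreover have "x \<in> space (PiM T (\<lambda>_. PiM C M))"
      proof -
        have "A' s \<subseteq> space (PiM C M)" if "s \<in> T" for s
          using A[THEN sets.sets_into_space] inv_in[OF that] by (fastforce simp: A'_def space_PiM PiE_iff)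
        with x show ?thesis by (fastforce simp: space_PiM PiE_iff)
      qed
      ultimately show "x \<in> f -` Pi\<^sub>E (T' \<times> C) A \<inter> space (PiM T (\<lambda>_. PiM C M))" by simp
    qed
    have A'_sets: "A' s \<in> sets (PiM C M)" if "s \<in> T" for s
      unfolding A'_def using A inv_in[OF that] fin by (intro sets_PiM_I_finite) auto
    have "emeasure (distr (PiM T (\<lambda>_. PiM C M)) (PiM (T' \<times> C) (\<lambda>i. M (snd i))) f) (Pi\<^sub>E (T' \<times> C) A)
        = emeasure (PiM T (\<lambda>_. PiM C M)) (Pi\<^sub>E T A')"
      using A fT fin by (subst emeasure_distr) (auto simp: pre intro!: sets_PiM_I_finite)
    also have "\<dots> = (\<Prod>s\<in>T. emeasure (PiM C M) (A' s))"
      using A'_sets fin by (intro C.emeasure_PiM) auto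
    also have "\<dots> = (\<Prod>s\<in>T. \<Prod>b\<in>C. emeasure (M b) (A (the_inv_into T' g s, b)))"
      unfolding A'_def using A inv_in fin by (intro prod.cong refl M.emeasure_PiM) auto
    also have "\<dots> = (\<Prod>t\<in>T'. \<Prod>b\<in>C. emeasure (M b) (A (t, b)))"
      using inv by (subst prod.reindex_bij_betw[OF g, symmetric]) simp
    also have "\<dots> = (\<Prod>i\<in>T' \<times> C. emeasure (M (snd i)) (A i))"
      by (simp add: prod.cartesian_product case_prod_beta)
    finally show "emeasure (distr (PiM T (\<lambda>_. PiM C M)) (PiM (T' \<times> C) (\<lambda>i. M (snd i))) f) (Pi\<^sub>E (T' \<times> C) A)
        = (\<Prod>i\<in>T' \<times> C. emeasure (M (snd i)) (A i))" .
  qed (use fT fin in auto)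
  then show ?thesis by (simp add: f_def)
qed

section \<open>Energies and the interaction kernel\<close>

text \<open>As \<open>S1\<close> and \<open>S2\<close> cover \<open>S\<close>, a pair outside both
  squares has one index outside \<open>S1\<close> and the other outside \<open>S2\<close>, where
  \<open>f\<close> vanishes. The rest is inclusion-exclusion for the two squares.\<close>

lemma sum_product_cover:
  fixes f :: "'i \<Rightarrow> 'i \<Rightarrow> real"
  assumes fin: "finite S" and S: "S1 \<union> S2 = S"
    and zero: "\<And>i j. i \<in> S - S1 \<Longrightarrow> j \<in> S - S2 \<Longrightarrow> f i j = 0 \<and> f j i = 0"
  shows "(\<Sum>i\<in>S. \<Sum>j\<in>S. f i j) + (\<Sum>i\<in>S1 \<inter> S2. \<Sum>j\<in>S1 \<inter> S2. f i j)
    = (\<Sum>i\<in>S1. \<Sum>j\<in>S1. f i j) + (\<Sum>i\<in>S2. \<Sum>j\<in>S2. f i j)"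
proof -
  define g where "g = (\<lambda>(i, j). f i j)"
  have fin': "finite S1" "finite S2" using fin S by auto
  have "(\<Sum>p\<in>S \<times> S. g p) = (\<Sum>p\<in>S1 \<times> S1 \<union> S2 \<times> S2. g p)"
    using S fin zero by (intro sum.mono_neutral_right) (auto simp: g_def)
  moreover have "(S1 \<times> S1) \<inter> (S2 \<times> S2) = (S1 \<inter> S2) \<times> (S1 \<inter> S2)" by auto
  ultimately have "(\<Sum>p\<in>S \<times> S. g p) + (\<Sum>p\<in>(S1 \<inter> S2) \<times> (S1 \<inter> S2). g p)
      = (\<Sum>p\<in>S1 \<times> S1. g p) + (\<Sum>p\<in>S2 \<times> S2. g p)"
    using sum.union_inter[of "S1 \<times> S1" "S2 \<times> S2" g] fin' by simp
  then show ?thesis by (simp add: g_def sum.cartesian_product)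
qed

section \<open>Energies over subsets of components\<close>

definition stat_idx :: "stgm \<Rightarrow> nat set \<Rightarrow> (nat \<times> nat) set" where
  "stat_idx P D = (SIGMA b:D. {1..stat_dim P b})"

text \<open>The logarithm of \<open>G_fun\<close> with every sum cut down to \<open>D\<close>, so
  that energies of different component sets can be compared. In the same way
  \<open>cross_energy\<close> comes from \<open>H_fun\<close>.\<close>

definition self_energy :: "stgm \<Rightarrow> nat set \<Rightarrow> (nat \<Rightarrow> real) \<Rightarrow> real" where
  "self_energy P D x = (\<Sum>i\<in>stat_idx P D. concat_param P i * concat_stat P x i)
    + (\<Sum>i\<in>stat_idx P D. \<Sum>j\<in>stat_idx P D. concat_stat P x i * block_matrix P 0 i j * concat_stat P x j) / 2
    + (\<Sum>b\<in>D. base_fun P b (x b))"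

definition cross_energy :: "stgm \<Rightarrow> nat set \<Rightarrow> (nat \<Rightarrow> real) \<Rightarrow> (nat \<Rightarrow> real) \<Rightarrow> real" where
  "cross_energy P D x y =
    (\<Sum>i\<in>stat_idx P D. \<Sum>j\<in>stat_idx P D. concat_stat P x i * block_matrix P 1 i j * concat_stat P y j)"

text \<open>The interaction kernel with all sums restricted to the components in \<open>D\<close>, evaluated at
  the times \<open>t - 1\<close> and \<open>t\<close> of a space-time configuration.\<close>

definition step_kernel :: "stgm \<Rightarrow> nat set \<Rightarrow> int \<Rightarrow> (int \<times> nat \<Rightarrow> real) \<Rightarrow> real" where
  "step_kernel P D t x = exp (self_energy P D (\<lambda>b. x (t - 1, b)) / 2
    + cross_energy P D (\<lambda>b. x (t - 1, b)) (\<lambda>b. x (t, b)) + self_energy P D (\<lambda>b. x (t, b)) / 2)"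

text \<open>The eigenfunctions and the kernel act on points of the product space, which are
  undefined outside \<open>comps P\<close>; hence the restriction.\<close>

definition slice :: "stgm \<Rightarrow> int \<Rightarrow> (int \<times> nat \<Rightarrow> real) \<Rightarrow> nat \<Rightarrow> real" where
  "slice P t x = (\<lambda>b\<in>comps P. x (t, b))"

text \<open>The value outside \<open>comps P\<close> is irrelevant, but it has to be sigma-finite.\<close>

definition comp_measure :: "stgm \<Rightarrow> nat \<Rightarrow> real measure" where
  "comp_measure P b = (if b \<in> comps P then ref_measure P b else count_space {})"

definition site_measure :: "stgm \<Rightarrow> int \<times> nat \<Rightarrow> real measure" where
  "site_measure P i = comp_measure P (snd i)"

lemma finite_comps[simp]: "finite (comps P)"
  by (simp add: comps_def)

lemma finite_stat_idx: "D \<subseteq> comps P \<Longrightarrow> finite (stat_idx P D)"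
  unfolding stat_idx_def by (auto intro: finite_subset[OF _ finite_comps])

lemma step_kernel_pos[simp]: "0 < step_kernel P D t x" "step_kernel P D t x \<noteq> 0"
  by (simp_all add: step_kernel_def)

lemma self_energy_cong:
  assumes "\<And>b. b \<in> D \<Longrightarrow> x b = y b"
  shows "self_energy P D x = self_energy P D y"
proof -
  have "concat_stat P x i = concat_stat P y i" if "i \<in> stat_idx P D" for i
    using that assms by (auto simp: concat_stat_def stat_idx_def)
  then show ?thesis using assms by (simp add: self_energy_def cong: sum.cong)
qed

lemma cross_energy_cong:
  assumes "\<And>b. b \<in> D \<Longrightarrow> x b = x' b" "\<And>b. b \<in> D \<Longrightarrow> y b = y' b"
  shows "cross_energy P D x y = cross_energy P D x' y'"
proof -
  have "concat_stat P x i = concat_stat P x' i" "concat_stat P y i = concat_stat P y' i"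
    if "i \<in> stat_idx P D" for i
    using that assms by (auto simp: concat_stat_def stat_idx_def)
  then show ?thesis by (simp add: cross_energy_def cong: sum.cong)
qed

lemma step_kernel_restrict:
  assumes "\<And>b. b \<in> D \<Longrightarrow> (t - 1, b) \<in> A \<and> (t, b) \<in> A"
  shows "step_kernel P D t (restrict x A) = step_kernel P D t x"
proof -
  have "self_energy P D (\<lambda>b. restrict x A (s, b)) = self_energy P D (\<lambda>b. x (s, b))" if "s = t - 1 \<or> s = t" for s
    using assms that by (intro self_energy_cong) auto
  moreover have "cross_energy P D (\<lambda>b. restrict x A (t - 1, b)) (\<lambda>b. restrict x A (t, b))
      = cross_energy P D (\<lambda>b. x (t - 1, b)) (\<lambda>b. x (t, b))"
    using assms by (intro cross_energy_cong) auto
  ultimately show ?thesis by (simp add: step_kernel_def)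
qed

lemma slice_restrict:
  assumes "{t} \<times> comps P \<subseteq> A"
  shows "slice P t (restrict x A) = slice P t x"
  using assms by (auto simp: slice_def fun_eq_iff)

lemma sqrt_exp: "sqrt (exp (z::real)) = exp (z / 2)"
  by (rule real_sqrt_unique) (simp_all add: power2_eq_square flip: exp_add)

lemma interaction_kernel_slice:
  "interaction_kernel P (slice P (t - 1) x) (slice P t x) = step_kernel P (comps P) t x"
proof -
  have G: "G_fun P x = exp (self_energy P (comps P) x)" for x
    by (simp add: G_fun_def self_energy_def quad_def stat_idx_def block_index_def)
  have H: "H_fun P x y = exp (cross_energy P (comps P) x y)" for x y
    by (simp add: H_fun_def cross_energy_def quad_def stat_idx_def block_index_def)
  have "self_energy P (comps P) (slice P s x) = self_energy P (comps P) (\<lambda>b. x (s, b))" for s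
    by (intro self_energy_cong) (simp add: slice_def)
  moreover have "cross_energy P (comps P) (slice P (t - 1) x) (slice P t x)
      = cross_energy P (comps P) (\<lambda>b. x (t - 1, b)) (\<lambda>b. x (t, b))"
    by (intro cross_energy_cong) (simp_all add: slice_def)
  ultimately show ?thesis
    by (simp add: interaction_kernel_def step_kernel_def G H sqrt_exp flip: exp_add)
qed

text \<open>Hammersley-Clifford factorisation of one step. No energy term joins \<open>a\<close> and
  \<open>B\<close>, so the energies over the components without \<open>B\<close> and without
  \<open>a\<close> obey inclusion-exclusion; after exponentiation the overlap is divided
  out.\<close>

lemma step_kernel_split:
  assumes valid: "valid_stgm P" and a: "a \<in> comps P" and B: "B \<subseteq> non_nbhd P a"
  shows "step_kernel P (comps P) t x
    = step_kernel P (comps P - B) t x * (step_kernel P (comps P - {a}) t x / step_kernel P (comps P - {a} - B) t x)"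
proof -
  let ?C = "comps P"
  have BC: "B \<subseteq> ?C" "a \<notin> B" using B by (auto simp: non_nbhd_def)
  have zero: "block_matrix P l i j = 0 \<and> block_matrix P l j i = 0"
    if l: "l = 0 \<or> l = 1" and i: "i \<in> stat_idx P ?C - stat_idx P (?C - B)" and j: "j \<in> stat_idx P ?C - stat_idx P (?C - {a})" for l i j
  proof -
    obtain b j1 where i': "i = (b, j1)" "b \<in> B" "b \<in> ?C" "j1 \<in> {1..stat_dim P b}" using i by (auto simp: stat_idx_def)
    obtain k where j': "j = (a, k)" "k \<in> {1..stat_dim P a}" using j by (auto simp: stat_idx_def)
    have "\<not> nonzero_block P 0 a b" "\<not> nonzero_block P 1 a b" "\<not> nonzero_block P (-1) a b"
      using i' B by (auto simp: non_nbhd_def nbhd_def)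
    then have z: "interact P 0 a b k j1 = 0" "interact P 1 a b k j1 = 0" "interact P (-1) a b k j1 = 0"
      using i' j' by (auto simp: nonzero_block_def)
    \<comment> \<open>The neighbourhood is described by the blocks starting from \<open>a\<close>.
      Transposition carries their vanishing to the blocks from \<open>b\<close> to \<open>a\<close>;
      the lag 1 block there is the transposed lag -1 block of \<open>a\<close>.\<close>
    have "interact P 0 a b k j1 = interact P 0 b a j1 k" "interact P (-1) a b k j1 = interact P 1 b a j1 k"
      using valid a i' j' unfolding valid_stgm_def by blast+
    then show ?thesis using z l by (auto simp: block_matrix_def i' j')
  qed
  have inter: "stat_idx P (?C - B) \<inter> stat_idx P (?C - {a}) = stat_idx P (?C - {a} - B)"
    and union: "stat_idx P (?C - B) \<union> stat_idx P (?C - {a}) = stat_idx P ?C"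
    using BC by (auto simp: stat_idx_def)
  have fin: "finite (stat_idx P ?C)" "finite (stat_idx P (?C - B))" "finite (stat_idx P (?C - {a}))"
    by (auto intro: finite_stat_idx)
  have lin: "(\<Sum>i\<in>stat_idx P ?C. f i) + (\<Sum>i\<in>stat_idx P (?C - {a} - B). f i)
      = (\<Sum>i\<in>stat_idx P (?C - B). f i) + (\<Sum>i\<in>stat_idx P (?C - {a}). f i)" for f :: "nat \<times> nat \<Rightarrow> real"
    using sum.union_inter[OF fin(2,3), of f] by (simp add: inter union)
  have "(?C - B) \<union> (?C - {a}) = ?C" "(?C - B) \<inter> (?C - {a}) = ?C - {a} - B" using BC by auto
  then have base: "(\<Sum>b\<in>?C. f b) + (\<Sum>b\<in>?C - {a} - B. f b) = (\<Sum>b\<in>?C - B. f b) + (\<Sum>b\<in>?C - {a}. f b)" for f :: "nat \<Rightarrow> real"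
    using sum.union_inter[of "?C - B" "?C - {a}" f] by simp
  have pair: "(\<Sum>i\<in>stat_idx P ?C. \<Sum>j\<in>stat_idx P ?C. f i * block_matrix P l i j * g j)
      + (\<Sum>i\<in>stat_idx P (?C - {a} - B). \<Sum>j\<in>stat_idx P (?C - {a} - B). f i * block_matrix P l i j * g j)
      = (\<Sum>i\<in>stat_idx P (?C - B). \<Sum>j\<in>stat_idx P (?C - B). f i * block_matrix P l i j * g j)
      + (\<Sum>i\<in>stat_idx P (?C - {a}). \<Sum>j\<in>stat_idx P (?C - {a}). f i * block_matrix P l i j * g j)"
    if "l = 0 \<or> l = 1" for f g :: "nat \<times> nat \<Rightarrow> real" and l
    using sum_product_cover[OF fin(1) union, of "\<lambda>i j. f i * block_matrix P l i j * g j"] zero[OF that]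
    by (simp add: inter)
  have self: "self_energy P ?C x + self_energy P (?C - {a} - B) x = self_energy P (?C - B) x + self_energy P (?C - {a}) x" for x
    unfolding self_energy_def using lin[of "\<lambda>i. concat_param P i * concat_stat P x i"] base[of "\<lambda>b. base_fun P b (x b)"]
      pair[of 0 "concat_stat P x" "concat_stat P x"] by (simp add: field_simps)
  have cross: "cross_energy P ?C x y + cross_energy P (?C - {a} - B) x y
      = cross_energy P (?C - B) x y + cross_energy P (?C - {a}) x y" for x y
    unfolding cross_energy_def by (rule pair) simp
  have "step_kernel P ?C t x * step_kernel P (?C - {a} - B) t x = step_kernel P (?C - B) t x * step_kernel P (?C - {a}) t x"
    unfolding step_kernel_def exp_add[symmetric]
    using self[of "\<lambda>b. x (t - 1, b)"] self[of "\<lambda>b. x (t, b)"] cross[of "\<lambda>b. x (t - 1, b)" "\<lambda>b. x (t, b)"]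
    by (simp add: field_simps)
  then show ?thesis by (simp add: field_simps)
qed

section \<open>Measurability of the energies\<close>

lemma site_measure_component:
  assumes "i \<in> A" "snd i \<in> comps P"
  shows "(\<lambda>x. x i) \<in> measurable (PiM A (site_measure P)) (ref_measure P (snd i))"
  using measurable_component_singleton[OF assms(1), of "site_measure P"] assms(2)
  by (simp add: site_measure_def comp_measure_def)

lemma measurable_concat_stat:
  assumes valid: "valid_stgm P" and D: "D \<subseteq> comps P" "{t} \<times> D \<subseteq> A" and i: "i \<in> stat_idx P D"
  shows "(\<lambda>x. concat_stat P (\<lambda>b. x (t, b)) i) \<in> borel_measurable (PiM A (site_measure P))"
proof -
  obtain b j where bj: "i = (b, j)" "b \<in> D" "j \<in> {1..stat_dim P b}" using i by (auto simp: stat_idx_def)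
  have "(\<lambda>x. suff_stat P b x j) \<in> borel_measurable (ref_measure P b)"
    using valid D bj unfolding valid_stgm_def by blast
  moreover have "(t, b) \<in> A" "b \<in> comps P" using D bj by auto
  ultimately show ?thesis
    using measurable_compose[OF site_measure_component[of "(t, b)" A P]] bj by (simp add: concat_stat_def)
qed

lemma measurable_self_energy:
  assumes valid: "valid_stgm P" and D: "D \<subseteq> comps P" "{t} \<times> D \<subseteq> A"
  shows "(\<lambda>x. self_energy P D (\<lambda>b. x (t, b))) \<in> borel_measurable (PiM A (site_measure P))"
proof -
  note [measurable] = measurable_concat_stat[OF assms]
  have [measurable]: "(\<lambda>x. base_fun P b (x (t, b))) \<in> borel_measurable (PiM A (site_measure P))" if "b \<in> D" for b
  proof -
    have "base_fun P b \<in> borel_measurable (ref_measure P b)"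
      using valid D that unfolding valid_stgm_def by blast
    moreover have "(t, b) \<in> A" "b \<in> comps P" using D that by auto
    ultimately show ?thesis
      using measurable_compose[OF site_measure_component[of "(t, b)" A P]] by simp
  qed
  show ?thesis unfolding self_energy_def by measurable
qed

lemma measurable_step_kernel:
  assumes valid: "valid_stgm P" and D: "D \<subseteq> comps P" "{t - 1, t} \<times> D \<subseteq> A"
  shows "step_kernel P D t \<in> borel_measurable (PiM A (site_measure P))"
proof -
  have D': "{t} \<times> D \<subseteq> A" "{t - 1} \<times> D \<subseteq> A" using D by auto
  note [measurable] = measurable_concat_stat[OF valid D(1) D'(1)] measurable_concat_stat[OF valid D(1) D'(2)]
    measurable_self_energy[OF valid D(1) D'(1)] measurable_self_energy[OF valid D(1) D'(2)]
  show ?thesis unfolding step_kernel_def cross_energy_def by measurable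
qed

lemma state_measure_eq: "state_measure P = PiM (comps P) (comp_measure P)"
  unfolding state_measure_def by (intro PiM_cong) (auto simp: comp_measure_def)

lemma measurable_slice:
  assumes "{t} \<times> comps P \<subseteq> A"
  shows "slice P t \<in> measurable (PiM A (site_measure P)) (state_measure P)"
  unfolding slice_def state_measure_def
  using assms site_measure_component[of "(t, _)" A P] by (intro measurable_restrict) auto

lemma product_sigma_finite_comp_measure:
  assumes "valid_stgm P"
  shows "product_sigma_finite (comp_measure P)"
proof (rule product_sigma_finite.intro)
  fix b
  show "sigma_finite_measure (comp_measure P b)"
    using assms by (auto simp: comp_measure_def valid_stgm_def intro: sigma_finite_measure_count_space_finite)
qed

section \<open>Truncation by the size of a state\<close>

definition state_size :: "stgm \<Rightarrow> (nat \<Rightarrow> real) \<Rightarrow> real" where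
  "state_size P x = \<bar>self_energy P (comps P) x\<bar> + (\<Sum>i\<in>stat_idx P (comps P). \<bar>concat_stat P x i\<bar>)"

definition cross_weight :: "stgm \<Rightarrow> real" where
  "cross_weight P = (\<Sum>i\<in>stat_idx P (comps P). \<Sum>j\<in>stat_idx P (comps P). \<bar>block_matrix P 1 i j\<bar>)"

text \<open>\<open>state_size\<close> dominates the self energy and every single statistic. The
  exponent of the kernel is thus bounded by b/2 + b/2 from the two halves of self energy, plus b^2
  times the entrywise norm \<open>cross_weight\<close> of the lag 1 matrix. The bound is on the
  absolute value, so it also controls the inverse.\<close>

lemma step_kernel_bounds:
  assumes b: "state_size P (\<lambda>b. x (t - 1, b)) \<le> b" "state_size P (\<lambda>b. x (t, b)) \<le> b"
  shows "step_kernel P (comps P) t x \<le> exp (b + b\<^sup>2 * cross_weight P)"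
    and "inverse (step_kernel P (comps P) t x) \<le> exp (b + b\<^sup>2 * cross_weight P)"
proof -
  let ?I = "stat_idx P (comps P)"
  have fin: "finite ?I" by (rule finite_stat_idx) simp
  have self: "\<bar>self_energy P (comps P) y\<bar> \<le> b" if "state_size P y \<le> b" for y
  proof -
    have "0 \<le> (\<Sum>i\<in>?I. \<bar>concat_stat P y i\<bar>)" by (intro sum_nonneg) simp
    then show ?thesis using that unfolding state_size_def by linarith
  qed
  have stat: "\<bar>concat_stat P y i\<bar> \<le> b" if "state_size P y \<le> b" "i \<in> ?I" for y i
    using that member_le_sum[of i ?I "\<lambda>i. \<bar>concat_stat P y i\<bar>"] fin by (simp add: state_size_def)
  have "\<bar>cross_energy P (comps P) y z\<bar> \<le> b\<^sup>2 * cross_weight P"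
    if y: "state_size P y \<le> b" and z: "state_size P z \<le> b" for y z
  proof -
    have b0: "0 \<le> b" using self[OF y] by linarith
    have "\<bar>cross_energy P (comps P) y z\<bar>
        \<le> (\<Sum>i\<in>?I. \<Sum>j\<in>?I. \<bar>concat_stat P y i * block_matrix P 1 i j * concat_stat P z j\<bar>)"
      unfolding cross_energy_def by (intro order.trans[OF sum_abs] sum_mono sum_abs)
    also have "\<dots> \<le> (\<Sum>i\<in>?I. \<Sum>j\<in>?I. b\<^sup>2 * \<bar>block_matrix P 1 i j\<bar>)"
    proof (intro sum_mono)
      fix i j assume "i \<in> ?I" "j \<in> ?I"
      then have "\<bar>concat_stat P y i\<bar> * \<bar>concat_stat P z j\<bar> \<le> b * b"
        using stat[OF y] stat[OF z] b0 by (intro mult_mono) auto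
      then have "(\<bar>concat_stat P y i\<bar> * \<bar>concat_stat P z j\<bar>) * \<bar>block_matrix P 1 i j\<bar> \<le> (b * b) * \<bar>block_matrix P 1 i j\<bar>"
        by (rule mult_right_mono) simp
      then show "\<bar>concat_stat P y i * block_matrix P 1 i j * concat_stat P z j\<bar> \<le> b\<^sup>2 * \<bar>block_matrix P 1 i j\<bar>"
        by (simp add: abs_mult power2_eq_square ac_simps)
    qed
    also have "\<dots> = b\<^sup>2 * cross_weight P"
      by (simp add: cross_weight_def sum_distrib_left)
    finally show ?thesis .
  qed
  note bounds = this[OF b] self[OF b(1)] self[OF b(2)]
  show "step_kernel P (comps P) t x \<le> exp (b + b\<^sup>2 * cross_weight P)"
    unfolding step_kernel_def exp_le_cancel_iff using bounds by linarith
  show "inverse (step_kernel P (comps P) t x) \<le> exp (b + b\<^sup>2 * cross_weight P)"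
    unfolding step_kernel_def exp_minus[symmetric] exp_le_cancel_iff using bounds by linarith
qed

lemma measurable_state_size:
  assumes valid: "valid_stgm P" and A: "{t} \<times> comps P \<subseteq> A"
  shows "(\<lambda>x. state_size P (\<lambda>b. x (t, b))) \<in> borel_measurable (PiM A (site_measure P))"
proof -
  note [measurable] = measurable_concat_stat[OF valid _ A] measurable_self_energy[OF valid _ A]
  show ?thesis unfolding state_size_def by measurable
qed

lemma state_size_cong:
  assumes "\<And>b. b \<in> comps P \<Longrightarrow> x b = y b"
  shows "state_size P x = state_size P y"
proof -
  have "concat_stat P x i = concat_stat P y i" if "i \<in> stat_idx P (comps P)" for i
    using that assms by (auto simp: concat_stat_def stat_idx_def)
  then show ?thesis
    using self_energy_cong[of "comps P" x y P] assms by (simp add: state_size_def cong: sum.cong)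
qed

section \<open>Finite windows of the process\<close>

locale density_process = prob_space M
  for P :: stgm and M :: "'w measure" and X :: "int \<Rightarrow> 'w \<Rightarrow> nat \<Rightarrow> real" and v w :: "(nat \<Rightarrow> real) \<Rightarrow> real" and r :: real +
  assumes valid: "valid_stgm P"
    and X_meas: "\<And>t. X t \<in> measurable M (state_measure P)"
    and v_meas: "v \<in> borel_measurable (state_measure P)" and w_meas: "w \<in> borel_measurable (state_measure P)"
    and window_density: "\<And>m n. n \<ge> 1 \<Longrightarrow> distributed M (PiM {1..n} (\<lambda>_. state_measure P))
               (\<lambda>\<omega>. \<lambda>i\<in>{1..n}. X (m + int i - 1) \<omega>)
               (\<lambda>x. ennreal (inverse (r ^ (n - 1)) * v (x 1)
                       * (\<Prod>t=2..n. interaction_kernel P (x (t - 1)) (x t)) * w (x n)))"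
begin

sublocale site: product_sigma_finite "site_measure P"
proof -
  interpret product_sigma_finite "comp_measure P" by (rule product_sigma_finite_comp_measure[OF valid])
  show "product_sigma_finite (site_measure P)"
    by (rule product_sigma_finite.intro) (simp add: site_measure_def sigma_finite_measures)
qed

section \<open>Space-time windows and their densities\<close>

definition coord :: "'w \<Rightarrow> int \<times> nat \<Rightarrow> real" where
  "coord \<omega> i = X (fst i) \<omega> (snd i)"

definition window :: "int \<Rightarrow> (int \<times> nat) set" where
  "window L = {-L..L} \<times> comps P"

text \<open>A window of 2L + 1 times contains 2L steps, hence the power of \<open>r\<close>.\<close>

definition boundary :: "int \<Rightarrow> (int \<times> nat \<Rightarrow> real) \<Rightarrow> real" where
  "boundary L x = inverse (r ^ nat (2 * L)) * v (slice P (-L) x) * w (slice P L x)"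

lemma coord_measurable:
  assumes "A \<subseteq> UNIV \<times> comps P"
  shows "(\<lambda>\<omega>. restrict (coord \<omega>) A) \<in> measurable M (PiM A (site_measure P))"
proof (rule measurable_restrict)
  fix i assume "i \<in> A"
  then have i: "snd i \<in> comps P" using assms by auto
  show "(\<lambda>\<omega>. coord \<omega> i) \<in> measurable M (site_measure P i)"
    using measurable_compose[OF X_meas[unfolded state_measure_eq] measurable_component_singleton[OF i]]
    by (simp add: coord_def site_measure_def)
qed

text \<open>The given density lives on the positions 1..n of a window starting at time -L.
  Relabelling positions as sites carries product measure to product measure by
  \<open>distr_PiM_uncurry\<close>, and the old density is the new one composed with the
  relabelling, so it can be pushed forward.\<close>

lemma coord_distributed:
  assumes L: "0 \<le> L"
  shows "distributed M (PiM (window L) (site_measure P)) (\<lambda>\<omega>. restrict (coord \<omega>) (window L))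
    (\<lambda>x. ennreal (boundary L x * (\<Prod>t\<in>{-L<..L}. step_kernel P (comps P) t x)))"
proof -
  define n where "n = nat (2 * L + 1)"
  define g where "g = (\<lambda>t. nat (t + L + 1))"
  define S where "S = PiM {1..n} (\<lambda>_. state_measure P)"
  define S' where "S' = PiM (window L) (site_measure P)"
  define Z where "Z = (\<lambda>\<omega>. \<lambda>i\<in>{1..n}. X (- L + int i - 1) \<omega>)"
  define f where "f = (\<lambda>x::nat \<Rightarrow> nat \<Rightarrow> real. \<lambda>i\<in>window L. x (g (fst i)) (snd i))"
  define q where "q = (\<lambda>x. inverse (r ^ (n - 1)) * v (x 1)
                       * (\<Prod>t=2..n. interaction_kernel P (x (t - 1)) (x t)) * w (x n))"
  define q' where "q' = (\<lambda>x. boundary L x * (\<Prod>t\<in>{-L<..L}. step_kernel P (comps P) t x))"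
  have D: "distributed M S Z (\<lambda>x. ennreal (q x))"
    unfolding S_def Z_def q_def by (rule window_density) (use L in \<open>simp add: n_def\<close>)
  have bij: "bij_betw g {-L..L} {1..n}"
    by (rule bij_betwI[where g="\<lambda>i. int i - L - 1"]) (use L in \<open>auto simp: g_def n_def\<close>)
  have S_eq: "S = PiM {1..n} (\<lambda>_. PiM (comps P) (comp_measure P))"
    by (simp add: S_def state_measure_eq)
  have S'_eq: "S' = PiM ({-L..L} \<times> comps P) (\<lambda>i. comp_measure P (snd i))"
    unfolding S'_def window_def site_measure_def ..
  have distr_f: "distr S S' f = S'"
    using distr_PiM_uncurry[OF product_sigma_finite_comp_measure[OF valid] finite_comps _ bij, of P]
    unfolding S_eq S'_eq f_def window_def by simp
  have f_meas[measurable]: "f \<in> measurable S S'"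
    unfolding S_eq S'_eq f_def window_def
  proof (rule measurable_restrict)
    fix i assume "i \<in> {-L..L} \<times> comps P"
    then have i: "g (fst i) \<in> {1..n}" "snd i \<in> comps P" using bij by (auto simp: bij_betw_def)
    show "(\<lambda>x. x (g (fst i)) (snd i)) \<in> measurable (PiM {1..n} (\<lambda>_. PiM (comps P) (comp_measure P))) (comp_measure P (snd i))"
      using measurable_compose[OF measurable_component_singleton[OF i(1)] measurable_component_singleton[OF i(2)]] .
  qed
  have q'_meas: "q' \<in> borel_measurable S'"
  proof -
    have "step_kernel P (comps P) t \<in> borel_measurable S'" if "t \<in> {-L<..L}" for t
      unfolding S'_def using that by (intro measurable_step_kernel valid) (auto simp: window_def)
    moreover have "boundary L \<in> borel_measurable S'"
    proof -
      have [measurable]: "slice P (-L) \<in> measurable S' (state_measure P)" "slice P L \<in> measurable S' (state_measure P)"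
        unfolding S'_def using L by (intro measurable_slice; auto simp: window_def)+
      note [measurable] = v_meas w_meas
      show ?thesis unfolding boundary_def by measurable
    qed
    ultimately show ?thesis unfolding q'_def by measurable
  qed
  have slice_f: "slice P t (f x) = x (g t)" if "x \<in> space S" "t \<in> {-L..L}" for x t
  proof -
    have "g t \<in> {1..n}" using bij that by (auto simp: bij_betw_def)
    then have "x (g t) \<in> extensional (comps P)"
      using that by (auto simp: S_eq space_PiM PiE_def)
    then show ?thesis
      using that by (auto simp: slice_def f_def window_def extensional_def fun_eq_iff)
  qed
  have q_eq: "q x = q' (f x)" if x: "x \<in> space S" for x
  proof -
    have "(\<Prod>t\<in>{-L<..L}. step_kernel P (comps P) t (f x)) = (\<Prod>t\<in>{-L<..L}. interaction_kernel P (x (g t - 1)) (x (g t)))"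
    proof (rule prod.cong[OF refl])
      fix t assume t: "t \<in> {-L<..L}"
      have "g (t - 1) = g t - 1" using t by (simp add: g_def)
      then show "step_kernel P (comps P) t (f x) = interaction_kernel P (x (g t - 1)) (x (g t))"
        using t x interaction_kernel_slice[of P t "f x"] by (simp add: slice_f)
    qed
    also have "\<dots> = (\<Prod>t=2..n. interaction_kernel P (x (t - 1)) (x t))"
    proof (rule prod.reindex_bij_betw)
      show "bij_betw g {-L<..L} {2..n}"
        by (rule bij_betwI[where g="\<lambda>i. int i - L - 1"]) (use L in \<open>auto simp: g_def n_def\<close>)
    qed
    finally show ?thesis
      using L x slice_f[OF x, of "-L"] slice_f[OF x, of L]
      by (simp add: q_def q'_def boundary_def g_def n_def nat_diff_distrib ac_simps nat_add_distrib)
  qed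
  have fZ: "f (Z \<omega>) = restrict (coord \<omega>) (window L)" for \<omega>
  proof
    fix i
    show "f (Z \<omega>) i = restrict (coord \<omega>) (window L) i"
    proof (cases "i \<in> window L")
      case True
      then have "fst i \<in> {-L..L}" by (auto simp: window_def)
      then have "g (fst i) \<in> {1..n}" "int (g (fst i)) = fst i + L + 1"
        using bij by (auto simp: bij_betw_def g_def)
      then show ?thesis using True by (simp add: f_def Z_def coord_def)
    qed (simp add: f_def)
  qed
  have "distr M S' (\<lambda>\<omega>. f (Z \<omega>)) = distr (distr M S Z) S' f"
    using D by (subst distr_distr) (auto simp: comp_def distributed_def)
  also have "distr M S Z = density S (\<lambda>x. ennreal (q' (f x)))"
  proof -
    have "distr M S Z = density S (\<lambda>x. ennreal (q x))" using D by (simp add: distributed_def)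
    also have "\<dots> = density S (\<lambda>x. ennreal (q' (f x)))"
    proof (rule density_cong)
      show "(\<lambda>x. ennreal (q x)) \<in> borel_measurable S" using D by (simp add: distributed_def)
      show "(\<lambda>x. ennreal (q' (f x))) \<in> borel_measurable S" using q'_meas by measurable
    qed (simp add: q_eq)
    finally show ?thesis .
  qed
  also have "distr (density S (\<lambda>x. ennreal (q' (f x)))) S' f = density (distr S S' f) (\<lambda>x. ennreal (q' x))"
    using q'_meas by (intro density_distr[symmetric]) auto
  finally have "distr M S' (\<lambda>\<omega>. restrict (coord \<omega>) (window L)) = density S' (\<lambda>x. ennreal (q' x))"
    unfolding fZ distr_f .
  then show ?thesis
    using q'_meas coord_measurable[of "window L"] unfolding distributed_def S'_def q'_def
    by (auto simp: window_def)
qed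

section \<open>The one-time marginal and its tails\<close>

lemma identically_distributed:
  "distr M (state_measure P) (X t) = distr M (state_measure P) (X 0)"
proof -
  define S where "S = PiM {1..1::nat} (\<lambda>_. state_measure P)"
  define Z where "Z = (\<lambda>t \<omega>. \<lambda>i\<in>{1..1::nat}. X (t + int i - 1) \<omega>)"
  have proj: "(\<lambda>x. x 1) \<in> measurable S (state_measure P)"
    unfolding S_def by (rule measurable_component_singleton) simp
  have Z: "Z t \<in> measurable M S" for t
    unfolding Z_def S_def by (intro measurable_restrict X_meas)
  \<comment> \<open>The window density does not involve the starting time \<open>m\<close>.\<close>
  have D: "distr M S (Z t) = distr M S (Z 0)"
    using window_density[of 1 t] window_density[of 1 0] by (simp add: distributed_def S_def Z_def)
  have "distr M (state_measure P) (X t) = distr (distr M S (Z t)) (state_measure P) (\<lambda>x. x 1)" for t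
    by (subst distr_distr[OF proj Z]) (simp add: comp_def Z_def)
  then show ?thesis using D by simp
qed

lemma measurable_state_size_state:
  "state_size P \<in> borel_measurable (state_measure P)"
proof -
  have "(\<lambda>x. \<lambda>i\<in>{0} \<times> comps P. x (snd i)) \<in> measurable (state_measure P) (PiM ({0} \<times> comps P) (site_measure P))"
    unfolding state_measure_eq site_measure_def
    by (rule measurable_restrict, rule measurable_component_singleton) auto
  from measurable_compose[OF this measurable_state_size[OF valid order.refl]]
  have "(\<lambda>x. state_size P (\<lambda>b. (\<lambda>i\<in>{0::int} \<times> comps P. x (snd i)) (0, b))) \<in> borel_measurable (state_measure P)" .
  moreover have "state_size P (\<lambda>b. (\<lambda>i\<in>{0::int} \<times> comps P. x (snd i)) (0, b)) = state_size P x" for x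
    by (intro state_size_cong) simp
  ultimately show ?thesis by simp
qed

text \<open>Keeps the loss from truncation the same at all times, however far out the level n
  lies.\<close>

lemma state_size_tail:
  "prob {\<omega>\<in>space M. b < state_size P (X t \<omega>)} = prob {\<omega>\<in>space M. b < state_size P (X 0 \<omega>)}"
proof -
  note [measurable] = measurable_state_size_state X_meas
  let ?S = "{x\<in>space (state_measure P). b < state_size P x}"
  have "measure (distr M (state_measure P) (X t)) ?S = prob {\<omega>\<in>space M. b < state_size P (X t \<omega>)}" for t
  proof -
    have "X t -` ?S \<inter> space M = {\<omega>\<in>space M. b < state_size P (X t \<omega>)}"
      using measurable_space[OF X_meas[of t]] by blast
    then show ?thesis by (subst measure_distr[OF X_meas]) simp_all
  qed
  from this[of t] this[of 0] show ?thesis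
    by (simp add: identically_distributed[of t])
qed

lemma state_size_tail_tendsto:
  "(\<lambda>k. prob {\<omega>\<in>space M. real k < state_size P (X 0 \<omega>)}) \<longlonglongrightarrow> 0"
proof -
  note [measurable] = measurable_state_size_state X_meas
  let ?A = "\<lambda>k. {\<omega>\<in>space M. real k < state_size P (X 0 \<omega>)}"
  have "(\<lambda>k. prob (?A k)) \<longlonglongrightarrow> prob (\<Inter>k. ?A k)"
    by (rule finite_Lim_measure_decseq) (auto simp: decseq_def)
  moreover have "(\<Inter>k. ?A k) = {}"
  proof -
    have "\<exists>k. \<not> real k < y" for y using reals_Archimedean2[of y] less_asym by blast
    then show ?thesis by blast
  qed
  ultimately show ?thesis by simp
qed

text \<open>Defined as a pullback and not by generators, so that composing with the restricted
  coordinates yields \<open>cyl A\<close>-measurable functions and conditional expectations have the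
  shape of \<open>factorized_density_cond_exp\<close>.\<close>

definition cyl :: "(int \<times> nat) set \<Rightarrow> 'w measure" where
  "cyl A = vimage_algebra (space M) (\<lambda>\<omega>. restrict (coord \<omega>) A) (PiM A (site_measure P))"

lemma space_cyl[simp]: "space (cyl A) = space M"
  by (simp add: cyl_def)

lemma measurable_cyl:
  assumes "A \<subseteq> UNIV \<times> comps P"
  shows "(\<lambda>\<omega>. restrict (coord \<omega>) A) \<in> measurable (cyl A) (PiM A (site_measure P))"
  unfolding cyl_def
  by (rule measurable_vimage_algebra1) (auto intro: measurable_space[OF coord_measurable[OF assms]])

lemma measurable_cyl_subset:
  assumes "A \<subseteq> A'" "A' \<subseteq> UNIV \<times> comps P"
  shows "(\<lambda>\<omega>. restrict (coord \<omega>) A) \<in> measurable (cyl A') (PiM A (site_measure P))"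
  using measurable_compose[OF measurable_cyl[OF assms(2)] measurable_restrict_subset[OF assms(1)]] assms(1)
  by (simp add: Int_absorb1)

lemma subalgebra_cyl_cyl:
  assumes "A \<subseteq> A'" "A' \<subseteq> UNIV \<times> comps P"
  shows "subalgebra (cyl A') (cyl A)"
  using measurable_cyl_subset[OF assms] unfolding subalgebra_def cyl_def[of A]
  by (simp add: measurable_iff_sets)

lemma subalgebra_cyl:
  assumes "A \<subseteq> UNIV \<times> comps P"
  shows "subalgebra M (cyl A)"
  using coord_measurable[OF assms] unfolding subalgebra_def cyl_def
  by (simp add: measurable_iff_sets)

lemma sets_cyl_mono:
  "A \<subseteq> A' \<Longrightarrow> A' \<subseteq> UNIV \<times> comps P \<Longrightarrow> sets (cyl A) \<subseteq> sets (cyl A')"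
  using subalgebra_cyl_cyl[of A A'] by (simp add: subalgebra_def)

lemma window_subset: "window L \<subseteq> UNIV \<times> comps P" "finite (window L)"
  by (auto simp: window_def)

lemma comp_algebra_simps:
  "space (comp_algebra M X K) = space M"
  "sets (comp_algebra M X K) = sigma_sets (space M)
      {(\<lambda>\<omega>. X t \<omega> b) -` A \<inter> space M | t b A. b \<in> K \<and> A \<in> sets borel}"
  unfolding comp_algebra_def by (auto intro!: space_measure_of sets_measure_of)

lemma measurable_comp_algebra_coord:
  assumes K: "K \<subseteq> comps P" and A: "A \<subseteq> UNIV \<times> K"
  shows "(\<lambda>\<omega>. restrict (coord \<omega>) A) \<in> measurable (comp_algebra M X K) (PiM A (site_measure P))"
proof (rule measurable_restrict)
  fix i assume "i \<in> A"
  then have i: "snd i \<in> K" "snd i \<in> comps P" using A K by (cases i; auto)+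
  let ?R = "ref_measure P (snd i)"
  have sets_R: "sets ?R = sets (restrict_space borel (space ?R))"
    using valid i unfolding valid_stgm_def by blast
  have "(\<lambda>\<omega>. coord \<omega> i) \<in> measurable (comp_algebra M X K) borel"
  proof (rule measurableI)
    fix S :: "real set" assume "S \<in> sets borel"
    then show "(\<lambda>\<omega>. coord \<omega> i) -` S \<inter> space (comp_algebra M X K) \<in> sets (comp_algebra M X K)"
      unfolding comp_algebra_simps coord_def using i by (intro sigma_sets.Basic) blast
  qed simp
  moreover have "(\<lambda>\<omega>. coord \<omega> i) \<in> space (comp_algebra M X K) \<rightarrow> space ?R"
  proof
    fix \<omega> assume "\<omega> \<in> space (comp_algebra M X K)"
    then have "X (fst i) \<omega> \<in> space (state_measure P)"
      using measurable_space[OF X_meas] by (simp add: comp_algebra_simps)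
    then show "coord \<omega> i \<in> space ?R" using i by (auto simp: coord_def state_measure_def space_PiM)
  qed
  ultimately have "(\<lambda>\<omega>. coord \<omega> i) \<in> measurable (comp_algebra M X K) (restrict_space borel (space ?R))"
    by (rule measurable_restrict_space2[rotated])
  then show "(\<lambda>\<omega>. coord \<omega> i) \<in> measurable (comp_algebra M X K) (site_measure P i)"
    using i sets_R by (simp add: site_measure_def comp_measure_def cong: measurable_cong_sets)
qed

text \<open>Presents the history of a component set as a limit of finite windows. The union is
  increasing, which makes it a pi-system and the form that martingale convergence asks for.\<close>

lemma sets_comp_algebra:
  assumes K: "K \<subseteq> comps P"
  shows "sets (comp_algebra M X K) = sigma_sets (space M) (\<Union>k::nat. sets (cyl ({-int k..int k} \<times> K)))"
proof (rule antisym)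
  show "sets (comp_algebra M X K) \<subseteq> sigma_sets (space M) (\<Union>k::nat. sets (cyl ({-int k..int k} \<times> K)))"
    unfolding comp_algebra_simps
  proof (rule sigma_sets_mono, safe)
    fix t b and A :: "real set" assume b: "b \<in> K" and A: "A \<in> sets borel"
    let ?k = "nat \<bar>t\<bar>" and ?R = "ref_measure P b"
    let ?A = "{-int ?k..int ?k} \<times> K"
    have bC: "b \<in> comps P" and tb: "(t, b) \<in> ?A" using b K by auto
    have sets_R: "sets ?R = sets (restrict_space borel (space ?R))"
      using valid bC unfolding valid_stgm_def by blast
    have AC: "?A \<subseteq> UNIV \<times> comps P" using K by auto
    have meas: "(\<lambda>\<omega>. X t \<omega> b) \<in> measurable (cyl ?A) ?R"
      using measurable_compose[OF measurable_cyl[OF AC] site_measure_component[OF tb]] bC tb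
      by (simp add: coord_def)
    \<comment> \<open>\<open>comp_algebra\<close> tests all Borel sets of the line,
      \<open>cyl\<close> only those inside the state space of \<open>b\<close>; this makes no
      difference because the process stays in that space.\<close>
    have "A \<inter> space ?R \<in> sets ?R"
      using A by (subst sets_R) (auto simp: sets_restrict_space)
    from measurable_sets[OF meas this]
    have "(\<lambda>\<omega>. X t \<omega> b) -` (A \<inter> space ?R) \<inter> space M \<in> sets (cyl ?A)" by simp
    moreover have "(\<lambda>\<omega>. X t \<omega> b) -` (A \<inter> space ?R) \<inter> space M = (\<lambda>\<omega>. X t \<omega> b) -` A \<inter> space M"
      using measurable_space[OF meas] by auto
    ultimately have "(\<lambda>\<omega>. X t \<omega> b) -` A \<inter> space M \<in> sets (cyl ?A)" by metis
    then show "(\<lambda>\<omega>. X t \<omega> b) -` A \<inter> space M \<in> sigma_sets (space M) (\<Union>k::nat. sets (cyl ({-int k..int k} \<times> K)))"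
      by (intro sigma_sets.Basic UN_I[of ?k UNIV]) simp_all
  qed
next
  have "sets (cyl ({-int k..int k} \<times> K)) \<subseteq> sets (comp_algebra M X K)" for k
  proof -
    have "{-int k..int k} \<times> K \<subseteq> UNIV \<times> K" by auto
    from measurable_comp_algebra_coord[OF K this] show ?thesis
      unfolding cyl_def by (simp add: measurable_iff_sets comp_algebra_simps(1))
  qed
  then show "sigma_sets (space M) (\<Union>k::nat. sets (cyl ({-int k..int k} \<times> K))) \<subseteq> sets (comp_algebra M X K)"
    using sets.sigma_sets_subset[of "\<Union>k::nat. sets (cyl ({-int k..int k} \<times> K))" "comp_algebra M X K"]
    by (auto simp: comp_algebra_simps(1))
qed

lemma subalgebra_comp_algebra:
  assumes K: "K \<subseteq> comps P"
  shows "subalgebra M (comp_algebra M X K)"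
proof -
  have "sets (cyl ({-int k..int k} \<times> K)) \<subseteq> sets M" for k
    using subalgebra_cyl[of "{-int k..int k} \<times> K"] K by (auto simp: subalgebra_def)
  then have "sigma_sets (space M) (\<Union>k::nat. sets (cyl ({-int k..int k} \<times> K))) \<subseteq> sets M"
    by (intro sets.sigma_sets_subset) auto
  then show ?thesis
    by (simp add: subalgebra_def comp_algebra_simps(1) sets_comp_algebra[OF K])
qed

text \<open>One nonnegative factor is enough, since \<open>ennreal\<close> cuts off negative values
  and is multiplicative once either factor is nonnegative. This matters because the sign of
  \<open>boundary\<close> is not controlled pointwise. \<open>Q\<close> is left free to cover both
  \<open>M\<close> and its reweighting.\<close>

lemma window_cond_exp:
  fixes f h :: "(int \<times> nat \<Rightarrow> real) \<Rightarrow> real" and \<psi> :: "(int \<times> nat \<Rightarrow> real) \<Rightarrow> real"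
  assumes UK: "U \<subseteq> window L" "K \<subseteq> U" and Q: "finite_measure Q" "space Q = space M"
    and f: "f \<in> borel_measurable (PiM U (site_measure P))"
    and h: "h \<in> borel_measurable (PiM (K \<union> (window L - U)) (site_measure P))"
    and pos: "(\<forall>x. 0 \<le> f x) \<or> (\<forall>x. 0 \<le> h x)"
    and Z: "distributed Q (PiM (window L) (site_measure P)) (\<lambda>\<omega>. restrict (coord \<omega>) (window L)) (\<lambda>x. ennreal (q x))"
    and q: "\<And>x. q x = f (restrict x U) * h (restrict x (K \<union> (window L - U)))"
    and A: "A \<subseteq> K \<union> (window L - U)"
    and \<psi>: "\<psi> \<in> borel_measurable (PiM A (site_measure P))" and \<psi>_bounds: "\<And>x. 0 \<le> \<psi> x" "\<And>x. \<psi> x \<le> 1"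
  obtains c where "c \<in> borel_measurable (PiM K (site_measure P))" "\<And>x. 0 \<le> c x" "\<And>x. c x \<le> (1::real)"
    "AE \<omega> in Q. real_cond_exp Q (cyl U) (\<lambda>\<omega>. \<psi> (restrict (coord \<omega>) A)) \<omega> = c (restrict (coord \<omega>) K)"
proof -
  let ?V = "K \<union> (window L - U)"
  have int: "window L \<inter> U = U" "window L \<inter> K = K" "window L \<inter> ?V = ?V" "?V \<inter> A = A"
    using UK A by auto
  have dens: "(\<lambda>x. ennreal (q x)) = (\<lambda>x. ennreal (f (restrict x U)) * ennreal (h (restrict x ?V)))"
    using pos by (auto simp: q ennreal_mult' ennreal_mult'')
  have \<psi>': "(\<lambda>x. \<psi> (restrict x A)) \<in> borel_measurable (PiM ?V (site_measure P))"
    by (rule measurable_compose[OF measurable_restrict_subset[OF A] \<psi>])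
  obtain c where c: "c \<in> borel_measurable (PiM K (site_measure P))" "\<And>x. 0 \<le> c x" "\<And>x. c x \<le> (1::real)"
    "AE \<omega> in Q. real_cond_exp Q (vimage_algebra (space Q) (\<lambda>\<omega>. restrict (restrict (coord \<omega>) (window L)) U) (PiM U (site_measure P)))
      (\<lambda>\<omega>. \<psi> (restrict (restrict (restrict (coord \<omega>) (window L)) ?V) A)) \<omega> = c (restrict (restrict (coord \<omega>) (window L)) K)"
  proof (rule site.factorized_density_cond_exp[OF window_subset(2)[of L] UK Q(1) _ _ Z[unfolded dens] \<psi>' \<psi>_bounds])
    show "(\<lambda>x. ennreal (f x)) \<in> borel_measurable (PiM U (site_measure P))"
      using f by measurable
    show "(\<lambda>x. ennreal (h x)) \<in> borel_measurable (PiM ?V (site_measure P))"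
      using h by measurable
  qed blast
  show thesis
    by (rule that[OF c(1-3)]) (use c(4) in \<open>simp only: restrict_restrict int cyl_def Q(2)\<close>)
qed

lemma measurable_step_prod:
  assumes "D \<subseteq> comps P" "\<And>t. t \<in> T \<Longrightarrow> {t - 1, t} \<times> D \<subseteq> A"
  shows "(\<lambda>x. \<Prod>t\<in>T. step_kernel P D t x) \<in> borel_measurable (PiM A (site_measure P))"
  using measurable_step_kernel[OF valid assms(1,2)] by (intro borel_measurable_prod) auto

lemma step_prod_restrict:
  assumes "\<And>t. t \<in> T \<Longrightarrow> {t - 1, t} \<times> D \<subseteq> A"
  shows "(\<Prod>t\<in>T. step_kernel P D t (restrict x A)) = (\<Prod>t\<in>T. step_kernel P D t x)"
  using assms by (intro prod.cong refl step_kernel_restrict) blast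

lemma measurable_boundary:
  assumes "{-L, L} \<times> comps P \<subseteq> A"
  shows "boundary L \<in> borel_measurable (PiM A (site_measure P))"
proof -
  have [measurable]: "slice P (-L) \<in> measurable (PiM A (site_measure P)) (state_measure P)"
      "slice P L \<in> measurable (PiM A (site_measure P)) (state_measure P)"
    using assms by (intro measurable_slice; auto)+
  note [measurable] = v_meas w_meas
  show ?thesis unfolding boundary_def by measurable
qed

lemma boundary_restrict:
  assumes "{-L, L} \<times> comps P \<subseteq> A"
  shows "boundary L (restrict x A) = boundary L x"
proof -
  have "{-L} \<times> comps P \<subseteq> A" "{L} \<times> comps P \<subseteq> A" using assms by auto
  then show ?thesis by (simp add: boundary_def slice_restrict)
qed

end

section \<open>Separation of non-interacting components\<close>

text \<open>If all N drops exceeded C / N, a nonnegative sequence starting at most at C would lose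
  more than C.\<close>

lemma exists_small_decrement:
  fixes \<Phi> :: "nat \<Rightarrow> real"
  assumes "0 < N" "\<And>j. 0 \<le> \<Phi> j" "\<Phi> 0 \<le> C"
  obtains j where "j < N" "\<Phi> j - \<Phi> (Suc j) \<le> C / real N"
proof -
  have "\<exists>j<N. \<Phi> j - \<Phi> (Suc j) \<le> C / real N"
  proof (rule ccontr)
    assume "\<not> ?thesis"
    then have "(\<Sum>j<N. C / real N) < (\<Sum>j<N. \<Phi> j - \<Phi> (Suc j))"
      using assms(1) by (intro sum_strict_mono) auto
    also have "\<dots> = \<Phi> 0 - \<Phi> N" by (rule sum_lessThan_telescope')
    finally show False using assms(1) assms(2)[of N] assms(3) by simp
  qed
  then show thesis using that by blast
qed

text \<open>\<open>B\<close> is kept general so that both claims of the theorem are instances: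
  taking all non-neighbours leaves the neighbourhood as separating set, taking a single one leaves
  all remaining components.\<close>

locale separated_components = density_process P M X v w r
  for P :: stgm and M :: "'w measure" and X v w r +
  fixes a :: nat and B :: "nat set"
  assumes a: "a \<in> comps P" and B: "B \<subseteq> non_nbhd P a"
begin

section \<open>Index sets for the conditioning\<close>

definition sep :: "nat set" where
  "sep = comps P - {a} - B"

definition obs :: "int \<Rightarrow> (int \<times> nat) set" where
  "obs L = {-L..L} \<times> sep"

text \<open>The sites that define $E_n$. The set shrinks as \<open>n\<close> grows, so the
  conditioning becomes coarser.\<close>

definition outer :: "int \<Rightarrow> int \<Rightarrow> (int \<times> nat) set" where
  "outer L n = obs L \<union> ({-L..L} - {-n<..<n}) \<times> comps P"

text \<open>Of the fully observed times only the two that border the interior are kept; the interior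
  interacts with no others.\<close>

definition rim :: "int \<Rightarrow> int \<Rightarrow> (int \<times> nat) set" where
  "rim L n = obs L \<union> {-n, n} \<times> comps P"

lemma B_comps: "B \<subseteq> comps P" "a \<notin> B"
  using B by (auto simp: non_nbhd_def)

lemma sep_comps: "sep \<subseteq> comps P"
  by (auto simp: sep_def)

lemma obs_subset: "obs L \<subseteq> window L"
  using sep_comps by (auto simp: obs_def window_def)

lemma outer_subset: "outer L n \<subseteq> window L"
  using obs_subset[of L] by (auto simp: outer_def window_def)

lemma rim_subset: "0 < n \<Longrightarrow> n \<le> L \<Longrightarrow> rim L n \<subseteq> outer L n"
  by (auto simp: outer_def rim_def)

text \<open>Markov property in time. A step touches two successive times, so the factors split into
  those living on times of modulus at most n and those living on times of modulus at least n; once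
  the separating components are given, the two groups share only the sites of
  \<open>rim\<close>.\<close>

lemma interior_cond_exp:
  fixes \<psi> :: "(int \<times> nat \<Rightarrow> real) \<Rightarrow> real"
  assumes n: "0 < n" "n \<le> L" and A: "A \<subseteq> {-n<..<n} \<times> comps P"
    and \<psi>: "\<psi> \<in> borel_measurable (PiM A (site_measure P))" "\<And>x. 0 \<le> \<psi> x" "\<And>x. \<psi> x \<le> 1"
  obtains c where "c \<in> borel_measurable (PiM (rim L n) (site_measure P))" "\<And>x. 0 \<le> c x" "\<And>x. c x \<le> (1::real)"
    "AE \<omega> in M. real_cond_exp M (cyl (outer L n)) (\<lambda>\<omega>. \<psi> (restrict (coord \<omega>) A)) \<omega> = c (restrict (coord \<omega>) (rim L n))"
proof -
  let ?V = "rim L n \<union> (window L - outer L n)"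
  let ?T1 = "{-L<..L} - {-n<..n}" and ?T2 = "{-n<..n}"
  have T1: "{t - 1, t} \<times> comps P \<subseteq> outer L n" if "t \<in> ?T1" for t
    using that n by (auto simp: outer_def)
  have T2: "{t - 1, t} \<times> comps P \<subseteq> ?V" if "t \<in> ?T2" for t
    using that n by (auto simp: outer_def rim_def window_def)
  have bd: "{-L, L} \<times> comps P \<subseteq> outer L n"
    using n by (auto simp: outer_def)
  have AV: "A \<subseteq> ?V" using A n by (auto simp: outer_def rim_def window_def)
  have split: "(\<Prod>t\<in>{-L<..L}. step_kernel P (comps P) t x)
      = (\<Prod>t\<in>?T1. step_kernel P (comps P) t x) * (\<Prod>t\<in>?T2. step_kernel P (comps P) t x)" for x
    using n by (intro prod.subset_diff) auto
  have r1: "(\<Prod>t\<in>?T1. step_kernel P (comps P) t (restrict x (outer L n))) = (\<Prod>t\<in>?T1. step_kernel P (comps P) t x)" for x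
    by (rule step_prod_restrict, erule T1)
  have r2: "(\<Prod>t\<in>?T2. step_kernel P (comps P) t (restrict x ?V)) = (\<Prod>t\<in>?T2. step_kernel P (comps P) t x)" for x
    by (rule step_prod_restrict, erule T2)
  let ?f = "\<lambda>x. boundary L x * (\<Prod>t\<in>?T1. step_kernel P (comps P) t x)"
  let ?h = "\<lambda>x. \<Prod>t\<in>?T2. step_kernel P (comps P) t x"
  show thesis
  proof (rule window_cond_exp[where Q = M and U = "outer L n" and K = "rim L n" and \<psi> = \<psi> and A = A and f = ?f and h = ?h,
        OF outer_subset rim_subset[OF n] finite_measure_axioms refl _ _ _ coord_distributed _ AV \<psi> that])
    show "?f \<in> borel_measurable (PiM (outer L n) (site_measure P))"
      by (intro borel_measurable_times measurable_boundary[OF bd] measurable_step_prod[OF order.refl T1])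
    show "?h \<in> borel_measurable (PiM ?V (site_measure P))"
      by (rule measurable_step_prod[OF order.refl T2])
    show "(\<forall>x. 0 \<le> ?f x) \<or> (\<forall>x. 0 \<le> ?h x)"
      by (intro disjI2 allI prod_nonneg) (simp add: less_imp_le)
    show "boundary L x * (\<Prod>t\<in>{-L<..L}. step_kernel P (comps P) t x) = ?f (restrict x (outer L n)) * ?h (restrict x ?V)" for x
      unfolding r1 r2 boundary_restrict[OF bd] split by simp
  qed (use n in auto)
qed

text \<open>The eigenfunctions in the density do not factorise over the components, but they only see the
  times \<open>-L\<close> and \<open>L\<close>, at which the whole configuration is given here.\<close>

lemma interior_separation:
  fixes \<phi> \<psi> :: "(int \<times> nat \<Rightarrow> real) \<Rightarrow> real"
  assumes n: "0 < n" "n \<le> L" and A1: "A1 \<subseteq> {-n<..<n} \<times> {a}" and A2: "A2 \<subseteq> {-n<..<n} \<times> B"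
    and \<phi>: "\<phi> \<in> borel_measurable (PiM A1 (site_measure P))" "\<And>x. 0 \<le> \<phi> x" "\<And>x. \<phi> x \<le> 1"
    and \<psi>: "\<psi> \<in> borel_measurable (PiM A2 (site_measure P))" "\<And>x. 0 \<le> \<psi> x" "\<And>x. \<psi> x \<le> 1"
    and D: "D \<in> sets (cyl (obs L))"
  shows "(\<integral>\<omega>. indicator D \<omega> * (\<phi> (restrict (coord \<omega>) A1) * \<psi> (restrict (coord \<omega>) A2)) \<partial>M)
    = (\<integral>\<omega>. indicator D \<omega> * (real_cond_exp M (cyl (outer L n)) (\<lambda>\<omega>. \<phi> (restrict (coord \<omega>) A1)) \<omega>
        * real_cond_exp M (cyl (outer L n)) (\<lambda>\<omega>. \<psi> (restrict (coord \<omega>) A2)) \<omega>) \<partial>M)"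
proof -
  let ?K = "outer L n"
  \<comment> \<open>The interior of \<open>a\<close> is given in addition, so that only the interior
    of \<open>B\<close> remains to be integrated out.\<close>
  define U where "U = ?K \<union> {-n<..<n} \<times> {a}"
  let ?V = "?K \<union> (window L - U)"
  have UK: "U \<subseteq> window L" "?K \<subseteq> U" using outer_subset[of L n] a n by (auto simp: U_def window_def)
  have T1: "{t - 1, t} \<times> (comps P - B) \<subseteq> U" if "t \<in> {-L<..L}" for t
    using that n by (auto simp: U_def outer_def obs_def sep_def)
  have T2: "{t - 1, t} \<times> (comps P - {a}) \<subseteq> ?V" if "t \<in> {-L<..L}" for t
    using that n by (auto simp: U_def outer_def obs_def sep_def window_def)
  have T3: "{t - 1, t} \<times> (comps P - {a} - B) \<subseteq> ?V" if "t \<in> {-L<..L}" for t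
    using T2[OF that] by auto
  have bd: "{-L, L} \<times> comps P \<subseteq> ?V"
    using n by (auto simp: outer_def)
  have AV: "A2 \<subseteq> ?V" using A2 B_comps n by (auto simp: outer_def U_def window_def)
  note [measurable] = measurable_boundary[OF bd]
  have r1: "(\<Prod>t\<in>{-L<..L}. step_kernel P (comps P - B) t (restrict x U)) = (\<Prod>t\<in>{-L<..L}. step_kernel P (comps P - B) t x)" for x
    by (rule step_prod_restrict, erule T1)
  have r2: "(\<Prod>t\<in>{-L<..L}. step_kernel P (comps P - {a}) t (restrict x ?V)) = (\<Prod>t\<in>{-L<..L}. step_kernel P (comps P - {a}) t x)" for x
    by (rule step_prod_restrict, erule T2)
  have r3: "(\<Prod>t\<in>{-L<..L}. step_kernel P (comps P - {a} - B) t (restrict x ?V)) = (\<Prod>t\<in>{-L<..L}. step_kernel P (comps P - {a} - B) t x)" for x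
    by (rule step_prod_restrict, erule T3)
  \<comment> \<open>By \<open>step_kernel_split\<close> the first factor of every step avoids
    \<open>B\<close> and the quotient avoids \<open>a\<close>. \<open>boundary\<close> joins the
    quotient because its times belong to \<open>outer\<close>; the other product then supplies the
    known sign.\<close>
  let ?f = "\<lambda>x. \<Prod>t\<in>{-L<..L}. step_kernel P (comps P - B) t x"
  let ?h = "\<lambda>x. boundary L x * ((\<Prod>t\<in>{-L<..L}. step_kernel P (comps P - {a}) t x) / (\<Prod>t\<in>{-L<..L}. step_kernel P (comps P - {a} - B) t x))"
  obtain c where c: "c \<in> borel_measurable (PiM ?K (site_measure P))" "\<And>x. 0 \<le> c x" "\<And>x. c x \<le> (1::real)"
    "AE \<omega> in M. real_cond_exp M (cyl U) (\<lambda>\<omega>. \<psi> (restrict (coord \<omega>) A2)) \<omega> = c (restrict (coord \<omega>) ?K)"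
  proof (rule window_cond_exp[where Q = M and U = U and K = ?K and \<psi> = \<psi> and A = A2 and f = ?f and h = ?h,
        OF UK finite_measure_axioms refl _ _ _ coord_distributed _ AV \<psi>])
    show "?f \<in> borel_measurable (PiM U (site_measure P))"
      by (rule measurable_step_prod[OF _ T1]) auto
    have [measurable]: "(\<lambda>x. \<Prod>t\<in>{-L<..L}. step_kernel P (comps P - {a}) t x) \<in> borel_measurable (PiM ?V (site_measure P))"
      "(\<lambda>x. \<Prod>t\<in>{-L<..L}. step_kernel P (comps P - {a} - B) t x) \<in> borel_measurable (PiM ?V (site_measure P))"
      by (rule measurable_step_prod[OF _ T2] measurable_step_prod[OF _ T3]; auto)+
    show "?h \<in> borel_measurable (PiM ?V (site_measure P))"
      by measurable
    show "(\<forall>x. 0 \<le> ?f x) \<or> (\<forall>x. 0 \<le> ?h x)"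
      by (intro disjI1 allI prod_nonneg) (simp add: less_imp_le)
    show "boundary L x * (\<Prod>t\<in>{-L<..L}. step_kernel P (comps P) t x) = ?f (restrict x U) * ?h (restrict x ?V)" for x
      unfolding r1 r2 r3 boundary_restrict[OF bd] step_kernel_split[OF valid a B]
      by (simp add: prod.distrib prod_dividef)
  qed (use n in auto)
  have AC: "A1 \<subseteq> U" "A1 \<subseteq> UNIV \<times> comps P" "A2 \<subseteq> UNIV \<times> comps P" "U \<subseteq> UNIV \<times> comps P" "?K \<subseteq> UNIV \<times> comps P" "obs L \<subseteq> ?K"
    using A1 A2 B_comps a UK window_subset(1)[of L] by (auto simp: U_def outer_def)
  define m1 where "m1 = (\<lambda>\<omega>. \<phi> (restrict (coord \<omega>) A1))"
  define m2 where "m2 = (\<lambda>\<omega>. \<psi> (restrict (coord \<omega>) A2))"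
  define k where "k = (\<lambda>\<omega>. c (restrict (coord \<omega>) ?K))"
  interpret U: finite_measure_subalgebra M "cyl U"
    by (rule finite_measure_subalgebraI[OF subalgebra_cyl[OF AC(4)]])
  interpret K: finite_measure_subalgebra M "cyl ?K"
    by (rule finite_measure_subalgebraI[OF subalgebra_cyl[OF AC(5)]])
  have m1U: "m1 \<in> borel_measurable (cyl U)"
    unfolding m1_def by (rule measurable_compose[OF measurable_cyl_subset[OF AC(1,4)] \<phi>(1)])
  have kK: "k \<in> borel_measurable (cyl ?K)"
    unfolding k_def by (rule measurable_compose[OF measurable_cyl[OF AC(5)] c(1)])
  have DK: "D \<in> sets (cyl ?K)"
    using D subalgebra_cyl_cyl[OF AC(6,5)] by (auto simp: subalgebra_def)
  then have DU: "D \<in> sets (cyl U)"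
    using subalgebra_cyl_cyl[OF UK(2) AC(4)] by (auto simp: subalgebra_def)
  have [measurable]: "m1 \<in> borel_measurable M" "m2 \<in> borel_measurable M" "k \<in> borel_measurable M"
    unfolding m1_def m2_def k_def
    by (rule measurable_compose[OF coord_measurable[OF AC(2)] \<phi>(1)] measurable_compose[OF coord_measurable[OF AC(3)] \<psi>(1)]
        measurable_compose[OF coord_measurable[OF AC(5)] c(1)])+
  have [measurable]: "D \<in> sets M"
    using DK subalgebra_cyl[OF AC(5)] by (auto simp: subalgebra_def)
  have int: "integrable M (\<lambda>\<omega>. x \<omega> * y \<omega>)"
    if [measurable]: "x \<in> borel_measurable M" "y \<in> borel_measurable M"
      and "\<And>\<omega>. \<bar>x \<omega>\<bar> \<le> 1" "\<And>\<omega>. \<bar>y \<omega>\<bar> \<le> 1" for x y :: "'w \<Rightarrow> real"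
  proof (rule integrable_const_bound[where B=1])
    show "AE \<omega> in M. norm (x \<omega> * y \<omega>) \<le> 1"
      using that(3,4) by (auto simp: abs_mult intro!: mult_le_one)
  qed measurable
  have le: "\<bar>m1 \<omega>\<bar> \<le> 1" "\<bar>m2 \<omega>\<bar> \<le> 1" "\<bar>k \<omega>\<bar> \<le> 1" "\<bar>indicator D \<omega> * m1 \<omega>\<bar> \<le> 1" "\<bar>indicator D \<omega> * k \<omega>\<bar> \<le> 1" for \<omega>
    using \<phi> \<psi> c by (auto simp: m1_def m2_def k_def indicator_def)
  have m2_int: "integrable M m2" and k_int: "integrable M k"
    using le by (auto intro!: integrable_const_bound[where B=1])
  have U_eq: "AE \<omega> in M. real_cond_exp M (cyl U) m2 \<omega> = k \<omega>"
    using c(4) by (simp add: m2_def k_def)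
  \<comment> \<open>The conditional expectation given the larger \<open>cyl U\<close> is already a
    function of the sites in \<open>?K\<close>, so the tower property identifies it with the one
    given \<open>cyl ?K\<close>.\<close>
  have K_eq: "AE \<omega> in M. real_cond_exp M (cyl ?K) m2 \<omega> = k \<omega>"
  proof -
    have "AE \<omega> in M. real_cond_exp M (cyl ?K) (real_cond_exp M (cyl U) m2) \<omega> = real_cond_exp M (cyl ?K) m2 \<omega>"
      by (rule K.real_cond_exp_nested_subalg[OF subalgebra_cyl[OF AC(4)] subalgebra_cyl_cyl[OF UK(2) AC(4)] m2_int])
    moreover have "AE \<omega> in M. real_cond_exp M (cyl ?K) (real_cond_exp M (cyl U) m2) \<omega> = real_cond_exp M (cyl ?K) k \<omega>"
      by (rule K.real_cond_exp_cong[OF U_eq]) auto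
    moreover have "AE \<omega> in M. real_cond_exp M (cyl ?K) k \<omega> = k \<omega>"
      by (rule K.real_cond_exp_F_meas[OF k_int kK])
    ultimately show ?thesis by eventually_elim simp
  qed
  have "(\<integral>\<omega>. indicator D \<omega> * (m1 \<omega> * m2 \<omega>) \<partial>M) = (\<integral>\<omega>. (indicator D \<omega> * m1 \<omega>) * m2 \<omega> \<partial>M)"
    by (simp add: ac_simps)
  \<comment> \<open>\<open>m1\<close> is known to \<open>cyl U\<close>, so \<open>m2\<close> can be
    conditioned first. Its replacement \<open>k\<close> is known to \<open>cyl ?K\<close>, and then
    \<open>m1\<close> can be conditioned as well.\<close>
  also have "\<dots> = (\<integral>\<omega>. (indicator D \<omega> * m1 \<omega>) * real_cond_exp M (cyl U) m2 \<omega> \<partial>M)"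
    using m1U DU le by (intro U.real_cond_exp_intg(2)[symmetric] int) auto
  also have "\<dots> = (\<integral>\<omega>. (indicator D \<omega> * k \<omega>) * m1 \<omega> \<partial>M)"
    using U_eq by (intro integral_cong_AE) auto
  also have "\<dots> = (\<integral>\<omega>. (indicator D \<omega> * k \<omega>) * real_cond_exp M (cyl ?K) m1 \<omega> \<partial>M)"
    using kK DK le by (intro K.real_cond_exp_intg(2)[symmetric] int) auto
  also have "\<dots> = (\<integral>\<omega>. indicator D \<omega> * (real_cond_exp M (cyl ?K) m1 \<omega> * real_cond_exp M (cyl ?K) m2 \<omega>) \<partial>M)"
    using K_eq by (intro integral_cong_AE) auto
  finally show ?thesis by (simp add: m1_def m2_def)
qed

text \<open>Dividing the density by the kernels of the steps \<open>-n-1 \<rightarrow> -n\<close> and \<open>n \<rightarrow> n+1\<close> makes the inside and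
  the outside of \<open>{-n..n}\<close> conditionally independent given the separating components, so that a
  function of the inside which is close to a function of the outside is close to a function of
  those. Restricting to bounded states at the four times involved makes the change of measure
  bounded in both directions.\<close>

lemma decoupling:
  fixes g \<psi> :: "(int \<times> nat \<Rightarrow> real) \<Rightarrow> real" and b :: real
  assumes n: "0 \<le> n" "n < L"
    and A1: "A1 \<subseteq> obs L \<union> {-n..n} \<times> comps P" and A2: "A2 \<subseteq> outer L (n + 1)"
    and g: "g \<in> borel_measurable (PiM A1 (site_measure P))" "\<And>x. 0 \<le> g x" "\<And>x. g x \<le> 1"
    and \<psi>: "\<psi> \<in> borel_measurable (PiM A2 (site_measure P))" "\<And>x. 0 \<le> \<psi> x" "\<And>x. \<psi> x \<le> 1"
  defines "f \<equiv> \<lambda>\<omega>. g (restrict (coord \<omega>) A1)" and "p \<equiv> \<lambda>\<omega>. \<psi> (restrict (coord \<omega>) A2)"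
    and "\<kappa> \<equiv> (exp (b + b\<^sup>2 * cross_weight P))\<^sup>2"
  shows "(\<integral>\<omega>. (f \<omega> - real_cond_exp M (cyl (obs L)) f \<omega>)\<^sup>2 \<partial>M)
    \<le> 4 * prob {\<omega>\<in>space M. b < state_size P (X 0 \<omega>)} + \<kappa>\<^sup>2 * (\<integral>\<omega>. (f \<omega> - p \<omega>)\<^sup>2 \<partial>M)"
proof -
  let ?N = "site_measure P" and ?W = "window L" and ?st = "step_kernel P (comps P)"
  \<comment> \<open>\<open>good\<close> is the indicator of bounded states at the ends of the two
    steps to be removed, -n-1 to -n and n to n+1; \<open>h\<close> cancels exactly their
    kernels.\<close>
  define ok where "ok = (\<lambda>(s::int) x. if state_size P (\<lambda>c. x (s, c)) \<le> b then 1 else (0::real))"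
  define good where "good = (\<lambda>x. ok (-n-1) x * ok (-n) x * ok n x * ok (n+1) x)"
  define h where "h = (\<lambda>x. good x * (inverse (?st (-n) x) * inverse (?st (n+1) x)))"
  define U where "U = obs L \<union> {-n..n} \<times> comps P"
  define hw where "hw = (\<lambda>\<omega>. h (restrict (coord \<omega>) ?W))"
  define Q where "Q = density M (\<lambda>\<omega>. ennreal (hw \<omega>))"
  let ?V = "obs L \<union> (?W - U)"
  have V: "?V = outer L (n + 1)"
    using n obs_subset[of L] sep_comps by (auto simp: U_def outer_def obs_def window_def)
  have UW: "U \<subseteq> ?W" "obs L \<subseteq> U" using n obs_subset[of L] by (auto simp: U_def window_def)
  have times: "{s} \<times> comps P \<subseteq> ?W" if "s \<in> {-n-1, -n, n, n+1}" for s
    using that n by (auto simp: window_def)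
  have ok_meas: "ok s \<in> borel_measurable (PiM A ?N)" if "{s} \<times> comps P \<subseteq> A" for s A
    unfolding ok_def using measurable_state_size[OF valid that] by measurable
  have ok_restrict: "ok s (restrict x A) = ok s x" if "{s} \<times> comps P \<subseteq> A" for s A x
  proof -
    have "state_size P (\<lambda>c. restrict x A (s, c)) = state_size P (\<lambda>c. x (s, c))"
      using that by (intro state_size_cong) auto
    then show ?thesis by (simp add: ok_def)
  qed
  have h_meas: "h \<in> borel_measurable (PiM ?W ?N)"
    unfolding h_def good_def using n
    by (intro borel_measurable_times borel_measurable_inverse ok_meas measurable_step_kernel[OF valid order.refl])
      (auto simp: window_def)
  have \<kappa>: "0 < exp (b + b\<^sup>2 * cross_weight P)" by simp
  \<comment> \<open>\<kappa> is the square of the bound for one kernel because two are removed.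
    \<open>h x \<le> \<kappa>\<close> serves the passage to the new measure,
    \<open>good x \<le> \<kappa> * h x\<close> the way back.\<close>
  have h_bounds: "0 \<le> h x" "h x \<le> \<kappa>" "good x \<le> \<kappa> * h x" "0 \<le> good x" "good x \<le> 1" for x
  proof -
    have "(0 \<le> h x \<and> h x \<le> \<kappa> \<and> good x \<le> \<kappa> * h x) \<and> 0 \<le> good x \<and> good x \<le> 1"
    proof (cases "good x = 0")
      case True
      then show ?thesis by (simp add: h_def \<kappa>_def)
    next
      case False
      then have small: "state_size P (\<lambda>c. x (s, c)) \<le> b" if "s \<in> {-n-1, -n, n, n+1}" for s
        using that by (auto simp: good_def ok_def split: if_splits)
      then have good1: "good x = 1" by (simp add: good_def ok_def)
      let ?e = "exp (b + b\<^sup>2 * cross_weight P)"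
      note l = step_kernel_bounds[of P x "-n" b, OF small small] step_kernel_bounds[of P x "n+1" b, OF small small]
      have st: "?st (-n) x \<le> ?e" "inverse (?st (-n) x) \<le> ?e" "?st (n+1) x \<le> ?e" "inverse (?st (n+1) x) \<le> ?e"
        using l by auto
      have pos: "0 < ?st t x" for t by simp
      have "inverse (?st (-n) x) * inverse (?st (n+1) x) \<le> ?e * ?e"
        using st pos by (intro mult_mono) (auto simp: less_imp_le)
      moreover have "?st (-n) x * ?st (n+1) x \<le> ?e * ?e"
        using st pos by (intro mult_mono) (auto simp: less_imp_le)
      moreover have "1 = (?st (-n) x * ?st (n+1) x) * h x"
        by (simp add: h_def good1 field_simps)
      moreover have "0 \<le> h x" using pos by (simp add: h_def good1 less_imp_le)
      ultimately show ?thesis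
        using mult_right_mono[of "?st (-n) x * ?st (n+1) x" "?e * ?e" "h x"]
        by (simp add: good1 \<kappa>_def power2_eq_square h_def)
    qed
    then show "0 \<le> h x" "h x \<le> \<kappa>" "good x \<le> \<kappa> * h x" "0 \<le> good x" "good x \<le> 1" by auto
  qed
  have hw_meas[measurable]: "hw \<in> borel_measurable M"
    unfolding hw_def by (rule measurable_compose[OF coord_measurable[OF window_subset(1)] h_meas])
  have hw_bounds: "0 \<le> hw \<omega>" "hw \<omega> \<le> \<kappa>" for \<omega> using h_bounds by (auto simp: hw_def)
  have spaceQ: "space Q = space M" and setsQ: "sets Q = sets M" by (simp_all add: Q_def)
  have finQ: "finite_measure Q"
  proof (rule finite_measureI)
    have "emeasure Q (space Q) = (\<integral>\<^sup>+\<omega>. ennreal (hw \<omega>) \<partial>M)"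
      by (simp add: Q_def emeasure_density cong: nn_integral_cong)
    also have "\<dots> \<le> (\<integral>\<^sup>+\<omega>. ennreal \<kappa> \<partial>M)"
      using hw_bounds by (intro nn_integral_mono ennreal_leI) auto
    also have "\<dots> < \<infinity>" by (simp add: emeasure_space_1)
    finally show "emeasure Q (space Q) \<noteq> \<infinity>" by simp
  qed
  interpret Q: finite_measure Q by fact
  have Q_int: "(\<integral>\<omega>. u \<omega> \<partial>Q) = (\<integral>\<omega>. hw \<omega> * u \<omega> \<partial>M)" if "u \<in> borel_measurable M" for u :: "'w \<Rightarrow> real"
    using integral_density[of u M hw] that hw_bounds by (simp add: Q_def)
  define q where "q = (\<lambda>x. boundary L x * (\<Prod>t\<in>{-L<..L}. ?st t x) * h x)"
  have ZQ: "distributed Q (PiM ?W ?N) (\<lambda>\<omega>. restrict (coord \<omega>) ?W) (\<lambda>x. ennreal (q x))"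
  proof -
    have "distributed Q (PiM ?W ?N) (\<lambda>\<omega>. restrict (coord \<omega>) ?W)
        (\<lambda>x. ennreal (boundary L x * (\<Prod>t\<in>{-L<..L}. ?st t x)) * ennreal (h x))"
      unfolding Q_def hw_def using h_meas n by (intro distributed_density[OF coord_distributed]) auto
    then show ?thesis using h_bounds(1) by (simp add: q_def ennreal_mult'')
  qed
  \<comment> \<open>Without the steps indexed by -n and n+1, no factor reaches from the times of
    modulus at most n to those of modulus at least n+1.\<close>
  let ?T1 = "{-n<..n}" and ?T2 = "{-L<..L} - {-n..n+1}"
  let ?F = "\<lambda>x. (ok (-n) x * ok n x) * (\<Prod>t\<in>?T1. ?st t x)"
  let ?H = "\<lambda>x. (ok (-n-1) x * ok (n+1) x) * (boundary L x * (\<Prod>t\<in>?T2. ?st t x))"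
  have T1: "{t - 1, t} \<times> comps P \<subseteq> U" if "t \<in> ?T1" for t
    using that n by (auto simp: U_def)
  have T2: "{t - 1, t} \<times> comps P \<subseteq> ?V" if "t \<in> ?T2" for t
    using that n unfolding V by (auto simp: outer_def)
  have bd: "{-L, L} \<times> comps P \<subseteq> ?V"
    using n unfolding V by (auto simp: outer_def)
  have okU: "{-n} \<times> comps P \<subseteq> U" "{n} \<times> comps P \<subseteq> U"
    and okV: "{-n-1} \<times> comps P \<subseteq> ?V" "{n+1} \<times> comps P \<subseteq> ?V"
    using n unfolding V by (auto simp: U_def outer_def)
  have r1: "(\<Prod>t\<in>?T1. ?st t (restrict x U)) = (\<Prod>t\<in>?T1. ?st t x)" for x
    by (rule step_prod_restrict, erule T1)
  have r2: "(\<Prod>t\<in>?T2. ?st t (restrict x ?V)) = (\<Prod>t\<in>?T2. ?st t x)" for x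
    by (rule step_prod_restrict, erule T2)
  have split: "(\<Prod>t\<in>{-L<..L}. ?st t x) = (\<Prod>t\<in>?T1. ?st t x) * (?st (-n) x * ?st (n+1) x) * (\<Prod>t\<in>?T2. ?st t x)" for x
  proof -
    have "(\<Prod>t\<in>{-L<..L}. ?st t x) = (\<Prod>t\<in>?T2. ?st t x) * (\<Prod>t\<in>{-n..n+1}. ?st t x)"
      using n by (intro prod.subset_diff) auto
    also have "(\<Prod>t\<in>{-n..n+1}. ?st t x) = ?st (-n) x * (?st (n+1) x * (\<Prod>t\<in>?T1. ?st t x))"
    proof -
      have "{-n..n+1} = insert (-n) (insert (n+1) ?T1)" using n by auto
      then show ?thesis using n by simp
    qed
    finally show ?thesis by (simp add: ac_simps)
  qed
  obtain c where c: "c \<in> borel_measurable (PiM (obs L) ?N)" "\<And>x. 0 \<le> c x" "\<And>x. c x \<le> (1::real)"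
    "AE \<omega> in Q. real_cond_exp Q (cyl U) (\<lambda>\<omega>. \<psi> (restrict (coord \<omega>) A2)) \<omega> = c (restrict (coord \<omega>) (obs L))"
  proof (rule window_cond_exp[where Q = Q and U = U and K = "obs L" and \<psi> = \<psi> and A = A2 and f = ?F and h = ?H,
        OF UW finQ spaceQ _ _ _ ZQ _ _ \<psi>])
    show "?F \<in> borel_measurable (PiM U ?N)"
      by (intro borel_measurable_times ok_meas okU measurable_step_prod[OF order.refl T1])
    show "?H \<in> borel_measurable (PiM ?V ?N)"
      by (intro borel_measurable_times ok_meas okV measurable_boundary[OF bd] measurable_step_prod[OF order.refl T2])
    show "(\<forall>x. 0 \<le> ?F x) \<or> (\<forall>x. 0 \<le> ?H x)"
      by (intro disjI1 allI mult_nonneg_nonneg prod_nonneg) (auto simp: less_imp_le ok_def)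
    show "q x = ?F (restrict x U) * ?H (restrict x ?V)" for x
      unfolding r1 r2 boundary_restrict[OF bd] ok_restrict[OF okU(1)] ok_restrict[OF okU(2)]
        ok_restrict[OF okV(1)] ok_restrict[OF okV(2)] q_def h_def good_def split
      by (simp add: field_simps)
    show "A2 \<subseteq> ?V" using A2 V by simp
  qed blast
  have sub: "A1 \<subseteq> U" "A1 \<subseteq> UNIV \<times> comps P" "A2 \<subseteq> UNIV \<times> comps P" "U \<subseteq> UNIV \<times> comps P" "obs L \<subseteq> UNIV \<times> comps P"
    using A1 A2 UW window_subset(1)[of L] V outer_subset[of L "n+1"] by (auto simp: U_def)
  define k where "k = (\<lambda>\<omega>. c (restrict (coord \<omega>) (obs L)))"
  have f_U: "f \<in> borel_measurable (cyl U)"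
    unfolding f_def by (rule measurable_compose[OF measurable_cyl_subset[OF sub(1,4)] g(1)])
  have k_obs: "k \<in> borel_measurable (cyl (obs L))"
    unfolding k_def by (rule measurable_compose[OF measurable_cyl[OF sub(5)] c(1)])
  have [measurable]: "f \<in> borel_measurable M" "p \<in> borel_measurable M" "k \<in> borel_measurable M"
    unfolding f_def p_def k_def
    by (rule measurable_compose[OF coord_measurable[OF sub(2)] g(1)] measurable_compose[OF coord_measurable[OF sub(3)] \<psi>(1)]
        measurable_compose[OF coord_measurable[OF sub(5)] c(1)])+
  have unit: "0 \<le> f \<omega> \<and> f \<omega> \<le> 1" "0 \<le> p \<omega> \<and> p \<omega> \<le> 1" "0 \<le> k \<omega> \<and> k \<omega> \<le> 1" for \<omega>
    using g \<psi> c by (auto simp: f_def p_def k_def)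
  have sq: "0 \<le> (x - y)\<^sup>2 \<and> (x - y)\<^sup>2 \<le> 1" if "0 \<le> x \<and> x \<le> 1" "0 \<le> y \<and> y \<le> 1" for x y :: real
  proof -
    have "\<bar>x - y\<bar> \<le> 1" using that by auto
    then show ?thesis by (simp add: abs_square_le_1)
  qed
  have bounded_int: "integrable M u" if "u \<in> borel_measurable M" "\<And>\<omega>. 0 \<le> u \<omega> \<and> u \<omega> \<le> d" for u :: "'w \<Rightarrow> real" and d :: real
    using that by (auto intro!: integrable_const_bound[where B=d])
  have int_h: "integrable M (\<lambda>\<omega>. hw \<omega> * u \<omega>)" if "u \<in> borel_measurable M" "\<And>\<omega>. 0 \<le> u \<omega> \<and> u \<omega> \<le> 1" for u :: "'w \<Rightarrow> real"
  proof (rule bounded_int[of _ "\<kappa> * 1"])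
    show "0 \<le> hw \<omega> * u \<omega> \<and> hw \<omega> * u \<omega> \<le> \<kappa> * 1" for \<omega>
      using that(2)[of \<omega>] hw_bounds[of \<omega>] by (auto intro!: mult_mono mult_nonneg_nonneg simp del: mult_1_right)
  qed (use that(1) in measurable)
  \<comment> \<open>Under \<open>Q\<close> the conditional expectation of \<open>p\<close> given
    \<open>cyl U\<close> is \<open>k\<close>, whereas \<open>f\<close> is itself
    \<open>cyl U\<close>-measurable; conditioning does not increase the L^2 distance from
    \<open>p\<close> to \<open>f\<close>.\<close>
  have in_Q: "(\<integral>\<omega>. hw \<omega> * (f \<omega> - k \<omega>)\<^sup>2 \<partial>M) \<le> \<kappa> * (\<integral>\<omega>. (f \<omega> - p \<omega>)\<^sup>2 \<partial>M)"
  proof -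
    have subQ: "subalgebra Q (cyl U)"
      using subalgebra_cyl[OF sub(4)] by (simp add: subalgebra_def spaceQ setsQ)
    have pQ: "p \<in> borel_measurable Q" by (simp add: Q_def)
    have "(\<integral>\<omega>. (p \<omega> - f \<omega>)\<^sup>2 \<partial>Q) = (\<integral>\<omega>. (p \<omega> - real_cond_exp Q (cyl U) p \<omega>)\<^sup>2 \<partial>Q)
        + (\<integral>\<omega>. (real_cond_exp Q (cyl U) p \<omega> - f \<omega>)\<^sup>2 \<partial>Q)"
      using unit by (intro Q.real_cond_exp_pythagoras[OF subQ pQ f_U]) auto
    moreover have "0 \<le> (\<integral>\<omega>. (p \<omega> - real_cond_exp Q (cyl U) p \<omega>)\<^sup>2 \<partial>Q)"
      by simp
    moreover have "(\<integral>\<omega>. (real_cond_exp Q (cyl U) p \<omega> - f \<omega>)\<^sup>2 \<partial>Q) = (\<integral>\<omega>. (k \<omega> - f \<omega>)\<^sup>2 \<partial>Q)"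
    proof (rule integral_cong_AE)
      show "AE \<omega> in Q. (real_cond_exp Q (cyl U) p \<omega> - f \<omega>)\<^sup>2 = (k \<omega> - f \<omega>)\<^sup>2"
        using c(4) unfolding p_def k_def by eventually_elim simp
      show "(\<lambda>\<omega>. (k \<omega> - f \<omega>)\<^sup>2) \<in> borel_measurable Q" by (simp add: Q_def)
      have [measurable]: "f \<in> borel_measurable Q" by (simp add: Q_def)
      show "(\<lambda>\<omega>. (real_cond_exp Q (cyl U) p \<omega> - f \<omega>)\<^sup>2) \<in> borel_measurable Q" by measurable
    qed
    ultimately have "(\<integral>\<omega>. (k \<omega> - f \<omega>)\<^sup>2 \<partial>Q) \<le> (\<integral>\<omega>. (p \<omega> - f \<omega>)\<^sup>2 \<partial>Q)" by linarith
    then have "(\<integral>\<omega>. hw \<omega> * (k \<omega> - f \<omega>)\<^sup>2 \<partial>M) \<le> (\<integral>\<omega>. hw \<omega> * (p \<omega> - f \<omega>)\<^sup>2 \<partial>M)"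
      by (simp add: Q_int)
    also have "\<dots> \<le> (\<integral>\<omega>. \<kappa> * (p \<omega> - f \<omega>)\<^sup>2 \<partial>M)"
      using sq[OF unit(2,1)] hw_bounds
      by (intro integral_mono int_h integrable_mult_right bounded_int[of _ 1]) (auto intro!: mult_right_mono)
    finally show ?thesis by (simp add: power2_commute)
  qed
  \<comment> \<open>The product of the four indicators vanishes only if one of them does, and the
    four tails equal the one at time 0.\<close>
  have good_tail: "(\<integral>\<omega>. 1 - good (coord \<omega>) \<partial>M) \<le> 4 * prob {\<omega>\<in>space M. b < state_size P (X 0 \<omega>)}"
    and good_int: "integrable M (\<lambda>\<omega>. 1 - good (coord \<omega>))"
  proof -
    note [measurable] = measurable_compose[OF X_meas measurable_state_size_state]
    define bad where "bad = (\<lambda>s. {\<omega>\<in>space M. b < state_size P (X s \<omega>)})"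
    have bad[measurable]: "bad s \<in> sets M" for s unfolding bad_def by measurable
    have ok_bad: "ok s (coord \<omega>) = 1 - indicator (bad s) \<omega>" if "\<omega> \<in> space M" for s \<omega>
      using that by (auto simp: ok_def bad_def coord_def)
    have okm[measurable]: "(\<lambda>\<omega>. ok s (coord \<omega>)) \<in> borel_measurable M" for s
      unfolding ok_def coord_def by simp
    show "integrable M (\<lambda>\<omega>. 1 - good (coord \<omega>))"
      using h_bounds(4,5) by (intro bounded_int[of _ 1]) (auto simp: good_def)
    then have "(\<integral>\<omega>. 1 - good (coord \<omega>) \<partial>M)
        \<le> (\<integral>\<omega>. indicator (bad (-n-1)) \<omega> + indicator (bad (-n)) \<omega> + indicator (bad n) \<omega> + indicator (bad (n+1)) \<omega> \<partial>M)"
    proof (rule integral_mono)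
      show "1 - good (coord \<omega>) \<le> indicator (bad (-n-1)) \<omega> + indicator (bad (-n)) \<omega> + indicator (bad n) \<omega> + indicator (bad (n+1)) \<omega>"
        if "\<omega> \<in> space M" for \<omega>
        unfolding good_def ok_bad[OF that] by (auto simp: indicator_def)
    qed (auto intro!: bounded_int[of _ 4] simp: indicator_def)
    also have "\<dots> = prob (bad (-n-1)) + prob (bad (-n)) + prob (bad n) + prob (bad (n+1))"
      by (simp add: integrable_const_bound[where B=1])
    also have "\<dots> = 4 * prob {\<omega>\<in>space M. b < state_size P (X 0 \<omega>)}"
      unfolding bad_def state_size_tail[of b "-n-1"] state_size_tail[of b "-n"] state_size_tail[of b n] state_size_tail[of b "n+1"]
      by simp
    finally show "(\<integral>\<omega>. 1 - good (coord \<omega>) \<partial>M) \<le> 4 * prob {\<omega>\<in>space M. b < state_size P (X 0 \<omega>)}" .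
  qed
  have good_hw: "good (coord \<omega>) \<le> \<kappa> * hw \<omega>" for \<omega>
  proof -
    have "good (restrict (coord \<omega>) ?W) = good (coord \<omega>)"
      unfolding good_def using times by (simp add: ok_restrict)
    then show ?thesis using h_bounds(3)[of "restrict (coord \<omega>) ?W"] by (simp add: hw_def)
  qed
  \<comment> \<open>\<open>k\<close> is a function of the sites in \<open>obs L\<close>, hence a
    competitor for the projection.\<close>
  have "(\<integral>\<omega>. (f \<omega> - real_cond_exp M (cyl (obs L)) f \<omega>)\<^sup>2 \<partial>M) \<le> (\<integral>\<omega>. (f \<omega> - k \<omega>)\<^sup>2 \<partial>M)"
  proof -
    have "0 \<le> (\<integral>\<omega>. (real_cond_exp M (cyl (obs L)) f \<omega> - k \<omega>)\<^sup>2 \<partial>M)" by simp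
    moreover have "(\<integral>\<omega>. (f \<omega> - k \<omega>)\<^sup>2 \<partial>M) = (\<integral>\<omega>. (f \<omega> - real_cond_exp M (cyl (obs L)) f \<omega>)\<^sup>2 \<partial>M)
        + (\<integral>\<omega>. (real_cond_exp M (cyl (obs L)) f \<omega> - k \<omega>)\<^sup>2 \<partial>M)"
      using unit by (intro real_cond_exp_pythagoras[OF subalgebra_cyl[OF sub(5)] _ k_obs]) auto
    ultimately show ?thesis by linarith
  qed
  also have "\<dots> \<le> (\<integral>\<omega>. (1 - good (coord \<omega>)) + \<kappa> * (hw \<omega> * (f \<omega> - k \<omega>)\<^sup>2) \<partial>M)"
  proof (rule integral_mono)
    show "integrable M (\<lambda>\<omega>. (f \<omega> - k \<omega>)\<^sup>2)"
      using sq[OF unit(1,3)] by (intro bounded_int[of _ 1]) auto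
    show "integrable M (\<lambda>\<omega>. (1 - good (coord \<omega>)) + \<kappa> * (hw \<omega> * (f \<omega> - k \<omega>)\<^sup>2))"
      using sq[OF unit(1,3)] by (intro Bochner_Integration.integrable_add good_int integrable_mult_right int_h) auto
    fix \<omega>
    \<comment> \<open>Off the good states the square is bounded by 1; on them it is dominated by the
      weight of \<open>Q\<close>.\<close>
    have "(f \<omega> - k \<omega>)\<^sup>2 = (1 - good (coord \<omega>)) * (f \<omega> - k \<omega>)\<^sup>2 + good (coord \<omega>) * (f \<omega> - k \<omega>)\<^sup>2"
      by (simp add: algebra_simps)
    also have "\<dots> \<le> (1 - good (coord \<omega>)) * 1 + (\<kappa> * hw \<omega>) * (f \<omega> - k \<omega>)\<^sup>2"
      using sq[OF unit(1,3)] h_bounds(4,5) good_hw by (intro add_mono mult_left_mono mult_right_mono) auto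
    finally show "(f \<omega> - k \<omega>)\<^sup>2 \<le> (1 - good (coord \<omega>)) + \<kappa> * (hw \<omega> * (f \<omega> - k \<omega>)\<^sup>2)"
      by (simp add: ac_simps)
  qed
  also have "\<dots> = (\<integral>\<omega>. 1 - good (coord \<omega>) \<partial>M) + \<kappa> * (\<integral>\<omega>. hw \<omega> * (f \<omega> - k \<omega>)\<^sup>2 \<partial>M)"
    using sq[OF unit(1,3)] good_int int_h[of "\<lambda>\<omega>. (f \<omega> - k \<omega>)\<^sup>2"]
    by (subst Bochner_Integration.integral_add) auto
  also have "\<dots> \<le> 4 * prob {\<omega>\<in>space M. b < state_size P (X 0 \<omega>)} + \<kappa> * (\<kappa> * (\<integral>\<omega>. (f \<omega> - p \<omega>)\<^sup>2 \<partial>M))"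
    using good_tail in_Q by (intro add_mono mult_left_mono) (auto simp: \<kappa>_def)
  finally show ?thesis by (simp add: power2_eq_square ac_simps)
qed

section \<open>Comparison of the levels\<close>

lemma outer_antimono: "n \<le> n' \<Longrightarrow> outer L n' \<subseteq> outer L n"
  by (auto simp: outer_def)

lemma subspaces: "outer L n \<subseteq> UNIV \<times> comps P" "obs L \<subseteq> UNIV \<times> comps P" "obs L \<subseteq> outer L n"
  using outer_subset[of L n] obs_subset[of L] window_subset(1)[of L] by (auto simp: outer_def)

text \<open>Pythagoras with the zero function as approximation, applied to the conditional
  expectation at level n. Projecting that further to level n' gives the one at level n', because
  \<open>outer L n'\<close> is contained in \<open>outer L n\<close>.\<close>

lemma outer_norm_decrement:
  assumes n: "n \<le> n'" and m[measurable]: "m \<in> borel_measurable M" and m_bounds: "\<And>\<omega>. 0 \<le> m \<omega>" "\<And>\<omega>. m \<omega> \<le> (1::real)"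
  shows "(\<integral>\<omega>. (real_cond_exp M (cyl (outer L n)) m \<omega>)\<^sup>2 \<partial>M)
    = (\<integral>\<omega>. (real_cond_exp M (cyl (outer L n)) m \<omega> - real_cond_exp M (cyl (outer L n')) m \<omega>)\<^sup>2 \<partial>M)
      + (\<integral>\<omega>. (real_cond_exp M (cyl (outer L n')) m \<omega>)\<^sup>2 \<partial>M)"
proof -
  let ?e = "\<lambda>n. real_cond_exp M (cyl (outer L n)) m"
  have sub: "subalgebra M (cyl (outer L n))" for n
    by (rule subalgebra_cyl[OF subspaces(1)])
  interpret O: finite_measure_subalgebra M "cyl (outer L n')"
    by (rule finite_measure_subalgebraI[OF sub])
  have "integrable M m" using m_bounds by (auto intro!: integrable_const_bound[where B=1])
  then have nested: "AE \<omega> in M. real_cond_exp M (cyl (outer L n')) (?e n) \<omega> = ?e n' \<omega>"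
    by (intro O.real_cond_exp_nested_subalg[OF sub subalgebra_cyl_cyl[OF outer_antimono[OF n] subspaces(1)]])
  have "(\<integral>\<omega>. (?e n \<omega> - 0)\<^sup>2 \<partial>M) = (\<integral>\<omega>. (?e n \<omega> - real_cond_exp M (cyl (outer L n')) (?e n) \<omega>)\<^sup>2 \<partial>M)
      + (\<integral>\<omega>. (real_cond_exp M (cyl (outer L n')) (?e n) \<omega> - 0)\<^sup>2 \<partial>M)"
    using real_cond_exp_unit_interval[OF sub m m_bounds] by (intro real_cond_exp_pythagoras[OF sub]) auto
  also have "(\<integral>\<omega>. (?e n \<omega> - real_cond_exp M (cyl (outer L n')) (?e n) \<omega>)\<^sup>2 \<partial>M) = (\<integral>\<omega>. (?e n \<omega> - ?e n' \<omega>)\<^sup>2 \<partial>M)"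
    using nested by (intro integral_cong_AE) auto
  also have "(\<integral>\<omega>. (real_cond_exp M (cyl (outer L n')) (?e n) \<omega> - 0)\<^sup>2 \<partial>M) = (\<integral>\<omega>. (?e n' \<omega>)\<^sup>2 \<partial>M)"
    using nested by (intro integral_cong_AE) auto
  finally show ?thesis by simp
qed

text \<open>By \<open>interior_cond_exp\<close> the conditional expectation at level n is a function
  of \<open>rim L n\<close>, on the inside, and the one at level n+1 a function of
  \<open>rim L (n + 1)\<close>, on the outside: the input of \<open>decoupling\<close>. The tower
  property then replaces the projection of the former on the separating components by that of
  \<open>m\<close>.\<close>

lemma outer_near_obs:
  fixes \<psi> :: "(int \<times> nat \<Rightarrow> real) \<Rightarrow> real" and b :: real
  assumes n: "0 < n" "n < L" and A: "A \<subseteq> {-n<..<n} \<times> comps P"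
    and \<psi>: "\<psi> \<in> borel_measurable (PiM A (site_measure P))" "\<And>x. 0 \<le> \<psi> x" "\<And>x. \<psi> x \<le> 1"
  defines "m \<equiv> \<lambda>\<omega>. \<psi> (restrict (coord \<omega>) A)" and "\<kappa> \<equiv> (exp (b + b\<^sup>2 * cross_weight P))\<^sup>2"
  shows "(\<integral>\<omega>. (real_cond_exp M (cyl (outer L n)) m \<omega> - real_cond_exp M (cyl (obs L)) m \<omega>)\<^sup>2 \<partial>M)
    \<le> 4 * prob {\<omega>\<in>space M. b < state_size P (X 0 \<omega>)}
      + \<kappa>\<^sup>2 * (\<integral>\<omega>. (real_cond_exp M (cyl (outer L n)) m \<omega> - real_cond_exp M (cyl (outer L (n + 1))) m \<omega>)\<^sup>2 \<partial>M)"
proof -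
  let ?e = "\<lambda>n. real_cond_exp M (cyl (outer L n)) m"
  have n': "0 < n + 1" "n + 1 \<le> L" "n \<le> L" "0 \<le> n" using n by auto
  have A': "A \<subseteq> {-(n+1)<..<n+1} \<times> comps P" using A by auto
  have rim: "rim L n \<subseteq> obs L \<union> {-n..n} \<times> comps P" "rim L (n + 1) \<subseteq> outer L (n + 1)"
    using n by (auto simp: rim_def outer_def)
  obtain c where c: "c \<in> borel_measurable (PiM (rim L n) (site_measure P))" "\<And>x. 0 \<le> c x" "\<And>x. c x \<le> (1::real)"
    "AE \<omega> in M. ?e n \<omega> = c (restrict (coord \<omega>) (rim L n))"
    using interior_cond_exp[OF n(1) n'(3) A \<psi>] unfolding m_def by blast
  obtain d where d: "d \<in> borel_measurable (PiM (rim L (n + 1)) (site_measure P))" "\<And>x. 0 \<le> d x" "\<And>x. d x \<le> (1::real)"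
    "AE \<omega> in M. ?e (n + 1) \<omega> = d (restrict (coord \<omega>) (rim L (n + 1)))"
    using interior_cond_exp[OF n'(1,2) A' \<psi>] unfolding m_def by blast
  let ?f = "\<lambda>\<omega>. c (restrict (coord \<omega>) (rim L n))" and ?p = "\<lambda>\<omega>. d (restrict (coord \<omega>) (rim L (n + 1)))"
  have rimC: "rim L n \<subseteq> UNIV \<times> comps P" "rim L (n + 1) \<subseteq> UNIV \<times> comps P" "A \<subseteq> UNIV \<times> comps P"
    using sep_comps A by (auto simp: rim_def obs_def)
  have [measurable]: "?f \<in> borel_measurable M" "?p \<in> borel_measurable M" "m \<in> borel_measurable M"
    unfolding m_def by (rule measurable_compose[OF coord_measurable[OF rimC(1)] c(1)]
      measurable_compose[OF coord_measurable[OF rimC(2)] d(1)] measurable_compose[OF coord_measurable[OF rimC(3)] \<psi>(1)])+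
  interpret O: finite_measure_subalgebra M "cyl (obs L)"
    by (rule finite_measure_subalgebraI[OF subalgebra_cyl[OF subspaces(2)]])
  have "0 \<le> m \<omega>" "m \<omega> \<le> 1" for \<omega> using \<psi> by (auto simp: m_def)
  then have "integrable M m" by (auto intro!: integrable_const_bound[where B=1])
  then have "AE \<omega> in M. real_cond_exp M (cyl (obs L)) (?e n) \<omega> = real_cond_exp M (cyl (obs L)) m \<omega>"
    by (intro O.real_cond_exp_nested_subalg[OF subalgebra_cyl[OF subspaces(1)] subalgebra_cyl_cyl[OF subspaces(3,1)]])
  moreover have "AE \<omega> in M. real_cond_exp M (cyl (obs L)) (?e n) \<omega> = real_cond_exp M (cyl (obs L)) ?f \<omega>"
    by (rule O.real_cond_exp_cong[OF c(4)]) auto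
  ultimately have "AE \<omega> in M. ?f \<omega> - real_cond_exp M (cyl (obs L)) ?f \<omega> = ?e n \<omega> - real_cond_exp M (cyl (obs L)) m \<omega>"
    using c(4) by eventually_elim simp
  then have "(\<integral>\<omega>. (?e n \<omega> - real_cond_exp M (cyl (obs L)) m \<omega>)\<^sup>2 \<partial>M)
      = (\<integral>\<omega>. (?f \<omega> - real_cond_exp M (cyl (obs L)) ?f \<omega>)\<^sup>2 \<partial>M)"
    by (intro integral_cong_AE) auto
  also have "\<dots> \<le> 4 * prob {\<omega>\<in>space M. b < state_size P (X 0 \<omega>)} + \<kappa>\<^sup>2 * (\<integral>\<omega>. (?f \<omega> - ?p \<omega>)\<^sup>2 \<partial>M)"
    unfolding \<kappa>_def by (rule decoupling[OF n'(4) n(2) rim c(1-3) d(1-3)])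
  also have "(\<integral>\<omega>. (?f \<omega> - ?p \<omega>)\<^sup>2 \<partial>M) = (\<integral>\<omega>. (?e n \<omega> - ?e (n + 1) \<omega>)\<^sup>2 \<partial>M)"
    using c(4) d(4) by (intro integral_cong_AE) auto
  finally show ?thesis .
qed

text \<open>The pigeonhole is applied to the sum of both squared norms, at most 2 initially, to get
  one level for both functions. The levels k+1, ..., L-1 are available: the observables must lie
  strictly inside (-n, n), and level n+1 must still fit into the window. Hence the
  denominator.\<close>

lemma exists_level_near_obs:
  fixes \<phi> \<psi> :: "(int \<times> nat \<Rightarrow> real) \<Rightarrow> real" and b :: real
  assumes k: "0 \<le> k" "k + 1 < L" and A1: "A1 \<subseteq> {-k..k} \<times> comps P" and A2: "A2 \<subseteq> {-k..k} \<times> comps P"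
    and \<phi>: "\<phi> \<in> borel_measurable (PiM A1 (site_measure P))" "\<And>x. 0 \<le> \<phi> x" "\<And>x. \<phi> x \<le> 1"
    and \<psi>: "\<psi> \<in> borel_measurable (PiM A2 (site_measure P))" "\<And>x. 0 \<le> \<psi> x" "\<And>x. \<psi> x \<le> 1"
  defines "m1 \<equiv> \<lambda>\<omega>. \<phi> (restrict (coord \<omega>) A1)" and "m2 \<equiv> \<lambda>\<omega>. \<psi> (restrict (coord \<omega>) A2)"
    and "\<eta> \<equiv> 4 * prob {\<omega>\<in>space M. b < state_size P (X 0 \<omega>)}
      + ((exp (b + b\<^sup>2 * cross_weight P))\<^sup>2)\<^sup>2 * (2 / of_int (L - k - 1))"
  obtains n where "k < n" "n < L"
    "(\<integral>\<omega>. (real_cond_exp M (cyl (outer L n)) m1 \<omega> - real_cond_exp M (cyl (obs L)) m1 \<omega>)\<^sup>2 \<partial>M) \<le> \<eta>"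
    "(\<integral>\<omega>. (real_cond_exp M (cyl (outer L n)) m2 \<omega> - real_cond_exp M (cyl (obs L)) m2 \<omega>)\<^sup>2 \<partial>M) \<le> \<eta>"
proof -
  have AC: "A1 \<subseteq> UNIV \<times> comps P" "A2 \<subseteq> UNIV \<times> comps P" using A1 A2 by auto
  have m: "m1 \<in> borel_measurable M" "m2 \<in> borel_measurable M"
    unfolding m1_def m2_def by (rule measurable_compose[OF coord_measurable[OF AC(1)] \<phi>(1)]
      measurable_compose[OF coord_measurable[OF AC(2)] \<psi>(1)])+
  have mb: "0 \<le> m1 \<omega>" "m1 \<omega> \<le> 1" "0 \<le> m2 \<omega>" "m2 \<omega> \<le> 1" for \<omega>
    using \<phi> \<psi> by (auto simp: m1_def m2_def)
  define sqn where "sqn = (\<lambda>m n. \<integral>\<omega>. (real_cond_exp M (cyl (outer L n)) m \<omega>)\<^sup>2 \<partial>M)"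
  define dec where "dec = (\<lambda>m n. \<integral>\<omega>. (real_cond_exp M (cyl (outer L n)) m \<omega> - real_cond_exp M (cyl (outer L (n + 1))) m \<omega>)\<^sup>2 \<partial>M)"
  have dec_eq: "dec m n = sqn m n - sqn m (n + 1)" if "m = m1 \<or> m = m2" for m n
    using outer_norm_decrement[of n "n + 1" m1 L] outer_norm_decrement[of n "n + 1" m2 L] m mb that
    by (auto simp: dec_def sqn_def)
  have sqn_le: "sqn m n \<le> 1" if "m \<in> borel_measurable M" "\<And>\<omega>. 0 \<le> m \<omega>" "\<And>\<omega>. m \<omega> \<le> 1" for m n
  proof -
    have unit: "AE \<omega> in M. 0 \<le> real_cond_exp M (cyl (outer L n)) m \<omega> \<and> real_cond_exp M (cyl (outer L n)) m \<omega> \<le> 1"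
      by (rule real_cond_exp_unit_interval[OF subalgebra_cyl[OF subspaces(1)] that])
    have "sqn m n \<le> (\<integral>\<omega>. 1 \<partial>M)"
      unfolding sqn_def
    proof (rule integral_mono_AE)
      show le: "AE \<omega> in M. (real_cond_exp M (cyl (outer L n)) m \<omega>)\<^sup>2 \<le> 1"
        using unit by eventually_elim (simp add: power_le_one)
      show "integrable M (\<lambda>\<omega>. (real_cond_exp M (cyl (outer L n)) m \<omega>)\<^sup>2)"
        using le by (intro integrable_const_bound[where B=1]) auto
    qed simp
    then show ?thesis by (simp add: prob_space)
  qed
  define \<Phi> where "\<Phi> = (\<lambda>j. sqn m1 (k + 1 + int j) + sqn m2 (k + 1 + int j))"
  have "0 < nat (L - k - 1)" using k by simp
  moreover have "0 \<le> \<Phi> j" for j by (simp add: \<Phi>_def sqn_def)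
  moreover have "\<Phi> 0 \<le> 2" using sqn_le[OF m(1), of "k+1"] sqn_le[OF m(2), of "k+1"] mb by (simp add: \<Phi>_def)
  ultimately obtain j where j: "j < nat (L - k - 1)" "\<Phi> j - \<Phi> (Suc j) \<le> 2 / real (nat (L - k - 1))"
    using exists_small_decrement[of "nat (L - k - 1)" \<Phi> 2] by blast
  define n where "n = k + 1 + int j"
  have n: "k < n" "n < L" "0 < n" using j k by (auto simp: n_def)
  have An: "A1 \<subseteq> {-n<..<n} \<times> comps P" "A2 \<subseteq> {-n<..<n} \<times> comps P" using A1 A2 n by auto
  have Sj: "k + 1 + int (Suc j) = n + 1" by (simp add: n_def)
  have "\<Phi> j - \<Phi> (Suc j) = dec m1 n + dec m2 n"
    unfolding \<Phi>_def Sj by (simp add: dec_eq n_def)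
  moreover have "0 \<le> dec m1 n" "0 \<le> dec m2 n" by (simp_all add: dec_def)
  moreover have "real (nat (L - k - 1)) = of_int (L - k - 1)" using k by simp
  ultimately have small: "dec m1 n \<le> 2 / of_int (L - k - 1)" "dec m2 n \<le> 2 / of_int (L - k - 1)"
    using j(2) by auto
  let ?c = "((exp (b + b\<^sup>2 * cross_weight P))\<^sup>2)\<^sup>2"
  have "?c * dec m1 n \<le> ?c * (2 / of_int (L - k - 1))" "?c * dec m2 n \<le> ?c * (2 / of_int (L - k - 1))"
    using small by (intro mult_left_mono; simp)+
  with outer_near_obs[OF n(3,2) An(1) \<phi>, of b] outer_near_obs[OF n(3,2) An(2) \<psi>, of b]
  have "(\<integral>\<omega>. (real_cond_exp M (cyl (outer L n)) m1 \<omega> - real_cond_exp M (cyl (obs L)) m1 \<omega>)\<^sup>2 \<partial>M) \<le> \<eta>"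
    "(\<integral>\<omega>. (real_cond_exp M (cyl (outer L n)) m2 \<omega> - real_cond_exp M (cyl (obs L)) m2 \<omega>)\<^sup>2 \<partial>M) \<le> \<eta>"
    unfolding m1_def[symmetric] m2_def[symmetric] dec_def \<eta>_def by linarith+
  then show thesis by (rule that[OF n(1,2)])
qed

text \<open>Three factorisations are compared: the exact one at level n, the one given the
  separating components on the window, and the one given their whole history. The first two are
  close by \<open>exists_level_near_obs\<close>, the last two by martingale convergence.
  \<open>D\<close> and the observables stay fixed while the window grows.\<close>

lemma cylinder_factorization:
  fixes \<phi> \<psi> :: "(int \<times> nat \<Rightarrow> real) \<Rightarrow> real" and k :: nat
  assumes \<phi>: "\<phi> \<in> borel_measurable (PiM ({-int k..int k} \<times> {a}) (site_measure P))" "\<And>x. 0 \<le> \<phi> x" "\<And>x. \<phi> x \<le> 1"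
    and \<psi>: "\<psi> \<in> borel_measurable (PiM ({-int k..int k} \<times> B) (site_measure P))" "\<And>x. 0 \<le> \<psi> x" "\<And>x. \<psi> x \<le> 1"
    and D: "D \<in> sets (cyl (obs (int k)))"
  defines "m1 \<equiv> \<lambda>\<omega>. \<phi> (restrict (coord \<omega>) ({-int k..int k} \<times> {a}))"
    and "m2 \<equiv> \<lambda>\<omega>. \<psi> (restrict (coord \<omega>) ({-int k..int k} \<times> B))"
    and "F \<equiv> comp_algebra M X sep"
  shows "(\<integral>\<omega>. indicator D \<omega> * (m1 \<omega> * m2 \<omega>) \<partial>M)
    = (\<integral>\<omega>. indicator D \<omega> * (real_cond_exp M F m1 \<omega> * real_cond_exp M F m2 \<omega>) \<partial>M)" (is "?I = ?J")
proof -
  let ?A1 = "{-int k..int k} \<times> {a}" and ?A2 = "{-int k..int k} \<times> B"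
  have AC: "?A1 \<subseteq> {-int k..int k} \<times> comps P" "?A2 \<subseteq> {-int k..int k} \<times> comps P"
    "?A1 \<subseteq> UNIV \<times> comps P" "?A2 \<subseteq> UNIV \<times> comps P"
    using a B_comps by auto
  have [measurable]: "m1 \<in> borel_measurable M" "m2 \<in> borel_measurable M"
    unfolding m1_def m2_def by (rule measurable_compose[OF coord_measurable[OF AC(3)] \<phi>(1)]
      measurable_compose[OF coord_measurable[OF AC(4)] \<psi>(1)])+
  have mb: "0 \<le> m1 \<omega>" "m1 \<omega> \<le> 1" "0 \<le> m2 \<omega>" "m2 \<omega> \<le> 1" for \<omega>
    using \<phi> \<psi> by (auto simp: m1_def m2_def)
  have m_int: "integrable M m1" "integrable M m2"
    using mb by (auto intro!: integrable_const_bound[where B=1])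
  have F: "subalgebra M F" unfolding F_def by (rule subalgebra_comp_algebra[OF sep_comps])
  define e where "e = (\<lambda>L m. real_cond_exp M (cyl (obs L)) m)"
  have unit: "AE \<omega> in M. 0 \<le> real_cond_exp M G m1 \<omega> \<and> real_cond_exp M G m1 \<omega> \<le> 1"
    "AE \<omega> in M. 0 \<le> real_cond_exp M G m2 \<omega> \<and> real_cond_exp M G m2 \<omega> \<le> 1" if "subalgebra M G" for G
    using real_cond_exp_unit_interval[OF that] mb by auto
  have obs_sub: "subalgebra M (cyl (obs L))" for L
    by (rule subalgebra_cyl[OF subspaces(2)])
  have obs_mono: "sets (cyl (obs L)) \<subseteq> sets (cyl (obs L'))" if "L \<le> L'" for L L'
    by (rule sets_cyl_mono[OF _ subspaces(2)]) (use that in \<open>auto simp: obs_def\<close>)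
  have DM[measurable]: "D \<in> sets M" using D obs_sub by (auto simp: subalgebra_def)
  have up: "(\<lambda>j. \<integral>\<omega>. \<bar>e (int j) m \<omega> - real_cond_exp M F m \<omega>\<bar> \<partial>M) \<longlonglongrightarrow> 0" if "integrable M m" for m
    unfolding e_def F_def
    by (rule upward_cond_exp_tendsto[OF obs_sub subalgebra_comp_algebra[OF sep_comps] obs_mono _ that])
      (auto simp: sets_comp_algebra[OF sep_comps] obs_def)
  \<comment> \<open>Two comparisons, each with an error of \<delta> for either observable.\<close>
  have "\<bar>?I - ?J\<bar> \<le> 4 * \<delta>" if \<delta>: "0 < \<delta>" for \<delta> :: real
  proof -
    \<comment> \<open>The truncation bound is fixed before the window, since the constant
      \<open>C\<close> below depends on it.\<close>
    obtain j where j: "4 * prob {\<omega>\<in>space M. real j < state_size P (X 0 \<omega>)} \<le> \<delta>\<^sup>2 / 2"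
    proof -
      have "\<forall>\<^sub>F j in sequentially. prob {\<omega>\<in>space M. real j < state_size P (X 0 \<omega>)} < \<delta>\<^sup>2 / 8"
        using order_tendstoD(2)[OF state_size_tail_tendsto, of "\<delta>\<^sup>2 / 8"] \<delta> by simp
      then obtain j where "prob {\<omega>\<in>space M. real j < state_size P (X 0 \<omega>)} < \<delta>\<^sup>2 / 8"
        by (auto simp: eventually_sequentially)
      then show thesis by (intro that[of j]) simp
    qed
    define C where "C = ((exp (real j + (real j)\<^sup>2 * cross_weight P))\<^sup>2)\<^sup>2"
    have "(\<lambda>l. C * (2 / of_int (int l - int k - 1))) \<longlonglongrightarrow> 0"
    proof -
      have "filterlim (\<lambda>l. - (real k + 1) + real l) at_top sequentially"
        by (rule filterlim_tendsto_add_at_top[OF tendsto_const filterlim_real_sequentially])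
      then have "(\<lambda>l. (2 * C) / (- (real k + 1) + real l)) \<longlonglongrightarrow> 0"
        by (intro tendsto_divide_0[OF tendsto_const] filterlim_at_top_imp_at_infinity)
      then show ?thesis by (simp add: algebra_simps)
    qed
    then have "\<forall>\<^sub>F l in sequentially. C * (2 / of_int (int l - int k - 1)) < \<delta>\<^sup>2 / 2"
      using \<delta> by (intro order_tendstoD(2)) auto
    moreover have "\<forall>\<^sub>F l in sequentially. (\<integral>\<omega>. \<bar>e (int l) m1 \<omega> - real_cond_exp M F m1 \<omega>\<bar> \<partial>M) < \<delta>"
      "\<forall>\<^sub>F l in sequentially. (\<integral>\<omega>. \<bar>e (int l) m2 \<omega> - real_cond_exp M F m2 \<omega>\<bar> \<partial>M) < \<delta>"
      using order_tendstoD(2)[OF up] m_int \<delta> by auto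
    moreover have "\<forall>\<^sub>F l in sequentially. k + 2 \<le> l" by (rule eventually_ge_at_top)
    ultimately have "\<forall>\<^sub>F l in sequentially. C * (2 / of_int (int l - int k - 1)) < \<delta>\<^sup>2 / 2
        \<and> (\<integral>\<omega>. \<bar>e (int l) m1 \<omega> - real_cond_exp M F m1 \<omega>\<bar> \<partial>M) < \<delta>
        \<and> (\<integral>\<omega>. \<bar>e (int l) m2 \<omega> - real_cond_exp M F m2 \<omega>\<bar> \<partial>M) < \<delta> \<and> k + 2 \<le> l"
      by eventually_elim simp
    then obtain l where l: "C * (2 / of_int (int l - int k - 1)) < \<delta>\<^sup>2 / 2"
        "(\<integral>\<omega>. \<bar>e (int l) m1 \<omega> - real_cond_exp M F m1 \<omega>\<bar> \<partial>M) < \<delta>"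
        "(\<integral>\<omega>. \<bar>e (int l) m2 \<omega> - real_cond_exp M F m2 \<omega>\<bar> \<partial>M) < \<delta>" "k + 2 \<le> l"
      by (auto simp: eventually_sequentially)
    have kl: "0 \<le> int k" "int k + 1 < int l" using l(4) by auto
    obtain n where n: "int k < n" "n < int l"
      "(\<integral>\<omega>. (real_cond_exp M (cyl (outer (int l) n)) m1 \<omega> - e (int l) m1 \<omega>)\<^sup>2 \<partial>M) \<le> \<delta>\<^sup>2"
      "(\<integral>\<omega>. (real_cond_exp M (cyl (outer (int l) n)) m2 \<omega> - e (int l) m2 \<omega>)\<^sup>2 \<partial>M) \<le> \<delta>\<^sup>2"
    proof (rule exists_level_near_obs[OF kl AC(1,2) \<phi> \<psi>, of "real j"])
      fix n
      let ?\<eta> = "4 * prob {\<omega>\<in>space M. real j < state_size P (X 0 \<omega>)}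
        + ((exp (real j + (real j)\<^sup>2 * cross_weight P))\<^sup>2)\<^sup>2 * (2 / of_int (int l - int k - 1))"
      have \<eta>: "?\<eta> \<le> \<delta>\<^sup>2" using j l(1) unfolding C_def by linarith
      assume h: "int k < n" "n < int l"
        "(\<integral>\<omega>. (real_cond_exp M (cyl (outer (int l) n)) (\<lambda>\<omega>. \<phi> (restrict (coord \<omega>) ?A1)) \<omega>
          - real_cond_exp M (cyl (obs (int l))) (\<lambda>\<omega>. \<phi> (restrict (coord \<omega>) ?A1)) \<omega>)\<^sup>2 \<partial>M) \<le> ?\<eta>"
        "(\<integral>\<omega>. (real_cond_exp M (cyl (outer (int l) n)) (\<lambda>\<omega>. \<psi> (restrict (coord \<omega>) ?A2)) \<omega>
          - real_cond_exp M (cyl (obs (int l))) (\<lambda>\<omega>. \<psi> (restrict (coord \<omega>) ?A2)) \<omega>)\<^sup>2 \<partial>M) \<le> ?\<eta>"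
      show thesis
        by (rule that[unfolded e_def m1_def m2_def, OF h(1,2) order.trans[OF h(3) \<eta>] order.trans[OF h(4) \<eta>]])
    qed
    let ?o = "\<lambda>m. real_cond_exp M (cyl (outer (int l) n)) m"
    have o_sub: "subalgebra M (cyl (outer (int l) n))" by (rule subalgebra_cyl[OF subspaces(1)])
    have e_unit: "AE \<omega> in M. 0 \<le> e (int l) m1 \<omega> \<and> e (int l) m1 \<omega> \<le> 1" "AE \<omega> in M. 0 \<le> e (int l) m2 \<omega> \<and> e (int l) m2 \<omega> \<le> 1"
      unfolding e_def by (rule unit[OF obs_sub])+
    note u = unit[OF o_sub] e_unit unit[OF F]
    have e_meas[measurable]: "e L m \<in> borel_measurable M" for L m by (simp add: e_def)
    have ab1: "AE \<omega> in M. \<bar>?o m1 \<omega> - e (int l) m1 \<omega>\<bar> \<le> 1"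
      using u(1,3) by eventually_elim auto
    have ab2: "AE \<omega> in M. \<bar>?o m2 \<omega> - e (int l) m2 \<omega>\<bar> \<le> 1"
      using u(2,4) by eventually_elim auto
    have near: "(\<integral>\<omega>. \<bar>?o m1 \<omega> - e (int l) m1 \<omega>\<bar> \<partial>M) \<le> \<delta>" "(\<integral>\<omega>. \<bar>?o m2 \<omega> - e (int l) m2 \<omega>\<bar> \<partial>M) \<le> \<delta>"
      by (rule integral_abs_le_of_square[OF _ ab1 \<delta> n(3)] integral_abs_le_of_square[OF _ ab2 \<delta> n(4)]; measurable)+
    have I: "?I = (\<integral>\<omega>. indicator D \<omega> * (?o m1 \<omega> * ?o m2 \<omega>) \<partial>M)"
      unfolding m1_def m2_def
    proof (rule interior_separation[OF _ _ _ _ \<phi> \<psi>])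
      show "D \<in> sets (cyl (obs (int l)))" using D obs_mono[of "int k" "int l"] l(4) by auto
    qed (use n kl in auto)
    have "\<bar>?I - (\<integral>\<omega>. indicator D \<omega> * (e (int l) m1 \<omega> * e (int l) m2 \<omega>) \<partial>M)\<bar>
        \<le> (\<integral>\<omega>. \<bar>?o m1 \<omega> - e (int l) m1 \<omega>\<bar> \<partial>M) + (\<integral>\<omega>. \<bar>?o m2 \<omega> - e (int l) m2 \<omega>\<bar> \<partial>M)"
      unfolding I by (rule integral_prod_diff_le) (use u in auto)
    moreover have "\<bar>(\<integral>\<omega>. indicator D \<omega> * (e (int l) m1 \<omega> * e (int l) m2 \<omega>) \<partial>M) - ?J\<bar>
        \<le> (\<integral>\<omega>. \<bar>e (int l) m1 \<omega> - real_cond_exp M F m1 \<omega>\<bar> \<partial>M) + (\<integral>\<omega>. \<bar>e (int l) m2 \<omega> - real_cond_exp M F m2 \<omega>\<bar> \<partial>M)"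
      by (rule integral_prod_diff_le) (use u in auto)
    ultimately show ?thesis using near l(2,3) by linarith
  qed
  \<comment> \<open>A positive difference x would satisfy x \<le> 4 x / 5.\<close>
  from this[of "\<bar>?I - ?J\<bar> / 5"] show ?thesis by fastforce
qed

text \<open>Finite-window events generate the three sigma-algebras. Any three such events fit into a
  common window, and their indicators are functions of the coordinates with values in [0,1], which
  is the case settled by \<open>cylinder_factorization\<close>.\<close>

lemma cond_indep_separated:
  "cond_indep M (comp_algebra M X {a}) (comp_algebra M X B) (comp_algebra M X sep)"
proof -
  let ?E = "\<lambda>K. \<Union>k::nat. sets (cyl ({-int k..int k} \<times> K))"
  have aK: "{a} \<subseteq> comps P" using a by simp
  have mono: "sets (cyl ({-int k..int k} \<times> K)) \<subseteq> sets (cyl ({-int l..int l} \<times> K))"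
    if "k \<le> l" "K \<subseteq> comps P" for k l :: nat and K
    by (rule sets_cyl_mono) (use that in auto)
  have stable: "Int_stable (?E K)" if K: "K \<subseteq> comps P" for K
  proof (rule Int_stableI)
    fix A B assume "A \<in> ?E K" "B \<in> ?E K"
    then obtain m n where "A \<in> sets (cyl ({-int m..int m} \<times> K))" "B \<in> sets (cyl ({-int n..int n} \<times> K))" by auto
    then have "A \<in> sets (cyl ({-int (max m n)..int (max m n)} \<times> K))" "B \<in> sets (cyl ({-int (max m n)..int (max m n)} \<times> K))"
      using mono[OF _ K, of m "max m n"] mono[OF _ K, of n "max m n"] by (meson max.cobounded1 max.cobounded2 subsetD)+
    then show "A \<inter> B \<in> ?E K" by blast
  qed
  have top: "space M \<in> ?E K" for K
    using sets.top[of "cyl ({-int 0..int 0} \<times> K)"] by (intro UN_I[of 0]) auto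
  have cylinder: "\<exists>A'\<in>sets (PiM A (site_measure P)). S = (\<lambda>\<omega>. restrict (coord \<omega>) A) -` A' \<inter> space M"
    if "S \<in> sets (cyl A)" "A \<subseteq> UNIV \<times> comps P" for S A
  proof -
    have "(\<lambda>\<omega>. restrict (coord \<omega>) A) \<in> space M \<rightarrow> space (PiM A (site_measure P))"
      by (auto intro: measurable_space[OF coord_measurable[OF that(2)]])
    from that(1)[unfolded cyl_def sets_vimage_algebra2[OF this]] show ?thesis by blast
  qed
  interpret F: finite_measure_subalgebra M "comp_algebra M X sep"
    by (rule finite_measure_subalgebraI[OF subalgebra_comp_algebra[OF sep_comps]])
  show ?thesis
  proof (rule cond_indep_from_generators[OF subalgebra_comp_algebra[OF aK] subalgebra_comp_algebra[OF B_comps(1)]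
        subalgebra_comp_algebra[OF sep_comps] stable[OF aK] top sets_comp_algebra[OF aK]
        stable[OF B_comps(1)] top sets_comp_algebra[OF B_comps(1)] stable[OF sep_comps] top sets_comp_algebra[OF sep_comps]])
    fix S T D assume "S \<in> ?E {a}" "T \<in> ?E B" "D \<in> ?E sep"
    then obtain k1 k2 k3 where k': "S \<in> sets (cyl ({-int k1..int k1} \<times> {a}))" "T \<in> sets (cyl ({-int k2..int k2} \<times> B))"
      "D \<in> sets (cyl ({-int k3..int k3} \<times> sep))" by auto
    define k where "k = max k1 (max k2 k3)"
    have k: "S \<in> sets (cyl ({-int k..int k} \<times> {a}))" "T \<in> sets (cyl ({-int k..int k} \<times> B))" "D \<in> sets (cyl (obs (int k)))"
    proof -
      have le: "k1 \<le> k" "k2 \<le> k" "k3 \<le> k" by (simp_all add: k_def)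
      show "S \<in> sets (cyl ({-int k..int k} \<times> {a}))" by (rule subsetD[OF mono[OF le(1) aK] k'(1)])
      show "T \<in> sets (cyl ({-int k..int k} \<times> B))" by (rule subsetD[OF mono[OF le(2) B_comps(1)] k'(2)])
      show "D \<in> sets (cyl (obs (int k)))"
        unfolding obs_def by (rule subsetD[OF mono[OF le(3) sep_comps] k'(3)])
    qed
    let ?A1 = "{-int k..int k} \<times> {a}" and ?A2 = "{-int k..int k} \<times> B"
    have AC: "?A1 \<subseteq> UNIV \<times> comps P" "?A2 \<subseteq> UNIV \<times> comps P" using a B_comps by auto
    obtain S' where S': "S' \<in> sets (PiM ?A1 (site_measure P))" "S = (\<lambda>\<omega>. restrict (coord \<omega>) ?A1) -` S' \<inter> space M"
      using cylinder[OF k(1) AC(1)] by blast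
    obtain T' where T': "T' \<in> sets (PiM ?A2 (site_measure P))" "T = (\<lambda>\<omega>. restrict (coord \<omega>) ?A2) -` T' \<inter> space M"
      using cylinder[OF k(2) AC(2)] by blast
    let ?m1 = "\<lambda>\<omega>. indicator S' (restrict (coord \<omega>) ?A1) :: real" and ?m2 = "\<lambda>\<omega>. indicator T' (restrict (coord \<omega>) ?A2) :: real"
    have ind: "\<omega> \<in> space M \<Longrightarrow> indicator S \<omega> = ?m1 \<omega>" "\<omega> \<in> space M \<Longrightarrow> indicator T \<omega> = ?m2 \<omega>" for \<omega>
      by (auto simp: S'(2) T'(2) indicator_def)
    have ST[measurable]: "S \<in> sets M" "T \<in> sets M" "D \<in> sets M"
      using k subalgebra_cyl[OF AC(1)] subalgebra_cyl[OF AC(2)] subalgebra_cyl[OF subspaces(2)]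
      by (auto simp: subalgebra_def)
    have ind_meas: "(indicator S' :: _ \<Rightarrow> real) \<in> borel_measurable (PiM ?A1 (site_measure P))"
      "(indicator T' :: _ \<Rightarrow> real) \<in> borel_measurable (PiM ?A2 (site_measure P))"
      using S' T' by auto
    have [measurable]: "?m1 \<in> borel_measurable M" "?m2 \<in> borel_measurable M"
      by (rule measurable_compose[OF coord_measurable[OF AC(1)] ind_meas(1)] measurable_compose[OF coord_measurable[OF AC(2)] ind_meas(2)])+
    have ce: "AE \<omega> in M. real_cond_exp M (comp_algebra M X sep) (indicator S) \<omega> = real_cond_exp M (comp_algebra M X sep) ?m1 \<omega>"
      "AE \<omega> in M. real_cond_exp M (comp_algebra M X sep) (indicator T) \<omega> = real_cond_exp M (comp_algebra M X sep) ?m2 \<omega>"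
      by (rule F.real_cond_exp_cong; use ind in auto)+
    have "(\<integral>\<omega>. indicator D \<omega> * (indicator S \<omega> * indicator T \<omega>) \<partial>M) = (\<integral>\<omega>. indicator D \<omega> * (?m1 \<omega> * ?m2 \<omega>) \<partial>M)"
      by (intro Bochner_Integration.integral_cong refl) (simp add: ind)
    also have "\<dots> = (\<integral>\<omega>. indicator D \<omega> * (real_cond_exp M (comp_algebra M X sep) ?m1 \<omega> * real_cond_exp M (comp_algebra M X sep) ?m2 \<omega>) \<partial>M)"
      by (rule cylinder_factorization[OF ind_meas(1) _ _ ind_meas(2) _ _ k(3)]) (auto simp: indicator_def)
    also have "\<dots> = (\<integral>\<omega>. indicator D \<omega> * (real_cond_exp M (comp_algebra M X sep) (indicator S) \<omega>
        * real_cond_exp M (comp_algebra M X sep) (indicator T) \<omega>) \<partial>M)"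
      using ce by (intro integral_cong_AE) auto
    finally show "(\<integral>\<omega>. indicator D \<omega> * (indicator S \<omega> * indicator T \<omega>) \<partial>M)
      = (\<integral>\<omega>. indicator D \<omega> * (real_cond_exp M (comp_algebra M X sep) (indicator S) \<omega>
        * real_cond_exp M (comp_algebra M X sep) (indicator T) \<omega>) \<partial>M)" .
  qed
qed

end

theorem theorem2p4:
  fixes P :: stgm and M :: "'w measure" and X :: "int \<Rightarrow> 'w \<Rightarrow> nat \<Rightarrow> real"
  assumes "valid_stgm P"
    and "hilbert_schmidt (state_measure P) (interaction_kernel P)"
    and "cestgm_process P M X"
  shows "(\<forall>a\<in>comps P.
      cond_indep M (comp_algebra M X {a}) (comp_algebra M X (non_nbhd P a)) (comp_algebra M X (nbhd P a)))
    \<and> (\<forall>a\<in>comps P. \<forall>b\<in>comps P - {a}. b \<notin> nbhd P a \<longrightarrow>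
      cond_indep M (comp_algebra M X {a}) (comp_algebra M X {b}) (comp_algebra M X (comps P - {a, b})))"
proof -
  obtain v w where process: "prob_space M" "strictly_stationary M (state_measure P) X"
    and v: "v \<in> L2_space (state_measure P)" and w: "w \<in> L2_space (state_measure P)"
    and density: "\<And>m n. n \<ge> 1 \<Longrightarrow> distributed M (PiM {1..n} (\<lambda>_. state_measure P))
               (\<lambda>\<omega>. \<lambda>i\<in>{1..n}. X (m + int i - 1) \<omega>)
               (\<lambda>x. ennreal (inverse (L2_spectral_radius (state_measure P)
                   (kernel_op (state_measure P) (interaction_kernel P)) ^ (n - 1)) * v (x 1)
                       * (\<Prod>t=2..n. interaction_kernel P (x (t - 1)) (x t)) * w (x n)))"
    using assms(3) unfolding cestgm_process_def Let_def eigenfunction_def adjoint_eigenfunction_def by blast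
  have process: "separated_components P M X v w
      (L2_spectral_radius (state_measure P) (kernel_op (state_measure P) (interaction_kernel P))) a B"
    if "a \<in> comps P" "B \<subseteq> non_nbhd P a" for a B
    using process(2) v w that assms(1) density
    by (intro separated_components.intro separated_components_axioms.intro density_process.intro density_process_axioms.intro process(1))
      (auto simp: strictly_stationary_def L2_space_def)
  show ?thesis
  proof (intro conjI ballI impI)
    fix a assume a: "a \<in> comps P"
    have "separated_components.sep P a (non_nbhd P a) = nbhd P a"
      unfolding separated_components.sep_def[OF process[OF a order.refl]] by (auto simp: non_nbhd_def nbhd_def)
    then show "cond_indep M (comp_algebra M X {a}) (comp_algebra M X (non_nbhd P a)) (comp_algebra M X (nbhd P a))"
      using separated_components.cond_indep_separated[OF process[OF a order.refl]] by simp
  next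
    fix a b assume a: "a \<in> comps P" and b: "b \<in> comps P - {a}" "b \<notin> nbhd P a"
    have B: "{b} \<subseteq> non_nbhd P a" using b by (simp add: non_nbhd_def)
    have "separated_components.sep P a {b} = comps P - {a, b}"
      unfolding separated_components.sep_def[OF process[OF a B]] by auto
    then show "cond_indep M (comp_algebra M X {a}) (comp_algebra M X {b}) (comp_algebra M X (comps P - {a, b}))"
      using separated_components.cond_indep_separated[OF process[OF a B]] by simp
  qed
qed

end
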